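(* Let $T$ be a complete first-order theory with monster model $\mathcal U$ and let $\phi(x,y)$ be an NIP formula. Let $d=\mathrm{vc}(\phi)$, $n:=\min\{m\in\mathbb N:\tfrac12m>2^{d+1}-1\}$ and $k:=k_{\mathrm{sd}}(N_{\mathrm{pq}}(n,2^{d+1}),d)$. Then there exists a formula $\psi(x,z)$ (without parameters) such that if $A\subseteq\mathcal U^x$ is a (small) set with $|A|>1$ and $\Gamma$ is a $k$-hype in $\phi^{\mathrm{opp}}$ over $A$, then $\psi(x,z)$ is an honest definition of $\Gamma$ in the following sense: for every finite $A_0\subseteq A$ there is some $e\in A^z$ such that (1) if $a\in A_0$ and $\phi(a,y)\in\Gamma$ then $\psi(a,e)$ holds; (2) for all $a\in A$, if $\psi(a,e)$ holds, then $\phi(a,y)\in\Gamma$. Namely, one may take $$\psi(x,(\bar z,\bar z',\bar z'')):=\operatorname{Maj}_{i<n}\ \forall y\Big(\bigwedge_{j<k}\big(\phi(z_{i,j},y)\leftrightarrow(z'_{i,j}=z''_{i,j})\big)\rightarrow\phi(x,y)\Big),$$ where $\bar z=(z_{i,j})_{i<n,j<k}$, and similarly $\bar z',\bar z''$, consist of variables of the sort of $x$.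
   Context: $\mathcal U$ is a large saturated model of $T$; small means of cardinality $<|\mathcal U|$. $\phi(x,y)$ is NIP if the family $\{\phi(\mathcal U^x,b):b\in\mathcal U^y\}$ of subsets of $\mathcal U^x$ has finite VC-dimension, denoted $\mathrm{vc}(\phi)$. $z$ is a tuple of variables each of the sort of $x$ and $A^z$ is the set of corresponding tuples of elements of $A$. $\operatorname{Maj}_{i<n}P_i$ is $\bigvee_{I\subseteq n,|I|>n/2}\bigwedge_{i\in I}P_i$. For $A\subseteq\mathcal U^x$ and $k\in\mathbb N$, a $k$-hype in $\phi^{\mathrm{opp}}$ over $A$ is a set $\Gamma$ of formulas of the form $\phi(a,y)$ or $\neg\phi(a,y)$ with $a\in A$, such that every $S\subseteq\Gamma$ of size $\leq k$ is consistent (realised in $\mathcal U$), and for every $a\in A$ exactly one of $\phi(a,y),\neg\phi(a,y)$ is in $\Gamma$. Functions: $k_{\mathrm{comp}}(d)=2^{d+1}(d-2)+d+4$; $\binom{s}{\leq k}=\sum_{i\leq k}\binom si$; $B_{\mathrm{vc}}(n,k)=\max\{s\in\mathbb N:\binom{s}{\leq k}^n\geq 2^s\}$; $k_{\mathrm{sd}}(1,d)=k_{\mathrm{comp}}(d)+2d+2$ and $k_{\mathrm{sd}}(n,d)=n\cdot k_{\mathrm{sd}}(1,2^{B_{\mathrm{vc}}(n,2^{d+1})+1})$ for $n\neq1$. $N_{\mathrm{pq}}:\mathbb N^2\to\mathbb N$ is a fixed function as provided by the (known) $(p,q)$-theorem of Alon–Kleitman and Matoušek: for all $q\leq p<\omega$,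 if $(X,\mathcal F)$ is a finite set system of non-empty sets whose dual family $\{\{s\in\mathcal F:x\in s\}:x\in X\}$ has VC-dimension $<q$, and such that every $S\subseteq\mathcal F$ with $|S|\geq p$ contains $S_0\subseteq S$ with $|S_0|\geq q$ and $\bigcap S_0\neq\emptyset$, then there is $X_0\subseteq X$ with $|X_0|\leq N_{\mathrm{pq}}(p,q)$ meeting every $s\in\mathcal F$. *)

theory Defs
  imports Complex_Main "HOL-Library.Extended_Nat" "HOL-Library.Equipollence"
begin

type_synonym var = nat

datatype 'f tm = Var var | Fn 'f "'f tm list"

datatype ('f, 'r) fm =
    Bot
  | Eq "'f tm" "'f tm"
  | Rel 'r "'f tm list"
  | Neg "('f, 'r) fm"
  | Conj "('f, 'r) fm" "('f, 'r) fm"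
  | Disj "('f, 'r) fm" "('f, 'r) fm"
  | Imp "('f, 'r) fm" "('f, 'r) fm"
  | Iff "('f, 'r) fm" "('f, 'r) fm"
  | Forall var "('f, 'r) fm"
  | Exists var "('f, 'r) fm"

text \<open>A language is given by its function symbols and its relation symbols, each paired with its
  arity. Either set may be empty, and constants are function symbols of arity 0.\<close>

record ('f, 'r) lang =
  Funs :: "('f \<times> nat) set"
  Rels :: "('r \<times> nat) set"

fun wf_tm :: "('f, 'r) lang \<Rightarrow> 'f tm \<Rightarrow> bool" where
  "wf_tm L (Var v) = True"
| "wf_tm L (Fn f ts) = ((f, length ts) \<in> Funs L \<and> (\<forall>t \<in> set ts. wf_tm L t))"

fun wf_fm :: "('f, 'r) lang \<Rightarrow> ('f, 'r) fm \<Rightarrow> bool" where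
  "wf_fm L Bot = True"
| "wf_fm L (Eq s t) = (wf_tm L s \<and> wf_tm L t)"
| "wf_fm L (Rel r ts) = ((r, length ts) \<in> Rels L \<and> (\<forall>t \<in> set ts. wf_tm L t))"
| "wf_fm L (Neg A) = wf_fm L A"
| "wf_fm L (Conj A B) = (wf_fm L A \<and> wf_fm L B)"
| "wf_fm L (Disj A B) = (wf_fm L A \<and> wf_fm L B)"
| "wf_fm L (Imp A B) = (wf_fm L A \<and> wf_fm L B)"
| "wf_fm L (Iff A B) = (wf_fm L A \<and> wf_fm L B)"
| "wf_fm L (Forall v A) = wf_fm L A"
| "wf_fm L (Exists v A) = wf_fm L A"

fun vars_tm :: "'f tm \<Rightarrow> var set" where
  "vars_tm (Var v) = {v}"
| "vars_tm (Fn f ts) = (\<Union>t \<in> set ts. vars_tm t)"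

text \<open>Free variables (\<open>fv\<close>), and all variables occurring free or bound (\<open>vars_fm\<close>).\<close>

fun fv :: "('f, 'r) fm \<Rightarrow> var set" where
  "fv Bot = {}"
| "fv (Eq s t) = vars_tm s \<union> vars_tm t"
| "fv (Rel r ts) = (\<Union>t \<in> set ts. vars_tm t)"
| "fv (Neg A) = fv A"
| "fv (Conj A B) = fv A \<union> fv B"
| "fv (Disj A B) = fv A \<union> fv B"
| "fv (Imp A B) = fv A \<union> fv B"
| "fv (Iff A B) = fv A \<union> fv B"
| "fv (Forall v A) = fv A - {v}"
| "fv (Exists v A) = fv A - {v}"

fun vars_fm :: "('f, 'r) fm \<Rightarrow> var set" where
  "vars_fm Bot = {}"
| "vars_fm (Eq s t) = vars_tm s \<union> vars_tm t"
| "vars_fm (Rel r ts) = (\<Union>t \<in> set ts. vars_tm t)"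
| "vars_fm (Neg A) = vars_fm A"
| "vars_fm (Conj A B) = vars_fm A \<union> vars_fm B"
| "vars_fm (Disj A B) = vars_fm A \<union> vars_fm B"
| "vars_fm (Imp A B) = vars_fm A \<union> vars_fm B"
| "vars_fm (Iff A B) = vars_fm A \<union> vars_fm B"
| "vars_fm (Forall v A) = insert v (vars_fm A)"
| "vars_fm (Exists v A) = insert v (vars_fm A)"

text \<open>Replacing free variables by variables, without renaming bound variables. It is only used
  with new variables that do not occur in the formula, so that nothing gets captured.\<close>

fun rename_tm :: "(var \<Rightarrow> var) \<Rightarrow> 'f tm \<Rightarrow> 'f tm" where
  "rename_tm s (Var v) = Var (s v)"
| "rename_tm s (Fn f ts) = Fn f (map (rename_tm s) ts)"

fun rename :: "(var \<Rightarrow> var) \<Rightarrow> ('f, 'r) fm \<Rightarrow> ('f, 'r) fm" where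
  "rename s Bot = Bot"
| "rename s (Eq t u) = Eq (rename_tm s t) (rename_tm s u)"
| "rename s (Rel r ts) = Rel r (map (rename_tm s) ts)"
| "rename s (Neg A) = Neg (rename s A)"
| "rename s (Conj A B) = Conj (rename s A) (rename s B)"
| "rename s (Disj A B) = Disj (rename s A) (rename s B)"
| "rename s (Imp A B) = Imp (rename s A) (rename s B)"
| "rename s (Iff A B) = Iff (rename s A) (rename s B)"
| "rename s (Forall v A) = Forall v (rename (s(v := v)) A)"
| "rename s (Exists v A) = Exists v (rename (s(v := v)) A)"

record ('f, 'r, 'u) fo_struct =
  Univ :: "'u set"
  FnI :: "'f \<Rightarrow> 'u list \<Rightarrow> 'u"
  RelI :: "'r \<Rightarrow> 'u list \<Rightarrow> bool"

definition is_struct :: "('f, 'r) lang \<Rightarrow> ('f, 'r, 'u) fo_struct \<Rightarrow> bool" where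
  "is_struct L M \<longleftrightarrow> Univ M \<noteq> {} \<and>
     (\<forall>(f, m) \<in> Funs L. \<forall>us. length us = m \<longrightarrow> set us \<subseteq> Univ M \<longrightarrow> FnI M f us \<in> Univ M)"

fun val :: "('f, 'r, 'u) fo_struct \<Rightarrow> (var \<Rightarrow> 'u) \<Rightarrow> 'f tm \<Rightarrow> 'u" where
  "val M e (Var v) = e v"
| "val M e (Fn f ts) = FnI M f (map (val M e) ts)"

fun sat :: "('f, 'r, 'u) fo_struct \<Rightarrow> (var \<Rightarrow> 'u) \<Rightarrow> ('f, 'r) fm \<Rightarrow> bool" where
  "sat M e Bot = False"
| "sat M e (Eq s t) = (val M e s = val M e t)"
| "sat M e (Rel r ts) = RelI M r (map (val M e) ts)"
| "sat M e (Neg A) = (\<not> sat M e A)"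
| "sat M e (Conj A B) = (sat M e A \<and> sat M e B)"
| "sat M e (Disj A B) = (sat M e A \<or> sat M e B)"
| "sat M e (Imp A B) = (sat M e A \<longrightarrow> sat M e B)"
| "sat M e (Iff A B) = (sat M e A \<longleftrightarrow> sat M e B)"
| "sat M e (Forall v A) = (\<forall>u \<in> Univ M. sat M (e(v := u)) A)"
| "sat M e (Exists v A) = (\<exists>u \<in> Univ M. sat M (e(v := u)) A)"

definition sentence :: "('f, 'r) lang \<Rightarrow> ('f, 'r) fm \<Rightarrow> bool" where
  "sentence L \<sigma> \<longleftrightarrow> wf_fm L \<sigma> \<and> fv \<sigma> = {}"

definition models :: "('f, 'r) lang \<Rightarrow> ('f, 'r, 'u) fo_struct \<Rightarrow> ('f, 'r) fm set \<Rightarrow> bool" where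
  "models L M T \<longleftrightarrow> is_struct L M \<and> (\<forall>\<sigma> \<in> T. \<forall>e. sat M e \<sigma>)"

text \<open>Entailment \<open>T \<Turnstile> \<sigma>\<close> quantifies over structures whose universe is a subset of the type of
  formulas. This loses nothing: by Loewenheim-Skolem, if \<open>T \<union> {\<not>\<sigma>}\<close> has a model at all then it
  has one whose size is at most that of this (infinite) type.\<close>

definition entails :: "('f, 'r) lang \<Rightarrow> ('f, 'r) fm set \<Rightarrow> ('f, 'r) fm \<Rightarrow> bool" where
  "entails L T \<sigma> \<longleftrightarrow>
     (\<forall>M :: ('f, 'r, ('f, 'r) fm) fo_struct. models L M T \<longrightarrow> models L M {\<sigma>})"

definition complete_theory :: "('f, 'r) lang \<Rightarrow> ('f, 'r) fm set \<Rightarrow> bool" where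
  "complete_theory L T \<longleftrightarrow> (\<forall>\<sigma> \<in> T. sentence L \<sigma>) \<and>
     (\<forall>\<sigma>. sentence L \<sigma> \<longrightarrow> entails L T \<sigma> \<or> entails L T (Neg \<sigma>))"

definition small :: "('f, 'r, 'u) fo_struct \<Rightarrow> 'a set \<Rightarrow> bool" where
  "small M A \<longleftrightarrow> A \<prec> Univ M"

text \<open>A formula over \<open>A\<close> in the single variable \<open>v\<close> is represented by a formula \<open>\<theta>\<close> together with
  an assignment \<open>e\<close> sending every other free variable of \<open>\<theta>\<close> to a parameter in \<open>A\<close>.\<close>

definition saturated :: "('f, 'r) lang \<Rightarrow> ('f, 'r, 'u) fo_struct \<Rightarrow> bool" where
  "saturated L M \<longleftrightarrow> (\<forall>A v p.
     A \<subseteq> Univ M \<and> small M A \<and>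
     (\<forall>(\<theta>, e) \<in> p. wf_fm L \<theta> \<and> e ` (fv \<theta> - {v}) \<subseteq> A) \<and>
     (\<forall>q \<subseteq> p. finite q \<longrightarrow> (\<exists>c \<in> Univ M. \<forall>(\<theta>, e) \<in> q. sat M (e(v := c)) \<theta>)) \<longrightarrow>
     (\<exists>c \<in> Univ M. \<forall>(\<theta>, e) \<in> p. sat M (e(v := c)) \<theta>))"

definition monster_model :: "('f, 'r) lang \<Rightarrow> ('f, 'r) fm set \<Rightarrow> ('f, 'r, 'u) fo_struct \<Rightarrow> bool" where
  "monster_model L T M \<longleftrightarrow> models L M T \<and> saturated L M"


text \<open>\<open>tuples A x\<close> is \<open>A\<^sup>x\<close>. The entries of \<open>x\<close> are only counted: \<open>x\<close> may be a list of variables,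
  or a list \<open>z\<close> of tuples of variables when \<open>A\<close> is itself a set of tuples.\<close>

definition tuples :: "'a set \<Rightarrow> 'v list \<Rightarrow> 'a list set" where
  "tuples A x = {a. length a = length x \<and> set a \<subseteq> A}"

definition assign :: "var list \<Rightarrow> 'u list \<Rightarrow> var \<Rightarrow> 'u" where
  "assign vs us v = (case map_of (zip vs us) v of Some u \<Rightarrow> u | None \<Rightarrow> undefined)"

text \<open>\<open>holds M \<theta> x a y b\<close> is \<open>M \<Turnstile> \<theta>(a, b)\<close> for a formula \<open>\<theta>(x, y)\<close>.\<close>

definition holds ::
  "('f, 'r, 'u) fo_struct \<Rightarrow> ('f, 'r) fm \<Rightarrow> var list \<Rightarrow> 'u list \<Rightarrow> var list \<Rightarrow> 'u list \<Rightarrow> bool" where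
  "holds M \<theta> x a y b \<longleftrightarrow> sat M (assign (x @ y) (a @ b)) \<theta>"

definition partitioned :: "('f, 'r) lang \<Rightarrow> ('f, 'r) fm \<Rightarrow> var list \<Rightarrow> var list \<Rightarrow> bool" where
  "partitioned L \<theta> x y \<longleftrightarrow> wf_fm L \<theta> \<and> distinct (x @ y) \<and> fv \<theta> \<subseteq> set (x @ y)"


definition shatters :: "'a set set \<Rightarrow> 'a set \<Rightarrow> bool" where
  "shatters F S \<longleftrightarrow> (\<forall>B \<subseteq> S. \<exists>C \<in> F. C \<inter> S = B)"

definition vc_dim :: "'a set set \<Rightarrow> enat" where
  "vc_dim F = Sup {enat (card S) | S. finite S \<and> shatters F S}"

definition def_family ::
  "('f, 'r, 'u) fo_struct \<Rightarrow> ('f, 'r) fm \<Rightarrow> var list \<Rightarrow> var list \<Rightarrow> 'u list set set" where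
  "def_family M \<phi> x y = {{a \<in> tuples (Univ M) x. holds M \<phi> x a y b} | b. b \<in> tuples (Univ M) y}"

definition NIP :: "('f, 'r, 'u) fo_struct \<Rightarrow> ('f, 'r) fm \<Rightarrow> var list \<Rightarrow> var list \<Rightarrow> bool" where
  "NIP M \<phi> x y \<longleftrightarrow> vc_dim (def_family M \<phi> x y) < \<infinity>"

definition vc :: "('f, 'r, 'u) fo_struct \<Rightarrow> ('f, 'r) fm \<Rightarrow> var list \<Rightarrow> var list \<Rightarrow> nat" where
  "vc M \<phi> x y = the_enat (vc_dim (def_family M \<phi> x y))"


text \<open>Computed in the integers because of \<open>d - 2\<close>; the value is nonnegative for every \<open>d\<close>.\<close>

definition k_comp :: "nat \<Rightarrow> nat" where
  "k_comp d = nat (2 ^ (d + 1) * (int d - 2) + int d + 4)"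

definition choose_le :: "nat \<Rightarrow> nat \<Rightarrow> nat" where
  "choose_le s k = (\<Sum>i\<le>k. s choose i)"

definition B_vc :: "nat \<Rightarrow> nat \<Rightarrow> nat" where
  "B_vc n k = Max {s. choose_le s k ^ n \<ge> 2 ^ s}"

definition k_sd1 :: "nat \<Rightarrow> nat" where
  "k_sd1 d = k_comp d + 2 * d + 2"

definition k_sd :: "nat \<Rightarrow> nat \<Rightarrow> nat" where
  "k_sd n d = (if n = 1 then k_sd1 d else n * k_sd1 (2 ^ (B_vc n (2 ^ (d + 1)) + 1)))"

text \<open>\<open>N\<close> is a bound as in the \<open>(p, q)\<close>-theorem. As the set systems are finite, it is enough to
  consider those whose points are natural numbers.\<close>

definition pq_function :: "(nat \<Rightarrow> nat \<Rightarrow> nat) \<Rightarrow> bool" where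
  "pq_function N \<longleftrightarrow> (\<forall>p q (X :: nat set) F.
     q \<le> p \<and> finite X \<and> F \<subseteq> Pow X \<and> {} \<notin> F \<and>
     vc_dim ((\<lambda>x. {s \<in> F. x \<in> s}) ` X) < enat q \<and>
     (\<forall>S \<subseteq> F. card S \<ge> p \<longrightarrow> (\<exists>S0 \<subseteq> S. card S0 \<ge> q \<and> \<Inter>S0 \<noteq> {})) \<longrightarrow>
     (\<exists>X0 \<subseteq> X. card X0 \<le> N p q \<and> (\<forall>s \<in> F. X0 \<inter> s \<noteq> {})))"


text \<open>The instance \<open>\<theta>(a, y)\<close> of \<open>\<theta>(x, y)\<close> is represented by the pair \<open>(\<theta>, a)\<close>; thus \<open>(\<phi>, a)\<close> and
  \<open>(Neg \<phi>, a)\<close> stand for \<open>\<phi>(a, y)\<close> and \<open>\<not>\<phi>(a, y)\<close>.\<close>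

type_synonym ('f, 'r, 'u) inst = "('f, 'r) fm \<times> 'u list"

definition consistent ::
  "('f, 'r, 'u) fo_struct \<Rightarrow> var list \<Rightarrow> var list \<Rightarrow> ('f, 'r, 'u) inst set \<Rightarrow> bool" where
  "consistent M x y S \<longleftrightarrow> (\<exists>b \<in> tuples (Univ M) y. \<forall>(\<theta>, a) \<in> S. holds M \<theta> x a y b)"

definition hype_opp ::
  "('f, 'r, 'u) fo_struct \<Rightarrow> ('f, 'r) fm \<Rightarrow> var list \<Rightarrow> var list \<Rightarrow> nat \<Rightarrow> 'u list set
    \<Rightarrow> ('f, 'r, 'u) inst set \<Rightarrow> bool" where
  "hype_opp M \<phi> x y k A \<Gamma> \<longleftrightarrow>
     \<Gamma> \<subseteq> {\<phi>, Neg \<phi>} \<times> A \<and>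
     (\<forall>S \<subseteq> \<Gamma>. finite S \<and> card S \<le> k \<longrightarrow> consistent M x y S) \<and>
     (\<forall>a \<in> A. ((\<phi>, a) \<in> \<Gamma>) \<noteq> ((Neg \<phi>, a) \<in> \<Gamma>))"

text \<open>Here \<open>z\<close> is a list of tuples of variables, each of the sort of \<open>x\<close>, and correspondingly the
  parameter \<open>e \<in> A\<^sup>z\<close> is a list of elements of \<open>A\<close>.\<close>

definition honest_definition ::
  "('f, 'r, 'u) fo_struct \<Rightarrow> ('f, 'r) fm \<Rightarrow> var list \<Rightarrow> 'u list set \<Rightarrow> ('f, 'r, 'u) inst set
    \<Rightarrow> ('f, 'r) fm \<Rightarrow> var list list \<Rightarrow> bool" where
  "honest_definition M \<phi> x A \<Gamma> \<psi> z \<longleftrightarrow>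
     (\<forall>A0 \<subseteq> A. finite A0 \<longrightarrow> (\<exists>e \<in> tuples A z.
        (\<forall>a \<in> A0. (\<phi>, a) \<in> \<Gamma> \<longrightarrow> holds M \<psi> x a (concat z) (concat e)) \<and>
        (\<forall>a \<in> A. holds M \<psi> x a (concat z) (concat e) \<longrightarrow> (\<phi>, a) \<in> \<Gamma>)))"

definition z_partitioned ::
  "('f, 'r) lang \<Rightarrow> ('f, 'r) fm \<Rightarrow> var list \<Rightarrow> var list list \<Rightarrow> bool" where
  "z_partitioned L \<psi> x z \<longleftrightarrow>
     (\<forall>w \<in> set z. length w = length x) \<and> partitioned L \<psi> x (concat z)"


definition Conjs :: "('f, 'r) fm list \<Rightarrow> ('f, 'r) fm" where
  "Conjs As = foldr Conj As (Neg Bot)"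

definition Disjs :: "('f, 'r) fm list \<Rightarrow> ('f, 'r) fm" where
  "Disjs As = foldr Disj As Bot"

definition Foralls :: "var list \<Rightarrow> ('f, 'r) fm \<Rightarrow> ('f, 'r) fm" where
  "Foralls vs A = foldr Forall vs A"

definition Eqs :: "var list \<Rightarrow> var list \<Rightarrow> ('f, 'r) fm" where
  "Eqs vs ws = Conjs (map2 (\<lambda>v w. Eq (Var v) (Var w)) vs ws)"

text \<open>\<open>subst_tuple x w \<phi>\<close> is \<open>\<phi>(w, y)\<close> for \<open>\<phi>(x, y)\<close> and a tuple \<open>w\<close> of variables not occurring
  in \<open>\<phi>\<close>.\<close>

definition subst_tuple :: "var list \<Rightarrow> var list \<Rightarrow> ('f, 'r) fm \<Rightarrow> ('f, 'r) fm" where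
  "subst_tuple x w \<phi> = rename (\<lambda>v. case map_of (zip x w) v of Some u \<Rightarrow> u | None \<Rightarrow> v) \<phi>"

text \<open>\<open>subseqs [0..<n]\<close> lists each subset \<open>I\<close> of \<open>{0, ..., n - 1}\<close> once, as an increasing list.\<close>

definition Maj :: "nat \<Rightarrow> (nat \<Rightarrow> ('f, 'r) fm) \<Rightarrow> ('f, 'r) fm" where
  "Maj n P = Disjs [Conjs (map P I). I \<leftarrow> subseqs [0..<n], real (length I) > real n / 2]"

definition maj_formula ::
  "('f, 'r) fm \<Rightarrow> var list \<Rightarrow> var list \<Rightarrow> nat \<Rightarrow> nat \<Rightarrow> (nat \<Rightarrow> nat \<Rightarrow> var list)
    \<Rightarrow> (nat \<Rightarrow> nat \<Rightarrow> var list) \<Rightarrow> (nat \<Rightarrow> nat \<Rightarrow> var list) \<Rightarrow> ('f, 'r) fm" where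
  "maj_formula \<phi> x y n k z z' z'' =
     Maj n (\<lambda>i. Foralls y
       (Imp (Conjs (map (\<lambda>j. Iff (subst_tuple x (z i j) \<phi>) (Eqs (z' i j) (z'' i j))) [0..<k])) \<phi>))"

definition matrix_list :: "nat \<Rightarrow> nat \<Rightarrow> (nat \<Rightarrow> nat \<Rightarrow> 'a) \<Rightarrow> 'a list" where
  "matrix_list n k z = [z i j. i \<leftarrow> [0..<n], j \<leftarrow> [0..<k]]"

definition maj_vars ::
  "nat \<Rightarrow> nat \<Rightarrow> (nat \<Rightarrow> nat \<Rightarrow> var list) \<Rightarrow> (nat \<Rightarrow> nat \<Rightarrow> var list)
    \<Rightarrow> (nat \<Rightarrow> nat \<Rightarrow> var list) \<Rightarrow> var list list" where
  "maj_vars n k z z' z'' = matrix_list n k z @ matrix_list n k z' @ matrix_list n k z''"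

text \<open>The entries of \<open>zs\<close> are tuples of the sort of \<open>x\<close>, consisting of pairwise distinct variables
  which are new: they are not in \<open>x\<close> or \<open>y\<close> and occur neither free nor bound in \<open>\<phi>\<close>.\<close>

definition fresh_tuples ::
  "('f, 'r) fm \<Rightarrow> var list \<Rightarrow> var list \<Rightarrow> var list list \<Rightarrow> bool" where
  "fresh_tuples \<phi> x y zs \<longleftrightarrow> (\<forall>w \<in> set zs. length w = length x) \<and> distinct (concat zs) \<and>
     set (concat zs) \<inter> (set x \<union> set y \<union> vars_fm \<phi>) = {}"

end

theory Submission
  imports Defs "HOL-Library.Sublist"
begin

text \<open>Let \<open>F\<close> be the closure, in the space of all subsets, of the traces of the sets \<open>\<phi>(\<U>, b)\<close> on \<open>A\<close>,
  and let \<open>g\<close> be the set of those \<open>a\<close> with \<open>\<phi>(a, y) \<in> \<Gamma>\<close>. A member \<open>p\<close> of \<open>F\<close> is \<open>k\<close>-compressible if its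
  restriction to any finite set is implied, within \<open>F\<close>, by its restriction to some set of at most \<open>k\<close>
  points. It suffices to find \<open>k\<close>-compressible \<open>p\<^sub>0, \<dots>, p\<^sub>n\<^sub>-\<^sub>1 \<in> F\<close> whose majority is \<open>g\<close>.

  If there are none, then the error sets of any \<open>n\<close> compressible points have a point lying in \<open>2\<^sup>d\<^sup>+\<^sup>1\<close>
  of them, so by the \<open>(p, q)\<close>-theorem the error sets of any finitely many compressible points are all met
  by some \<open>N\<close> points of \<open>A\<close>. Hence there is an ultrafilter on \<open>A\<^sup>N\<close> such that each compressible point errs
  somewhere on almost every \<open>N\<close>-tuple. This is refuted by a compressible point that agrees with \<open>g\<close> on
  almost every \<open>N\<close>-tuple.

  Passing to the class of the sets of tuples on which a member of \<open>F\<close> agrees with \<open>g\<close>, whose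
  VC-dimension \<open>D\<close> is bounded by Sauer--Shelah, one has to find in a class whose members cover all sets of
  \<open>D + 1\<close> points a compressible member that belongs to a given ultrafilter. Compressible members exist
  in every closed class by the argument of Chen, Cheng and Tang for the recursive teaching dimension,
  with a minimal compressible subclass in place of a minimal nonempty cylinder. Applied to the limits of
  members containing \<open>D + 1\<close> generic points, it gives either a compressible member in the ultrafilter or
  a member with one more alternation on generic points, of which NIP allows only boundedly many.\<close>

section \<open>Ultrafilters and compactness\<close>

definition is_ultrafilter :: "'a set set \<Rightarrow> bool" where
  "is_ultrafilter U \<longleftrightarrow>
     {} \<notin> U \<and> (\<forall>A\<in>U. \<forall>B\<in>U. A \<inter> B \<in> U) \<and> (\<forall>A. A \<in> U \<or> - A \<in> U)"

definition fin_inter :: "'a set set \<Rightarrow> bool" where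
  "fin_inter \<S> \<longleftrightarrow> (\<forall>T. finite T \<longrightarrow> T \<subseteq> \<S> \<longrightarrow> \<Inter>T \<noteq> {})"

lemma ultrafilter_mono:
  assumes "is_ultrafilter U" "A \<in> U" "A \<subseteq> B"
  shows "B \<in> U"
proof (rule ccontr)
  assume "B \<notin> U"
  then have "A \<inter> - B \<in> U" using assms unfolding is_ultrafilter_def by blast
  moreover have "A \<inter> - B = {}" using assms(3) by blast
  ultimately show False using assms(1) unfolding is_ultrafilter_def by simp
qed

lemma ultrafilter_UNIV: "is_ultrafilter U \<Longrightarrow> UNIV \<in> U"
  unfolding is_ultrafilter_def by (metis Compl_UNIV_eq)

lemma ultrafilter_Int: "is_ultrafilter U \<Longrightarrow> A \<in> U \<Longrightarrow> B \<in> U \<Longrightarrow> A \<inter> B \<in> U"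
  unfolding is_ultrafilter_def by blast

lemma ultrafilter_Compl: "is_ultrafilter U \<Longrightarrow> - A \<in> U \<longleftrightarrow> A \<notin> U"
  unfolding is_ultrafilter_def by (metis Compl_disjoint)

lemma ultrafilter_not_eventually:
  "is_ultrafilter U \<Longrightarrow> {a. P a} \<notin> U \<Longrightarrow> {a. \<not> P a} \<in> U"
  by (metis Collect_neg_eq ultrafilter_Compl)

lemma ultrafilter_nonempty: "is_ultrafilter U \<Longrightarrow> A \<in> U \<Longrightarrow> \<exists>a. a \<in> A"
  unfolding is_ultrafilter_def by (metis ex_in_conv)

lemma ultrafilter_Un: "is_ultrafilter U \<Longrightarrow> A \<union> B \<in> U \<Longrightarrow> A \<in> U \<or> B \<in> U"
  using ultrafilter_Int[of U "- A" "- B"] ultrafilter_Compl[of U A] ultrafilter_Compl[of U B]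
    ultrafilter_Compl[of U "A \<union> B"] by (auto simp: Compl_Un)

lemma ultrafilter_Ball:
  assumes "is_ultrafilter U" "finite I" "\<And>i. i \<in> I \<Longrightarrow> {a. P i a} \<in> U"
  shows "{a. \<forall>i\<in>I. P i a} \<in> U"
  using assms(2,3)
proof (induction I)
  case empty
  then show ?case using ultrafilter_UNIV[OF assms(1)] by simp
next
  case (insert i I)
  then have "{a. P i a} \<inter> {a. \<forall>i\<in>I. P i a} \<in> U" using assms(1) by (simp add: ultrafilter_Int)
  then show ?case by (simp add: Collect_conj_eq)
qed

text \<open>A family that is maximal, by Zorn's lemma, among those containing \<open>\<S>\<close>
  with the finite intersection property is closed under intersection and decides every set.\<close>

lemma ultrafilter_exists:
  fixes \<S> :: "'a set set"
  assumes "fin_inter \<S>"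
  shows "\<exists>U. is_ultrafilter U \<and> \<S> \<subseteq> U"
proof -
  let ?P = "{G. \<S> \<subseteq> G \<and> fin_inter G}"
  have "\<exists>M\<in>?P. \<forall>X\<in>?P. M \<subseteq> X \<longrightarrow> X = M"
  proof (rule subset_Zorn_nonempty)
    show "?P \<noteq> {}" using assms by blast
    fix C assume C: "C \<noteq> {}" "subset.chain ?P C"
    then have ch: "C \<subseteq> ?P" "\<And>X Y. X \<in> C \<Longrightarrow> Y \<in> C \<Longrightarrow> X \<subseteq> Y \<or> Y \<subseteq> X"
      unfolding subset_chain_def by blast+
    have "\<Inter>T \<noteq> {}" if T: "finite T" "T \<subseteq> \<Union>C" for T
    proof -
      have "\<exists>B\<in>C. T \<subseteq> B"
        using finite_subset_Union_chain[OF T C] by blast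
      then show ?thesis using ch(1) T(1) unfolding fin_inter_def by blast
    qed
    moreover have "\<S> \<subseteq> \<Union>C" using C(1) ch(1) by blast
    ultimately show "\<Union>C \<in> ?P" unfolding fin_inter_def by blast
  qed
  then obtain M where M0: "M \<in> ?P" and max0: "\<forall>X\<in>?P. M \<subseteq> X \<longrightarrow> X = M" by (rule bexE)
  from M0 have M: "\<S> \<subseteq> M" "fin_inter M" by simp_all
  have max: "X = M" if "M \<subseteq> X" "fin_inter X" for X
  proof -
    have "X \<in> ?P" using that M(1) by simp
    then show ?thesis using max0 that(1) by simp
  qed
  \<comment> \<open>By maximality, a set that meets all finite intersections from \<open>M\<close>
    already lies in \<open>M\<close>. Closure under intersection and the decision of every set both
    come from this.\<close>
  have mem: "A \<in> M" if "\<And>T. finite T \<Longrightarrow> T \<subseteq> M \<Longrightarrow> A \<inter> \<Inter>T \<noteq> {}" for A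
  proof -
    have "\<Inter>T \<noteq> {}" if T: "finite T" "T \<subseteq> insert A M" for T
    proof -
      have "A \<inter> \<Inter>(T - {A}) \<noteq> {}" using that by (intro \<open>\<And>T. finite T \<Longrightarrow> T \<subseteq> M \<Longrightarrow> A \<inter> \<Inter>T \<noteq> {}\<close>) auto
      moreover have "A \<inter> \<Inter>(T - {A}) \<subseteq> \<Inter>T" by blast
      ultimately show ?thesis by blast
    qed
    then have "insert A M = M" by (intro max) (auto simp: fin_inter_def)
    then show ?thesis by blast
  qed
  have "is_ultrafilter M"
    unfolding is_ultrafilter_def
  proof (intro conjI ballI allI)
    show "{} \<notin> M"
    proof
      assume "{} \<in> M"
      then have "\<Inter>{{}} \<noteq> ({} :: 'a set)"
        using M(2)[unfolded fin_inter_def, rule_format, of "{{}}"] by simp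
      then show False by simp
    qed
  next
    fix A B assume AB: "A \<in> M" "B \<in> M"
    show "A \<inter> B \<in> M"
    proof (rule mem)
      fix T assume "finite T" "T \<subseteq> M"
      then have "finite (insert A (insert B T))" "insert A (insert B T) \<subseteq> M" using AB by auto
      then have "\<Inter>(insert A (insert B T)) \<noteq> {}" using M(2) unfolding fin_inter_def by blast
      then show "A \<inter> B \<inter> \<Inter>T \<noteq> {}" by auto
    qed
  next
    fix A
    show "A \<in> M \<or> - A \<in> M"
    proof (rule ccontr)
      assume "\<not> ?thesis"
      then obtain T1 T2 where T: "finite T1" "T1 \<subseteq> M" "A \<inter> \<Inter>T1 = {}"
        "finite T2" "T2 \<subseteq> M" "- A \<inter> \<Inter>T2 = {}" using mem by meson
      have "finite (T1 \<union> T2)" "T1 \<union> T2 \<subseteq> M" using T by auto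
      then have "\<Inter>(T1 \<union> T2) \<noteq> {}" using M(2) unfolding fin_inter_def by blast
      then show False using T(3,6) by blast
    qed
  qed
  then show ?thesis using M(1) by blast
qed

section \<open>Closed classes and compactness of the space of all subsets\<close>

definition closed_class :: "'p set set \<Rightarrow> bool" where
  "closed_class K \<longleftrightarrow> (\<forall>c. (\<forall>S. finite S \<longrightarrow> (\<exists>z\<in>K. z \<inter> S = c \<inter> S)) \<longrightarrow> c \<in> K)"

lemma closed_classD:
  "closed_class K \<Longrightarrow> (\<And>S. finite S \<Longrightarrow> \<exists>z\<in>K. z \<inter> S = c \<inter> S) \<Longrightarrow> c \<in> K"
  unfolding closed_class_def by blast

text \<open>Closed classes are the closed sets of the product topology, whose basic open sets fix
  the trace on a finite set. The common point is the limit along an ultrafilter extending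
  \<open>\<F>\<close>: it contains \<open>x\<close> iff almost every \<open>z\<close> does.\<close>

lemma compactness:
  fixes \<F> :: "'p set set set"
  assumes "\<And>K. K \<in> \<F> \<Longrightarrow> closed_class K" "fin_inter \<F>"
  shows "\<exists>c. \<forall>K\<in>\<F>. c \<in> K"
proof -
  obtain U where U: "is_ultrafilter U" "\<F> \<subseteq> U" using ultrafilter_exists[OF assms(2)] by blast
  define c where "c = {x. {z. x \<in> z} \<in> U}"
  have "c \<in> K" if "K \<in> \<F>" for K
  proof (rule closed_classD)
    show "closed_class K" using assms(1) that .
    fix S :: "'p set" assume S: "finite S"
    have "{z. x \<in> z \<longleftrightarrow> x \<in> c} \<in> U" for x
    proof (cases "x \<in> c")
      case True then show ?thesis by (simp add: c_def)
    next
      case False then show ?thesis using ultrafilter_not_eventually[OF U(1)] by (simp add: c_def)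
    qed
    then have "{z. \<forall>x\<in>S. x \<in> z \<longleftrightarrow> x \<in> c} \<in> U" by (rule ultrafilter_Ball[OF U(1) S])
    then have "{z. \<forall>x\<in>S. x \<in> z \<longleftrightarrow> x \<in> c} \<inter> K \<in> U"
      using U that by (meson subsetD ultrafilter_Int)
    then obtain z where "z \<in> K" "\<forall>x\<in>S. x \<in> z \<longleftrightarrow> x \<in> c"
      using ultrafilter_nonempty[OF U(1)] by blast
    then show "\<exists>z\<in>K. z \<inter> S = c \<inter> S" by blast
  qed
  then show ?thesis by blast
qed

text \<open>A condition that depends only on the trace on a finite set is clopen, so imposing it
  preserves closedness.\<close>

lemma closed_class_restrict:
  assumes "closed_class K" "finite S" "\<And>c c'. c \<inter> S = c' \<inter> S \<Longrightarrow> P c = P c'"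
  shows "closed_class {c \<in> K. P c}"
  unfolding closed_class_def
proof (intro allI impI)
  fix c assume *: "\<forall>S. finite S \<longrightarrow> (\<exists>z\<in>{c \<in> K. P c}. z \<inter> S = c \<inter> S)"
  then have "c \<in> K" by (intro closed_classD[OF assms(1)]) blast
  moreover obtain z where "P z" "z \<inter> S = c \<inter> S" using * assms(2) by blast
  then have "P c" using assms(3) by metis
  ultimately show "c \<in> {c \<in> K. P c}" by blast
qed

lemma closed_class_UNIV: "closed_class UNIV"
  unfolding closed_class_def by blast

text \<open>Only one finite coordinate set has to be tested at a time, since such conditions get stronger
  as the coordinate set grows.\<close>

lemma compactness_directed:
  fixes K :: "'p set set" and P :: "'p set \<Rightarrow> 'p set \<Rightarrow> bool"
  assumes "closed_class K"
    and local: "\<And>S c c'. finite S \<Longrightarrow> c \<inter> S = c' \<inter> S \<Longrightarrow> P S c = P S c'"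
    and anti: "\<And>S S' c. finite S' \<Longrightarrow> S \<subseteq> S' \<Longrightarrow> P S' c \<Longrightarrow> P S c"
    and ex: "\<And>S. finite S \<Longrightarrow> \<exists>c\<in>K. P S c"
  shows "\<exists>c\<in>K. \<forall>S. finite S \<longrightarrow> P S c"
proof -
  let ?C = "\<lambda>S. {c\<in>K. P S c}"
  let ?F = "?C ` {S. finite S}"
  have "fin_inter ?F"
    unfolding fin_inter_def
  proof (intro allI impI)
    fix T assume "finite T" "T \<subseteq> ?F"
    then obtain SS where SS: "finite SS" "SS \<subseteq> {S. finite S}" "T = ?C ` SS"
      by (meson finite_subset_image)
    have fin: "finite (\<Union>SS)" using SS by blast
    then obtain c where c: "c \<in> K" "P (\<Union>SS) c" using ex by blast
    have "c \<in> ?C S" if "S \<in> SS" for S using c anti[OF fin] that by blast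
    then show "\<Inter>T \<noteq> {}" using SS(3) by blast
  qed
  moreover have "closed_class C" if "C \<in> ?F" for C
  proof -
    from that obtain S where C: "C = ?C S" and "S \<in> {S. finite S}" by (rule imageE)
    then have S: "finite S" by simp
    show ?thesis unfolding C by (rule closed_class_restrict[OF assms(1) S local[OF S]])
  qed
  ultimately have "\<exists>c. \<forall>C\<in>?F. c \<in> C" by (intro compactness)
  then obtain c where c: "\<forall>C\<in>?F. c \<in> C" ..
  then have "c \<in> ?C S" if "finite S" for S using that by simp
  then show ?thesis by (metis (mono_tags, lifting) finite.emptyI mem_Collect_eq)
qed

section \<open>Compressible subclasses and points\<close>

text \<open>A bound by a natural number on finite shattered sets, which avoids \<open>enat\<close>
  and the convention that infinite sets have \<open>card\<close> 0.\<close>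

definition vc_le :: "'p set set \<Rightarrow> nat \<Rightarrow> bool" where
  "vc_le K d \<longleftrightarrow> (\<forall>S. finite S \<longrightarrow> shatters K S \<longrightarrow> card S \<le> d)"

lemma vc_leD: "vc_le K d \<Longrightarrow> finite S \<Longrightarrow> shatters K S \<Longrightarrow> card S \<le> d"
  unfolding vc_le_def by blast

lemma shatters_mono: "shatters K S \<Longrightarrow> K \<subseteq> K' \<Longrightarrow> shatters K' S"
  unfolding shatters_def by (meson subset_iff)

lemma shattersD: "shatters K S \<Longrightarrow> B \<subseteq> S \<Longrightarrow> \<exists>c\<in>K. c \<inter> S = B"
  unfolding shatters_def by blast

lemma vc_le_subset: "vc_le K d \<Longrightarrow> K' \<subseteq> K \<Longrightarrow> vc_le K' d"
  unfolding vc_le_def using shatters_mono by blast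

text \<open>The trace that all of \<open>Z\<close> shares on \<open>Y\<close> acts as a single
  condition; within \<open>K\<close> it implies having on \<open>S\<close> one of the traces of
  \<open>Z\<close>. This relative form of isolation makes sense for a class in place of a
  point.\<close>

definition isolates :: "'p set set \<Rightarrow> 'p set set \<Rightarrow> 'p set \<Rightarrow> 'p set \<Rightarrow> bool" where
  "isolates K Z Y S \<longleftrightarrow> (\<forall>z\<in>Z. \<forall>z'\<in>Z. z \<inter> Y = z' \<inter> Y) \<and>
     (\<forall>z\<in>Z. \<forall>c\<in>K. c \<inter> Y = z \<inter> Y \<longrightarrow> (\<exists>z'\<in>Z. z' \<inter> S = c \<inter> S))"

text \<open>For \<open>Z = {p}\<close> this is \<open>m\<close>-compressibility of the type \<open>p\<close>.\<close>

definition compressible :: "nat \<Rightarrow> 'p set set \<Rightarrow> 'p set set \<Rightarrow> bool" where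
  "compressible m K Z \<longleftrightarrow> Z \<subseteq> K \<and> Z \<noteq> {} \<and> closed_class Z \<and>
     (\<forall>S. finite S \<longrightarrow> (\<exists>Y. finite Y \<and> card Y \<le> m \<and> isolates K Z Y S))"

lemma compressibleD:
  assumes "compressible m K Z" "finite S"
  obtains Y where "finite Y" "card Y \<le> m" "isolates K Z Y S"
  using assms unfolding compressible_def by blast

lemma isolates_agree: "isolates K Z Y S \<Longrightarrow> z \<in> Z \<Longrightarrow> z' \<in> Z \<Longrightarrow> z \<inter> Y = z' \<inter> Y"
  unfolding isolates_def by blast

lemma isolatesD:
  "isolates K Z Y S \<Longrightarrow> z \<in> Z \<Longrightarrow> c \<in> K \<Longrightarrow> c \<inter> Y = z \<inter> Y \<Longrightarrow> \<exists>z'\<in>Z. z' \<inter> S = c \<inter> S"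
  unfolding isolates_def by blast

lemma isolatesI:
  "(\<And>z z'. z \<in> Z \<Longrightarrow> z' \<in> Z \<Longrightarrow> z \<inter> Y = z' \<inter> Y) \<Longrightarrow>
   (\<And>z c. z \<in> Z \<Longrightarrow> c \<in> K \<Longrightarrow> c \<inter> Y = z \<inter> Y \<Longrightarrow> \<exists>z'\<in>Z. z' \<inter> S = c \<inter> S) \<Longrightarrow> isolates K Z Y S"
  unfolding isolates_def by (intro conjI ballI impI)

lemma compressible_refl:
  assumes "closed_class K" "K \<noteq> {}"
  shows "compressible 0 K K"
  using assms unfolding compressible_def isolates_def by (auto intro!: exI[of _ "{}"])

lemma compressible_mono: "compressible m K Z \<Longrightarrow> m \<le> m' \<Longrightarrow> compressible m' K Z"
  unfolding compressible_def by (meson le_trans)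

text \<open>The set \<open>Y\<close> is chosen for the target \<open>S \<union> Y'\<close>: a member
  of \<open>K\<close> with the right trace on \<open>Y \<union> Y'\<close> is matched on
  \<open>S \<union> Y'\<close> by a member of \<open>Z\<close>, to which the isolation of
  \<open>W\<close> by \<open>Y'\<close> applies.\<close>

lemma compressible_trans:
  assumes KZ: "compressible m K Z" and ZW: "compressible m' Z W"
  shows "compressible (m + m') K W"
  unfolding compressible_def
proof (intro conjI allI impI)
  show "W \<subseteq> K" "W \<noteq> {}" "closed_class W" using assms unfolding compressible_def by blast+
  fix S :: "'a set" assume S: "finite S"
  obtain Y' where Y': "finite Y'" "card Y' \<le> m'" "isolates Z W Y' S"
    using ZW S by (rule compressibleD)
  obtain Y where Y: "finite Y" "card Y \<le> m" "isolates K Z Y (S \<union> Y')"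
    using KZ S Y'(1) by (metis compressibleD finite_Un)
  have WZ: "W \<subseteq> Z" using ZW unfolding compressible_def by blast
  have "isolates K W (Y \<union> Y') S"
  proof (rule isolatesI)
    fix w w' assume w: "w \<in> W" "w' \<in> W"
    then have "w \<inter> Y' = w' \<inter> Y'" by (rule isolates_agree[OF Y'(3)])
    moreover have "w \<inter> Y = w' \<inter> Y" using w WZ by (intro isolates_agree[OF Y(3)]) auto
    ultimately show "w \<inter> (Y \<union> Y') = w' \<inter> (Y \<union> Y')" by blast
  next
    fix w c assume w: "w \<in> W" and c: "c \<in> K" and eq: "c \<inter> (Y \<union> Y') = w \<inter> (Y \<union> Y')"
    then have e1: "c \<inter> Y = w \<inter> Y" and e2: "c \<inter> Y' = w \<inter> Y'" by blast+
    obtain z where z: "z \<in> Z" "z \<inter> (S \<union> Y') = c \<inter> (S \<union> Y')"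
      using isolatesD[OF Y(3) subsetD[OF WZ w] c e1] by blast
    then have "z \<inter> Y' = w \<inter> Y'" "z \<inter> S = c \<inter> S" using e2 by blast+
    then show "\<exists>z'\<in>W. z' \<inter> S = c \<inter> S" using isolatesD[OF Y'(3) w z(1)] by simp
  qed
  moreover have "card (Y \<union> Y') \<le> m + m'" using card_Un_le[of Y Y'] Y(2) Y'(2) by linarith
  ultimately show "\<exists>Y. finite Y \<and> card Y \<le> m + m' \<and> isolates K W Y S"
    using Y(1) Y'(1) by blast
qed

section \<open>Intersections of chains and minimal compressible subclasses\<close>

lemma closed_class_Inter: "(\<And>K. K \<in> \<Z> \<Longrightarrow> closed_class K) \<Longrightarrow> closed_class (\<Inter>\<Z>)"
  unfolding closed_class_def by (meson InterE InterI)

lemma finite_chain_least: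
  assumes "finite T" "T \<noteq> {}" "\<And>X Y. X \<in> T \<Longrightarrow> Y \<in> T \<Longrightarrow> X \<subseteq> Y \<or> Y \<subseteq> X"
  shows "\<exists>Z\<in>T. \<forall>X\<in>T. Z \<subseteq> X"
  using assms
proof (induction T rule: finite_ne_induct)
  case (singleton x) then show ?case by simp
next
  case (insert x T)
  then obtain Z where Z: "Z \<in> T" "\<forall>X\<in>T. Z \<subseteq> X" by (metis insertCI)
  have "Z \<subseteq> x \<or> x \<subseteq> Z" using insert.prems Z(1) by blast
  then show ?case
  proof
    assume "Z \<subseteq> x" then show ?thesis using Z by blast
  next
    assume "x \<subseteq> Z"
    then have "\<forall>X\<in>insert x T. x \<subseteq> X" using Z(2) by blast
    then show ?thesis by blast
  qed
qed

text \<open>Compactness applies because finitely many members of a chain have a least one, which is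
  nonempty.\<close>

lemma chain_Inter_nonempty:
  assumes closed: "\<And>Z. Z \<in> \<Z> \<Longrightarrow> closed_class Z" and ne: "\<And>Z. Z \<in> \<Z> \<Longrightarrow> Z \<noteq> {}"
    and chain: "\<And>X Y. X \<in> \<Z> \<Longrightarrow> Y \<in> \<Z> \<Longrightarrow> X \<subseteq> Y \<or> Y \<subseteq> X"
  shows "\<Inter>\<Z> \<noteq> {}"
proof -
  have "fin_inter \<Z>"
    unfolding fin_inter_def
  proof (intro allI impI)
    fix T assume T: "finite T" "T \<subseteq> \<Z>"
    show "\<Inter>T \<noteq> {}"
    proof (cases "T = {}")
      case False
      have "\<exists>Z\<in>T. \<forall>X\<in>T. Z \<subseteq> X" using T chain by (intro finite_chain_least[OF T(1) False]) auto
      then obtain Z where Z: "Z \<in> T" "\<forall>X\<in>T. Z \<subseteq> X" ..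
      then have "Z \<subseteq> \<Inter>T" by (simp add: Inter_greatest)
      then show ?thesis using ne[of Z] Z(1) T(2) by (metis subsetD subset_empty)
    qed simp
  qed
  then show ?thesis using compactness[of \<Z>] closed by (metis InterI empty_iff)
qed

text \<open>On a given finite \<open>S\<close>, some member of the chain has exactly the traces of
  the whole intersection; a set that isolates this member on \<open>S\<close> also isolates the
  intersection.\<close>

lemma compressible_chain:
  assumes ne: "\<Z> \<noteq> {}" and compr: "\<And>Z. Z \<in> \<Z> \<Longrightarrow> compressible m K Z"
    and chain: "\<And>X Y. X \<in> \<Z> \<Longrightarrow> Y \<in> \<Z> \<Longrightarrow> X \<subseteq> Y \<or> Y \<subseteq> X"
  shows "compressible m K (\<Inter>\<Z>)"
proof -
  have closed: "closed_class Z" and Zne: "Z \<noteq> {}" and ZK: "Z \<subseteq> K" if "Z \<in> \<Z>" for Z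
    using compr[OF that] unfolding compressible_def by blast+
  show ?thesis
    unfolding compressible_def
  proof (intro conjI allI impI)
    show "\<Inter>\<Z> \<subseteq> K" using ne ZK by blast
    show "\<Inter>\<Z> \<noteq> {}" using closed Zne chain by (rule chain_Inter_nonempty)
    show "closed_class (\<Inter>\<Z>)" using closed by (rule closed_class_Inter)
    fix S :: "'a set" assume S: "finite S"
    \<comment> \<open>If each member of the chain realised \<open>B\<close> on \<open>S\<close>, the
      parts with trace \<open>B\<close> would form a chain of nonempty closed classes, and a common
      point would realise \<open>B\<close> in the intersection.\<close>
    have avoid: "\<exists>Z\<in>\<Z>. \<forall>z\<in>Z. z \<inter> S \<noteq> B" if B: "\<forall>z\<in>\<Inter>\<Z>. z \<inter> S \<noteq> B" for B
    proof (rule ccontr)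
      assume "\<not> ?thesis"
      then have *: "\<And>Z. Z \<in> \<Z> \<Longrightarrow> \<exists>z\<in>Z. z \<inter> S = B" by blast
      let ?f = "\<lambda>Z. {z \<in> Z. z \<inter> S = B}"
      have "\<Inter>(?f ` \<Z>) \<noteq> {}"
      proof (rule chain_Inter_nonempty)
        show "closed_class W" if "W \<in> ?f ` \<Z>" for W
        proof -
          from that obtain Z where W: "W = ?f Z" and Z: "Z \<in> \<Z>" by (rule imageE)
          show ?thesis unfolding W by (rule closed_class_restrict[OF closed[OF Z] S]) simp
        qed
        show "W \<noteq> {}" if "W \<in> ?f ` \<Z>" for W using that * by auto
        show "X \<subseteq> Y \<or> Y \<subseteq> X" if XY: "X \<in> ?f ` \<Z>" "Y \<in> ?f ` \<Z>" for X Y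
        proof -
          from XY(1) obtain X' where "X = ?f X'" "X' \<in> \<Z>" by (rule imageE)
          moreover from XY(2) obtain Y' where "Y = ?f Y'" "Y' \<in> \<Z>" by (rule imageE)
          ultimately show ?thesis using chain[of X' Y'] by auto
        qed
      qed
      then obtain z where "z \<in> \<Inter>(?f ` \<Z>)" by blast
      then have "z \<in> \<Inter>\<Z>" "z \<inter> S = B" using ne by auto
      then show False using B by blast
    qed
    define bad where "bad = {B \<in> Pow S. \<forall>z\<in>\<Inter>\<Z>. z \<inter> S \<noteq> B}"
    have "\<forall>B\<in>bad. \<exists>Z\<in>\<Z>. \<forall>z\<in>Z. z \<inter> S \<noteq> B" using avoid unfolding bad_def by blast
    then obtain f where f: "\<forall>B\<in>bad. f B \<in> \<Z> \<and> (\<forall>z\<in>f B. z \<inter> S \<noteq> B)" by metis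
    \<comment> \<open>\<open>Z0\<close> keeps the finite subchain nonempty when no trace is
      bad.\<close>
    obtain Z0 where Z0: "Z0 \<in> \<Z>" using ne by blast
    have "\<exists>Z\<in>insert Z0 (f ` bad). \<forall>X\<in>insert Z0 (f ` bad). Z \<subseteq> X"
    proof (rule finite_chain_least)
      show "finite (insert Z0 (f ` bad))" using S by (simp add: bad_def)
      show "X \<subseteq> Y \<or> Y \<subseteq> X" if "X \<in> insert Z0 (f ` bad)" "Y \<in> insert Z0 (f ` bad)" for X Y
        using that f Z0 by (intro chain) auto
    qed simp
    then obtain Z where Z: "Z \<in> insert Z0 (f ` bad)" "\<forall>X\<in>insert Z0 (f ` bad). Z \<subseteq> X" ..
    have ZZ: "Z \<in> \<Z>" using Z(1) Z0 f by auto
    have good: "\<exists>z'\<in>\<Inter>\<Z>. z' \<inter> S = z \<inter> S" if z: "z \<in> Z" for z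
    proof (rule ccontr)
      assume "\<not> ?thesis"
      then have b: "z \<inter> S \<in> bad" unfolding bad_def by blast
      then have "z \<in> f (z \<inter> S)" using Z(2) z by blast
      then show False using f b by blast
    qed
    obtain Y where Y: "finite Y" "card Y \<le> m" "isolates K Z Y S"
      using compr[OF ZZ] S by (rule compressibleD)
    have "isolates K (\<Inter>\<Z>) Y S"
    proof (rule isolatesI)
      fix z z' assume "z \<in> \<Inter>\<Z>" "z' \<in> \<Inter>\<Z>"
      then show "z \<inter> Y = z' \<inter> Y" using ZZ by (intro isolates_agree[OF Y(3)]) auto
    next
      fix z c assume z: "z \<in> \<Inter>\<Z>" and c: "c \<in> K" "c \<inter> Y = z \<inter> Y"
      have "z \<in> Z" using z ZZ by blast
      then obtain z' where "z' \<in> Z" "z' \<inter> S = c \<inter> S" using isolatesD[OF Y(3) _ c] by blast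
      then show "\<exists>z'\<in>\<Inter>\<Z>. z' \<inter> S = c \<inter> S" using good by metis
    qed
    then show "\<exists>Y. finite Y \<and> card Y \<le> m \<and> isolates K (\<Inter>\<Z>) Y S" using Y by blast
  qed
qed

lemma compressible_minimal:
  assumes "closed_class K" "K \<noteq> {}"
  shows "\<exists>Z. compressible m K Z \<and> (\<forall>W. compressible m K W \<longrightarrow> W \<subseteq> Z \<longrightarrow> W = Z)"
proof -
  \<comment> \<open>\<open>subset_Zorn_nonempty\<close> provides maximal elements, so minimality is
    obtained by passing to complements.\<close>
  let ?A = "uminus ` {Z. compressible m K Z}"
  have "\<exists>M\<in>?A. \<forall>X\<in>?A. M \<subseteq> X \<longrightarrow> X = M"
  proof (rule subset_Zorn_nonempty)
    show "?A \<noteq> {}" using compressible_mono[OF compressible_refl[OF assms]] by blast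
    fix C assume C: "C \<noteq> {}" "subset.chain ?A C"
    have "compressible m K (\<Inter>(uminus ` C))"
    proof (rule compressible_chain)
      show "uminus ` C \<noteq> {}" using C(1) by simp
      show "compressible m K Z" if "Z \<in> uminus ` C" for Z
        using that C(2) unfolding subset_chain_def by auto
      show "X \<subseteq> Y \<or> Y \<subseteq> X" if XY: "X \<in> uminus ` C" "Y \<in> uminus ` C" for X Y
      proof -
        from XY(1) obtain X' where "X = - X'" "X' \<in> C" by (rule imageE)
        moreover from XY(2) obtain Y' where "Y = - Y'" "Y' \<in> C" by (rule imageE)
        ultimately show ?thesis using C(2) unfolding subset_chain_def by (metis Compl_anti_mono)
      qed
    qed
    moreover have "\<Union>C = - \<Inter>(uminus ` C)" by auto
    ultimately show "\<Union>C \<in> ?A" by blast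
  qed
  then obtain M where M: "M \<in> ?A" "\<forall>X\<in>?A. M \<subseteq> X \<longrightarrow> X = M" ..
  from M(1) obtain Z where Z: "M = - Z" "compressible m K Z" by auto
  have "W = Z" if W: "compressible m K W" "W \<subseteq> Z" for W
  proof -
    have "- W \<in> ?A" "M \<subseteq> - W" using W Z(1) by auto
    then have "- W = M" using M(2) by blast
    then show ?thesis using Z(1) by simp
  qed
  then show ?thesis using Z(2) by blast
qed

section \<open>Lowering the VC-dimension of a compressible subclass\<close>

lemma swap_count:
  fixes M d P kk :: nat
  assumes "M \<le> P * d + 1" "0 < P" and le: "M + P * (P * d + 1) + P \<le> P * (M + Suc d)"
  shows False
proof -
  obtain Q where Q: "P = Suc Q" using assms(2) by (cases P) auto
  \<comment> \<open>With \<open>m = P * d + 1\<close>, the assumption \<open>le\<close> amounts to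
    \<open>(P - 1) * m + 1 \<le> (P - 1) * M\<close>, which contradicts
    \<open>M \<le> m\<close>.\<close>
  have "Q * M \<le> Q * (P * d + 1)" using assms(1) by (rule mult_le_mono2)
  moreover have "M + P * (P * d + 1) + P \<le> Q * M + M + P * d + P"
    using le by (simp add: Q algebra_simps)
  ultimately have "P * (P * d + 1) \<le> Q * (P * d + 1) + P * d" by linarith
  then have "P * d + 1 + Q * (P * d + 1) \<le> Q * (P * d + 1) + P * d" by (simp add: Q)
  then show False by linarith
qed

text \<open>If prescribing the trace \<open>B\<close> on \<open>S\<close> forces the value at each point of a set \<open>W \<subseteq> Y\<close>, then
  \<open>W\<close> can be exchanged for \<open>S\<close>. As \<open>K\<close> cannot shatter \<open>S\<close> together with a point of \<open>Y\<close>, each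
  point of \<open>Y\<close> is forced by some trace, and by pigeonhole one trace forces enough of them.\<close>

lemma exchange:
  assumes vc: "vc_le K (Suc d)" and ZK: "Z \<subseteq> K" and S: "finite S" "card S = Suc d" "shatters Z S"
    and Y: "finite Y" "card Y \<le> 2 ^ Suc d * d + 1"
    and agree: "\<And>z z'. z \<in> Z \<Longrightarrow> z' \<in> Z \<Longrightarrow> z \<inter> Y = z' \<inter> Y"
  obtains B Y' where "B \<subseteq> S" "finite Y'" "card Y' \<le> 2 ^ Suc d * d + 1" "Y' \<subseteq> Y \<union> S" "S \<subseteq> Y'"
    "\<And>z c. z \<in> Z \<Longrightarrow> c \<in> K \<Longrightarrow> z \<inter> S = B \<Longrightarrow> c \<inter> Y' = z \<inter> Y' \<Longrightarrow> c \<inter> Y = z \<inter> Y"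
proof -
  obtain z0 where z0: "z0 \<in> Z" using shattersD[OF S(3), of "{}"] by blast
  have forced: "\<exists>B\<in>Pow S. \<forall>c\<in>K. c \<inter> S = B \<longrightarrow> (y \<in> c \<longleftrightarrow> y \<in> z0)" if y: "y \<in> Y" for y
  proof (rule ccontr)
    assume "\<not> ?thesis"
    then have free: "\<And>B. B \<subseteq> S \<Longrightarrow> \<exists>c\<in>K. c \<inter> S = B \<and> (y \<in> c \<longleftrightarrow> y \<notin> z0)" by auto
    have yz: "y \<in> z \<longleftrightarrow> y \<in> z0" if "z \<in> Z" for z using agree[OF that z0] y by blast
    \<comment> \<open>At a point of \<open>S\<close> the class \<open>Z\<close> takes both values,
      while all its members agree on \<open>Y\<close>.\<close>
    have "y \<notin> S"
    proof
      assume yS: "y \<in> S"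
      obtain u where u: "u \<in> Z" "u \<inter> S = {}" using shattersD[OF S(3), of "{}"] by blast
      obtain v where v: "v \<in> Z" "v \<inter> S = S" using shattersD[OF S(3), of S] by blast
      show False using yz[OF u(1)] yz[OF v(1)] u(2) v(2) yS by blast
    qed
    have "shatters K (insert y S)"
      unfolding shatters_def
    proof (intro allI impI)
      fix B assume B: "B \<subseteq> insert y S"
      \<comment> \<open>One of the two values at \<open>y\<close> comes from \<open>Z\<close>, which
        shatters \<open>S\<close>, the other from the assumption that no trace forces
        \<open>y\<close>.\<close>
      have "\<exists>c\<in>K. c \<inter> S = B \<inter> S \<and> (y \<in> c \<longleftrightarrow> y \<in> B)"
      proof (cases "y \<in> B \<longleftrightarrow> y \<in> z0")
        case True
        obtain z where "z \<in> Z" "z \<inter> S = B \<inter> S" using shattersD[OF S(3), of "B \<inter> S"] by blast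
        then show ?thesis using yz ZK True by blast
      next
        case False
        then show ?thesis using free[of "B \<inter> S"] by auto
      qed
      then obtain c where "c \<in> K" "c \<inter> S = B \<inter> S" "y \<in> c \<longleftrightarrow> y \<in> B" by blast
      then have "c \<inter> insert y S = B" using B by blast
      then show "\<exists>C\<in>K. C \<inter> insert y S = B" using \<open>c \<in> K\<close> by blast
    qed
    then have "card (insert y S) \<le> Suc d" using vc S(1) by (simp add: vc_leD)
    then show False using S \<open>y \<notin> S\<close> by simp
  qed
  then have "\<forall>y\<in>Y. \<exists>B. B \<in> Pow S \<and> (\<forall>c\<in>K. c \<inter> S = B \<longrightarrow> (y \<in> c \<longleftrightarrow> y \<in> z0))" by blast
  from bchoice[OF this] obtain s where
    s0: "\<forall>y\<in>Y. s y \<in> Pow S \<and> (\<forall>c\<in>K. c \<inter> S = s y \<longrightarrow> (y \<in> c \<longleftrightarrow> y \<in> z0))" ..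
  have s1: "s y \<in> Pow S" if "y \<in> Y" for y
    using bspec[OF s0 that] by (rule conjunct1)
  have s2: "y \<in> c \<longleftrightarrow> y \<in> z0" if "y \<in> Y" "c \<in> K" "c \<inter> S = s y" for y c
    using bspec[OF bspec[OF s0 that(1), THEN conjunct2] that(2)] that(3) by (rule mp)
  define fib where "fib B = {y \<in> Y. s y = B}" for B
  \<comment> \<open>Some fibre is so large that replacing it by the \<open>d + 1\<close> points of
    \<open>S\<close> leaves at most \<open>2 ^ Suc d * d + 1\<close> points.\<close>
  have "\<exists>B\<in>Pow S. card Y + Suc d \<le> 2 ^ Suc d * d + 1 + card (fib B)"
  proof (rule ccontr)
    assume neg: "\<not> ?thesis"
    have le: "card (fib B) + (2 ^ Suc d * d + 1) + 1 \<le> card Y + Suc d" if "B \<in> Pow S" for B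
    proof -
      have "\<not> card Y + Suc d \<le> 2 ^ Suc d * d + 1 + card (fib B)" using neg that by blast
      then show ?thesis by linarith
    qed
    have "card Y = (\<Sum>B\<in>Pow S. card (fib B))"
    proof -
      have "Y = (\<Union>B\<in>Pow S. fib B)" using s1 unfolding fib_def by auto
      moreover have "card (\<Union>B\<in>Pow S. fib B) = (\<Sum>B\<in>Pow S. card (fib B))"
        using S(1) Y(1) unfolding fib_def by (intro card_UN_disjoint) auto
      ultimately show ?thesis by simp
    qed
    moreover have "(\<Sum>B\<in>Pow S. card (fib B) + (2 ^ Suc d * d + 1) + 1) \<le> (\<Sum>B\<in>Pow S. card Y + Suc d)"
      using le by (rule sum_mono)
    moreover have "(\<Sum>B\<in>Pow S. c) = 2 ^ Suc d * c" for c :: nat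
      using S by (simp add: card_Pow)
    ultimately have "card Y + 2 ^ Suc d * (2 ^ Suc d * d + 1) + 2 ^ Suc d * 1 \<le> 2 ^ Suc d * (card Y + Suc d)"
      by (simp only: sum.distrib distrib_left)
    then show False using swap_count[OF Y(2)] by simp
  qed
  then obtain B where B: "B \<subseteq> S" "card Y + Suc d \<le> 2 ^ Suc d * d + 1 + card (fib B)" by blast
  define Y' where "Y' = (Y - fib B) \<union> S"
  have fibY: "fib B \<subseteq> Y" unfolding fib_def by blast
  have "card Y' \<le> card (Y - fib B) + Suc d"
    using card_Un_le[of "Y - fib B" S] S(2) unfolding Y'_def by simp
  also have "card (Y - fib B) = card Y - card (fib B)"
    using fibY Y(1) by (simp add: card_Diff_subset finite_subset)
  finally have card: "card Y' \<le> 2 ^ Suc d * d + 1"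
    using B(2) card_mono[OF Y(1) fibY] by linarith
  have ext: "c \<inter> Y = z \<inter> Y" if z: "z \<in> Z" and c: "c \<in> K" and "z \<inter> S = B" "c \<inter> Y' = z \<inter> Y'" for z c
  proof -
    have cS: "c \<inter> S = B" "z \<inter> S = B" using that unfolding Y'_def by blast+
    have "y \<in> c \<longleftrightarrow> y \<in> z" if y: "y \<in> Y" for y
    proof (cases "y \<in> fib B")
      case True
      then show ?thesis using s2[OF y c] s2[OF y subsetD[OF ZK z]] cS unfolding fib_def by simp
    next
      case False
      then have "y \<in> Y'" using y unfolding Y'_def by blast
      then show ?thesis using \<open>c \<inter> Y' = z \<inter> Y'\<close> by blast
    qed
    then show ?thesis by blast
  qed
  have "finite Y'" "Y' \<subseteq> Y \<union> S" "S \<subseteq> Y'" using Y(1) S(1) unfolding Y'_def by auto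
  then show thesis by (intro that[OF B(1) _ card]) (simp_all add: ext)
qed

text \<open>Take \<open>Z\<close> minimal. If it shattered a set \<open>S\<close> of
  \<open>d + 1\<close> points, the exchange would make the members of \<open>Z\<close> with some
  fixed trace \<open>B\<close> on \<open>S\<close> compressible with the same bound. By minimality
  they are all of \<open>Z\<close>, which leaves only one trace on \<open>S\<close>.\<close>

lemma compressible_subclass_smaller_vc:
  assumes closed: "closed_class K" and ne: "K \<noteq> {}" and vc: "vc_le K (Suc d)"
  shows "\<exists>Z. compressible (2 ^ Suc d * d + 1) K Z \<and> vc_le Z d"
proof -
  let ?m = "2 ^ Suc d * d + 1"
  obtain Z where Z: "compressible ?m K Z"
    and min: "\<And>W. compressible ?m K W \<Longrightarrow> W \<subseteq> Z \<Longrightarrow> W = Z"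
    using compressible_minimal[OF closed ne] by blast
  have ZK: "Z \<subseteq> K" and Zcl: "closed_class Z" using Z unfolding compressible_def by blast+
  have "card S \<le> d" if S: "finite S" "shatters Z S" for S
  proof (rule ccontr)
    assume "\<not> card S \<le> d"
    moreover have "card S \<le> Suc d" using vc_le_subset[OF vc ZK] S by (rule vc_leD)
    ultimately have cS: "card S = Suc d" by simp
    let ?Z = "\<lambda>B. {z \<in> Z. z \<inter> S = B}"
    define Q where "Q B S' \<longleftrightarrow> (\<exists>Y'. finite Y' \<and> card Y' \<le> ?m \<and> isolates K (?Z B) Y' S')" for B S'
    have ex: "\<exists>B\<in>Pow S. Q B S'" if S': "finite S'" "S \<subseteq> S'" for S'
    proof -
      obtain Y where Y: "finite Y" "card Y \<le> ?m" "isolates K Z Y S'"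
        using Z S'(1) by (rule compressibleD)
      obtain B Y' where B: "B \<subseteq> S" and Y': "finite Y'" "card Y' \<le> ?m" "Y' \<subseteq> Y \<union> S" "S \<subseteq> Y'"
        and ext: "\<And>z c. z \<in> Z \<Longrightarrow> c \<in> K \<Longrightarrow> z \<inter> S = B \<Longrightarrow> c \<inter> Y' = z \<inter> Y' \<Longrightarrow> c \<inter> Y = z \<inter> Y"
        using exchange[OF vc ZK S(1) cS S(2) Y(1,2) isolates_agree[OF Y(3)]] by metis
      have "isolates K (?Z B) Y' S'"
        proof (rule isolatesI)
        fix z z' assume z: "z \<in> ?Z B" "z' \<in> ?Z B"
        then have "z \<inter> Y = z' \<inter> Y" "z \<inter> S = z' \<inter> S" using isolates_agree[OF Y(3)] by auto
        then show "z \<inter> Y' = z' \<inter> Y'" using Y'(3) by blast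
      next
        fix z c assume z: "z \<in> ?Z B" and c: "c \<in> K" "c \<inter> Y' = z \<inter> Y'"
        then have "c \<inter> Y = z \<inter> Y" using ext[of z c] by simp
        then obtain z' where z': "z' \<in> Z" "z' \<inter> S' = c \<inter> S'"
          using isolatesD[OF Y(3) _ c(1), of z] z by auto
        \<comment> \<open>As \<open>S\<close> is contained in both \<open>S'\<close> and
          \<open>Y'\<close>, the member \<open>z'\<close> inherits the trace
          \<open>B\<close>.\<close>
        have "z' \<inter> S = c \<inter> S" using z'(2) S'(2) by blast
        also have "\<dots> = z \<inter> S" using c(2) Y'(4) by blast
        finally have "z' \<in> ?Z B" using z z'(1) by simp
        then show "\<exists>z'\<in>?Z B. z' \<inter> S' = c \<inter> S'" using z'(2) by (rule bexI[rotated])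
      qed
      then have "Q B S'" unfolding Q_def using Y'(1,2) by (intro exI[of _ Y'] conjI)
      then show ?thesis using B by (intro bexI[of _ B]) simp_all
    qed
    have Q_anti: "Q B S'" if "Q B S''" "S' \<subseteq> S''" for B S' S''
    proof -
      obtain Y where Y: "finite Y" "card Y \<le> ?m" "isolates K (?Z B) Y S''" using \<open>Q B S''\<close> unfolding Q_def by blast
      have "isolates K (?Z B) Y S'"
      proof (rule isolatesI[OF isolates_agree[OF Y(3)]])
        fix z c assume zc: "z \<in> ?Z B" "c \<in> K" "c \<inter> Y = z \<inter> Y"
        obtain z' where "z' \<in> ?Z B" "z' \<inter> S'' = c \<inter> S''" using isolatesD[OF Y(3) zc] ..
        then show "\<exists>z'\<in>?Z B. z' \<inter> S' = c \<inter> S'"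
          using \<open>S' \<subseteq> S''\<close> by (intro bexI[of _ z']) blast+
      qed
      then show ?thesis unfolding Q_def using Y(1,2) by (intro exI[of _ Y] conjI)
    qed
    \<comment> \<open>So far \<open>B\<close> depends on \<open>S'\<close>. Since \<open>Q\<close>
      passes to smaller sets and there are only finitely many \<open>B\<close>, the union of one
      counterexample for each \<open>B\<close> would refute all of them at once.\<close>
    have "\<exists>B\<in>Pow S. \<forall>S'. finite S' \<longrightarrow> Q B S'"
    proof (rule ccontr)
      assume "\<not> ?thesis"
      then have "\<forall>B\<in>Pow S. \<exists>S'. finite S' \<and> \<not> Q B S'" by blast
      from bchoice[OF this] obtain f where "\<forall>B\<in>Pow S. finite (f B) \<and> \<not> Q B (f B)" ..
      then have f: "\<And>B. B \<in> Pow S \<Longrightarrow> finite (f B)" "\<And>B. B \<in> Pow S \<Longrightarrow> \<not> Q B (f B)"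
        by fast+
      have "finite (S \<union> (\<Union>B\<in>Pow S. f B))" using S(1) f(1) by auto
      then obtain B where B: "B \<in> Pow S" "Q B (S \<union> (\<Union>B\<in>Pow S. f B))" using ex[of "S \<union> (\<Union>B\<in>Pow S. f B)"] by blast
      have "Q B (f B)" using Q_anti[OF B(2), of "f B"] B(1) by blast
      then show False using f(2)[OF B(1)] by blast
    qed
    then obtain B where B: "B \<in> Pow S" "\<forall>S'. finite S' \<longrightarrow> Q B S'" ..
    have "compressible ?m K (?Z B)"
      unfolding compressible_def
    proof (intro conjI)
      show "?Z B \<subseteq> K" using ZK by blast
      show "?Z B \<noteq> {}" using shattersD[OF S(2)] B(1) by blast
      show "closed_class (?Z B)" by (rule closed_class_restrict[OF Zcl S(1)]) simp
      show "\<forall>S'. finite S' \<longrightarrow> (\<exists>Y. finite Y \<and> card Y \<le> ?m \<and> isolates K (?Z B) Y S')"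
        using B(2) unfolding Q_def .
    qed
    then have ZB: "?Z B = Z" by (intro min) auto
    obtain x where x: "x \<in> S" using cS by fastforce
    \<comment> \<open>A member of \<open>Z\<close> whose trace differs from \<open>B\<close> at
      \<open>x\<close>.\<close>
    obtain z where z: "z \<in> Z" "z \<inter> S = (if x \<in> B then {} else {x})"
      using shattersD[OF S(2), of "if x \<in> B then {} else {x}"] x by (metis empty_subsetI insert_subset)
    then have "z \<inter> S = B" using ZB by blast
    then show False using z(2) x by (auto split: if_splits)
  qed
  then show ?thesis using Z unfolding vc_le_def by blast
qed

section \<open>Compressible points, by induction on the VC-dimension\<close>

lemma k_comp_0: "k_comp 0 = 0"
  by (simp add: k_comp_def)

lemma k_comp_Suc: "k_comp (Suc d) = 2 ^ Suc d * d + 1 + k_comp d"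
proof -
  \<comment> \<open>\<open>nat\<close> distributes over sums of nonnegative integers; for
    \<open>d < 2\<close> the factor \<open>d - 2\<close> is negative and the value is
    computed.\<close>
  have nonneg: "0 \<le> 2 ^ (d + 1) * (int d - 2) + int d + 4"
  proof (cases "d < 2")
    case True
    then have "d = 0 \<or> d = 1" by auto
    then show ?thesis by auto
  qed simp
  have "2 ^ (Suc d + 1) * (int (Suc d) - 2) + int (Suc d) + 4
      = int (2 ^ Suc d * d + 1) + (2 ^ (d + 1) * (int d - 2) + int d + 4)"
    by (simp add: algebra_simps)
  then show ?thesis using nonneg unfolding k_comp_def by (simp only: nat_add_distrib)
qed

text \<open>A nonempty class of VC-dimension 0 is a single point. Otherwise a compressible subclass
  of smaller dimension contains a compressible point, and the two bounds add up along the recursion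
  of \<open>k_comp\<close>.\<close>

lemma compressible_point:
  assumes "closed_class K" "K \<noteq> {}" "vc_le K d"
  shows "\<exists>p\<in>K. compressible (k_comp d) K {p}"
  using assms
proof (induction d arbitrary: K)
  case 0
  obtain p where p: "p \<in> K" using 0(2) by blast
  have "z = p" if z: "z \<in> K" for z
  proof (rule ccontr)
    assume "z \<noteq> p"
    then obtain x where x: "x \<in> z \<longleftrightarrow> x \<notin> p" by blast
    have "shatters K {x}"
      unfolding shatters_def
    proof (intro allI impI)
      fix B assume "B \<subseteq> {x}"
      then have "B = {} \<or> B = {x}" by blast
      then have "z \<inter> {x} = B \<or> p \<inter> {x} = B" using x by blast
      then show "\<exists>C\<in>K. C \<inter> {x} = B" using p z by blast
    qed
    then show False using vc_leD[OF 0(3), of "{x}"] by simp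
  qed
  then have "K = {p}" using p by blast
  then show ?case using compressible_refl[OF 0(1,2)] by (auto simp: k_comp_0)
next
  case (Suc d)
  obtain Z where Z: "compressible (2 ^ Suc d * d + 1) K Z" "vc_le Z d"
    using compressible_subclass_smaller_vc[OF Suc.prems] by blast
  have "closed_class Z" "Z \<noteq> {}" and ZK: "Z \<subseteq> K" using Z(1) unfolding compressible_def by auto
  then obtain p where p: "p \<in> Z" "compressible (k_comp d) Z {p}" using Suc.IH Z(2) by blast
  have "compressible (k_comp (Suc d)) K {p}"
    unfolding k_comp_Suc using Z(1) p(2) by (rule compressible_trans)
  then show ?case using p(1) ZK by blast
qed

section \<open>Compressible points in an ultrafilter\<close>

text \<open>\<open>generic U K \<eta>\<close> says that for \<open>U\<close>-almost all \<open>a\<^sub>1\<close>, for \<open>U\<close>-almost all \<open>a\<^sub>2\<close>, \<dots>, the pattern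
  \<open>\<eta>\<close> is realised on \<open>a\<^sub>1, a\<^sub>2, \<dots>\<close> by a member of \<open>K\<close>. It replaces realising \<open>\<eta>\<close> on a Morley
  sequence of the global coheir \<open>U\<close>.\<close>

primrec generic :: "'p set set \<Rightarrow> 'p set set \<Rightarrow> bool list \<Rightarrow> bool" where
  "generic U K [] \<longleftrightarrow> K \<noteq> {}"
| "generic U K (e # \<eta>) \<longleftrightarrow> {a. generic U {c \<in> K. (a \<in> c) = e} \<eta>} \<in> U"

context
  fixes U :: "'p set set"
  assumes U: "is_ultrafilter U"
begin

lemma generic_mono: "generic U K \<eta> \<Longrightarrow> K \<subseteq> K' \<Longrightarrow> generic U K' \<eta>"
proof (induction \<eta> arbitrary: K K')
  case Nil
  then show ?case by auto
next
  case (Cons e \<eta>)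
  have "{a. generic U {c \<in> K. (a \<in> c) = e} \<eta>} \<subseteq> {a. generic U {c \<in> K'. (a \<in> c) = e} \<eta>}"
  proof
    fix a assume "a \<in> {a. generic U {c \<in> K. (a \<in> c) = e} \<eta>}"
    then have "generic U {c \<in> K. (a \<in> c) = e} \<eta>" by simp
    moreover have "{c \<in> K. (a \<in> c) = e} \<subseteq> {c \<in> K'. (a \<in> c) = e}" using Cons.prems(2) by blast
    ultimately show "a \<in> {a. generic U {c \<in> K'. (a \<in> c) = e} \<eta>}" using Cons.IH by simp
  qed
  then show ?case using Cons.prems(1) ultrafilter_mono[OF U] by simp
qed

lemma generic_drop: "generic U K (e # \<eta>) \<Longrightarrow> generic U K \<eta>"
proof -
  assume "generic U K (e # \<eta>)"
  then obtain a where "generic U {c \<in> K. (a \<in> c) = e} \<eta>"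
    using ultrafilter_nonempty[OF U] by fastforce
  then show ?thesis by (rule generic_mono) blast
qed

text \<open>Leaving out an entry replaces almost every point by some suitable point, and forgetting
  the condition there only enlarges the class.\<close>

lemma generic_subseq: "subseq \<sigma> \<eta> \<Longrightarrow> generic U K \<eta> \<Longrightarrow> generic U K \<sigma>"
proof (induction arbitrary: K rule: list_emb.induct)
  case (list_emb_Nil ys)
  then show ?case by (induction ys) (auto dest: generic_drop simp del: generic.simps(2))
next
  case (list_emb_Cons xs ys y)
  then show ?case using generic_drop by blast
next
  case (list_emb_Cons2 x y xs ys)
  have "{a. generic U {c \<in> K. (a \<in> c) = x} ys} \<subseteq> {a. generic U {c \<in> K. (a \<in> c) = x} xs}"
    using list_emb_Cons2.IH by blast
  then show ?case using list_emb_Cons2.prems list_emb_Cons2.hyps(1) ultrafilter_mono[OF U] by simp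
qed

lemma generic_nonempty: "generic U K \<eta> \<Longrightarrow> K \<noteq> {}"
  using generic_subseq[of "[]" \<eta> K] by simp

text \<open>An ultrafilter is prime, so each quantifier over almost all points distributes over the
  union.\<close>

lemma generic_Un: "generic U (K \<union> K') \<eta> \<Longrightarrow> generic U K \<eta> \<or> generic U K' \<eta>"
proof (induction \<eta> arbitrary: K K')
  case Nil
  then show ?case by simp
next
  case (Cons e \<eta>)
  let ?K = "\<lambda>a. {c \<in> K. (a \<in> c) = e}" and ?K' = "\<lambda>a. {c \<in> K'. (a \<in> c) = e}"
  have "{c \<in> K \<union> K'. (a \<in> c) = e} = ?K a \<union> ?K' a" for a by blast
  then have "{a. generic U (?K a \<union> ?K' a) \<eta>} \<in> U" using Cons.prems by simp
  moreover have "{a. generic U (?K a \<union> ?K' a) \<eta>} \<subseteq> {a. generic U (?K a) \<eta>} \<union> {a. generic U (?K' a) \<eta>}"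
    using Cons.IH by blast
  ultimately have "{a. generic U (?K a) \<eta>} \<union> {a. generic U (?K' a) \<eta>} \<in> U"
    by (rule ultrafilter_mono[OF U])
  then show ?case using ultrafilter_Un[OF U] by simp
qed

lemma generic_UN:
  assumes "finite I" "generic U (\<Union>i\<in>I. K i) \<eta>"
  shows "\<exists>i\<in>I. generic U (K i) \<eta>"
  using assms
proof (induction I)
  case empty
  then show ?case using generic_nonempty by fastforce
next
  case (insert i I)
  then have "generic U (K i) \<eta> \<or> generic U (\<Union>i\<in>I. K i) \<eta>" using generic_Un by simp
  then show ?case using insert.IH by blast
qed

text \<open>For finite \<open>S\<close> the class splits by traces into finitely many pieces, one of
  which stays generic; compactness chooses these traces coherently.\<close>

lemma generic_limit_point:
  assumes closed: "closed_class E" and gen: "generic U E \<eta>"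
  shows "\<exists>c\<in>E. \<forall>S. finite S \<longrightarrow> generic U {c'\<in>E. c' \<inter> S = c \<inter> S} \<eta>"
proof -
  have "\<exists>c\<in>UNIV. \<forall>S. finite S \<longrightarrow> generic U {c'\<in>E. c' \<inter> S = c \<inter> S} \<eta>"
  proof (rule compactness_directed[OF closed_class_UNIV])
    show "generic U {z \<in> E. z \<inter> S = c \<inter> S} \<eta> = generic U {z \<in> E. z \<inter> S = c' \<inter> S} \<eta>"
      if "c \<inter> S = c' \<inter> S" for S c c' using that by simp
    show "generic U {z \<in> E. z \<inter> S = c \<inter> S} \<eta>"
      if "S \<subseteq> S'" "generic U {z \<in> E. z \<inter> S' = c \<inter> S'} \<eta>" for S S' c
      using that(2) by (rule generic_mono) (use that(1) in blast)
    show "\<exists>c\<in>UNIV. generic U {z \<in> E. z \<inter> S = c \<inter> S} \<eta>" if S: "finite S" for S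
    proof -
      have "generic U (\<Union>B\<in>Pow S. {z \<in> E. z \<inter> S = B}) \<eta>" 
      proof (rule generic_mono[OF gen], rule subsetI)
        fix z assume "z \<in> E"
        then show "z \<in> (\<Union>B\<in>Pow S. {z \<in> E. z \<inter> S = B})" by (intro UN_I[of "z \<inter> S"]) simp_all
      qed
      then have "\<exists>B\<in>Pow S. generic U {z \<in> E. z \<inter> S = B} \<eta>" using S 
        by (intro generic_UN[of "Pow S" "\<lambda>B. {z \<in> E. z \<inter> S = B}"]) simp_all
      then obtain B where "B \<in> Pow S" "generic U {z \<in> E. z \<inter> S = B} \<eta>" ..
      then show ?thesis by (intro bexI[of _ B]) (simp_all add: Int_absorb2)
    qed
  qed
  then obtain c where c: "\<And>S. finite S \<Longrightarrow> generic U {c'\<in>E. c' \<inter> S = c \<inter> S} \<eta>" by blast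
  have "c \<in> E"
  proof (rule closed_classD[OF closed])
    fix S :: "'p set" assume "finite S"
    then show "\<exists>z\<in>E. z \<inter> S = c \<inter> S" using generic_nonempty[OF c] by blast
  qed
  then show ?thesis using c by blast
qed

text \<open>Choosing the first point splits every class in two according to the value there. The
  induction therefore treats finitely many classes at once and finds one set shattered by all of
  them.\<close>

lemma generic_all_patterns_shatter:
  assumes "finite \<K>" "\<K> \<noteq> {}" "\<And>K \<sigma>. K \<in> \<K> \<Longrightarrow> length \<sigma> = m \<Longrightarrow> generic U K \<sigma>"
  shows "\<exists>S. finite S \<and> card S = m \<and> (\<forall>K\<in>\<K>. shatters K S)"
  using assms
proof (induction m arbitrary: \<K>)
  case 0
  then have "\<forall>K\<in>\<K>. K \<noteq> {}" by (metis generic.simps(1) list.size(3))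
  then show ?case by (intro exI[of _ "{}"]) (auto simp: shatters_def)
next
  case (Suc m)
  let ?K = "\<lambda>a K e. {c \<in> K. (a \<in> c) = e}"
  \<comment> \<open>These are finitely many requirements on the first point, so a single
    \<open>a\<close> meets all of them.\<close>
  let ?I = "\<K> \<times> (UNIV :: bool set) \<times> {\<sigma> :: bool list. length \<sigma> = m}"
  have fin: "finite ?I"
    using Suc.prems(1) finite_lists_length_eq[of "UNIV :: bool set" m] by auto
  have "{a. \<forall>i\<in>?I. generic U (?K a (fst i) (fst (snd i))) (snd (snd i))} \<in> U"
    using fin
  proof (rule ultrafilter_Ball[OF U])
    fix i assume i: "i \<in> ?I"
    then have "generic U (fst i) (fst (snd i) # snd (snd i))" by (intro Suc.prems(3)) auto
    then show "{a. generic U (?K a (fst i) (fst (snd i))) (snd (snd i))} \<in> U" by simp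
  qed
  then obtain a where "\<forall>i\<in>?I. generic U (?K a (fst i) (fst (snd i))) (snd (snd i))"
    using ultrafilter_nonempty[OF U] by blast
  then have a: "\<And>K e \<sigma>. K \<in> \<K> \<Longrightarrow> length \<sigma> = m \<Longrightarrow> generic U (?K a K e) \<sigma>" by simp
  let ?\<K>' = "(\<lambda>(K, e). ?K a K e) ` (\<K> \<times> UNIV)"
  have "finite ?\<K>'" "?\<K>' \<noteq> {}" using Suc.prems(1,2) by simp_all
  moreover have "generic U K' \<sigma>" if "K' \<in> ?\<K>'" "length \<sigma> = m" for K' \<sigma> using that a by auto
  ultimately obtain S where S: "finite S" "card S = m" "\<And>K'. K' \<in> ?\<K>' \<Longrightarrow> shatters K' S"
    using Suc.IH by meson
  have sh: "shatters (?K a K e) S" if "K \<in> \<K>" for K e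
    by (rule S(3)) (use that in auto)
  obtain K0 where K0: "K0 \<in> \<K>" using Suc.prems(2) by blast
    have "a \<notin> S"
    proof
      assume "a \<in> S"
      obtain c where "c \<in> ?K a K0 True" "c \<inter> S = {}" using shattersD[OF sh[OF K0], of "{}" True] by auto
      then show False using \<open>a \<in> S\<close> by blast
    qed
    moreover have "shatters K (insert a S)" if K: "K \<in> \<K>" for K
      unfolding shatters_def
    proof (intro allI impI)
      fix B assume B: "B \<subseteq> insert a S"
      obtain c where c: "c \<in> ?K a K (a \<in> B)" "c \<inter> S = B \<inter> S"
        using shattersD[OF sh[OF K], of "B \<inter> S" "a \<in> B"] by auto
      then have "c \<inter> insert a S = B" using B by blast
      then show "\<exists>C\<in>K. C \<inter> insert a S = B" using c(1) by blast
    qed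
    ultimately show ?case using S(1,2) by (intro exI[of _ "insert a S"]) auto
qed

section \<open>Limit classes and compressible points of cylinders\<close>

definition limit_class :: "'p set set \<Rightarrow> bool list \<Rightarrow> 'p set set" where
  "limit_class K \<eta> = {c. \<forall>S. finite S \<longrightarrow> generic U {c' \<in> K. c' \<inter> S = c \<inter> S} \<eta>}"

lemma limit_class_subset:
  assumes "closed_class K"
  shows "limit_class K \<eta> \<subseteq> K"
proof
  fix c assume c: "c \<in> limit_class K \<eta>"
  show "c \<in> K"
  proof (rule closed_classD[OF assms])
    fix S :: "'p set" assume "finite S"
    then have "{c' \<in> K. c' \<inter> S = c \<inter> S} \<noteq> {}"
      using c unfolding limit_class_def by (intro generic_nonempty[of _ \<eta>]) simp
    then show "\<exists>z\<in>K. z \<inter> S = c \<inter> S" by blast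
  qed
qed

lemma closed_limit_class: "closed_class (limit_class K \<eta>)"
  unfolding closed_class_def
proof (intro allI impI)
  fix c assume *: "\<forall>S. finite S \<longrightarrow> (\<exists>z\<in>limit_class K \<eta>. z \<inter> S = c \<inter> S)"
  have "generic U {c' \<in> K. c' \<inter> S = c \<inter> S} \<eta>" if S: "finite S" for S
  proof -
    obtain z where z: "z \<in> limit_class K \<eta>" "z \<inter> S = c \<inter> S" using * S by blast
    from z(1) have "generic U {c' \<in> K. c' \<inter> S = z \<inter> S} \<eta>" using S unfolding limit_class_def by simp
    then show ?thesis unfolding z(2) .
  qed
  then show "c \<in> limit_class K \<eta>" unfolding limit_class_def by simp
qed

text \<open>The limit class consists of the limits of members that realise \<open>\<eta>\<close>
  generically. The use is contrapositive: a closed \<open>E\<close> that misses the limit class is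
  not generic for \<open>\<eta>\<close>.\<close>

lemma limit_class_meets:
  assumes "closed_class E" "generic U E \<eta>" "E \<subseteq> K"
  shows "\<exists>c\<in>E. c \<in> limit_class K \<eta>"
proof -
  obtain c where c: "c \<in> E" "\<And>S. finite S \<Longrightarrow> generic U {c'\<in>E. c' \<inter> S = c \<inter> S} \<eta>"
    using generic_limit_point[OF assms(1,2)] by blast
  have "generic U {c'\<in>K. c' \<inter> S = c \<inter> S} \<eta>" if "finite S" for S
    using c(2)[OF that] by (rule generic_mono) (use assms(3) in blast)
  then show ?thesis using c(1) unfolding limit_class_def by blast
qed

text \<open>If genericity fails, it fails for almost every choice of the next point; as
  \<open>p\<close> belongs to \<open>U\<close>, such points can be picked in \<open>p\<close>. After
  \<open>l\<close> choices no member of \<open>E\<close> contains them all.\<close>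

lemma not_generic_avoid:
  assumes "p \<in> U" "\<not> generic U E (replicate l True)"
  shows "\<exists>W. finite W \<and> card W \<le> l \<and> W \<subseteq> p \<and> (\<forall>c\<in>E. \<not> W \<subseteq> c)"
  using assms(2)
proof (induction l arbitrary: E)
  case 0
  then show ?case by (intro exI[of _ "{}"]) simp
next
  case (Suc l)
  then have "{a. generic U {c \<in> E. (a \<in> c) = True} (replicate l True)} \<notin> U" by simp
  then have "{a. \<not> generic U {c \<in> E. (a \<in> c) = True} (replicate l True)} \<in> U"
    by (rule ultrafilter_not_eventually[OF U])
  then have "{a. \<not> generic U {c \<in> E. (a \<in> c) = True} (replicate l True)} \<inter> p \<in> U"
    using assms(1) by (rule ultrafilter_Int[OF U])
  then obtain a where a: "a \<in> p" "\<not> generic U {c \<in> E. (a \<in> c) = True} (replicate l True)"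
    using ultrafilter_nonempty[OF U] by blast
  obtain W where W: "finite W" "card W \<le> l" "W \<subseteq> p" "\<forall>c\<in>{c \<in> E. (a \<in> c) = True}. \<not> W \<subseteq> c"
    using Suc.IH[OF a(2)] by blast
  have "card (insert a W) \<le> Suc l" using W(1,2) by (simp add: card_insert_if)
  moreover have "\<forall>c\<in>E. \<not> insert a W \<subseteq> c" using W(4) by blast
  ultimately show ?case using W(1,3) a(1) by (intro exI[of _ "insert a W"]) simp
qed

definition cylinder :: "'p set set \<Rightarrow> 'p set \<Rightarrow> 'p set \<Rightarrow> 'p set set" where
  "cylinder K P N = {c \<in> K. P \<subseteq> c \<and> N \<inter> c = {}}"

text \<open>A point \<open>p\<close> of the limit class with \<open>p \<notin> U\<close> allows to insert a \<open>0\<close> before the run of \<open>1\<close>s.\<close>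

lemma compressible_in_ultrafilter_or_insert:
  assumes closed: "closed_class K" and vc: "vc_le K D" and fin: "finite P" "finite N"
    and gen: "generic U (cylinder K P N) (replicate l True)"
  shows "(\<exists>p\<in>K. compressible (k_comp D + card P + card N + l) K {p} \<and> p \<in> U) \<or>
    generic U (cylinder K P N) (False # replicate l True)"
proof -
  let ?K = "cylinder K P N"
  let ?Z = "limit_class ?K (replicate l True)"
  have KK: "?K \<subseteq> K" unfolding cylinder_def by blast
  have Kcl: "closed_class ?K"
    unfolding cylinder_def
    by (rule closed_class_restrict[OF closed, of "P \<union> N"]) (use fin in \<open>auto simp: set_eq_iff\<close>)
  have ZK: "?Z \<subseteq> ?K" using Kcl by (rule limit_class_subset)
  have Zne: "?Z \<noteq> {}" using limit_class_meets[OF Kcl gen] by blast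
  have Zvc: "vc_le ?Z D" using vc ZK KK by (meson vc_le_subset)
  obtain p where p: "p \<in> ?Z" "compressible (k_comp D) ?Z {p}"
    using compressible_point[OF closed_limit_class Zne Zvc] by blast
  have pK: "p \<in> ?K" using p(1) ZK by blast
  show ?thesis
  proof (cases "p \<in> U")
    case True
    have "compressible (k_comp D + card P + card N + l) K {p}"
      unfolding compressible_def
    proof (intro conjI allI impI)
      show "{p} \<subseteq> K" using pK KK by blast
      show "{p} \<noteq> {}" by simp
      show "closed_class {p}" using p(2) unfolding compressible_def by blast
      fix S :: "'p set" assume S: "finite S"
      obtain Y where Y: "finite Y" "card Y \<le> k_comp D" "isolates ?Z {p} Y S"
        using p(2) S by (rule compressibleD)
      \<comment> \<open>The members of the cylinder that \<open>Y\<close> fails to exclude. They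
        form a closed class disjoint from the limit class, so the run of 1s is not generic for it,
        and at most \<open>l\<close> points of \<open>p\<close> exclude them.\<close>
      let ?E = "{c \<in> ?K. c \<inter> Y = p \<inter> Y \<and> c \<inter> S \<noteq> p \<inter> S}"
      have "\<not> generic U ?E (replicate l True)"
      proof
        assume g: "generic U ?E (replicate l True)"
        have "closed_class ?E"
        proof (rule closed_class_restrict[OF Kcl, of "Y \<union> S"])
          fix c c' :: "'p set" assume "c \<inter> (Y \<union> S) = c' \<inter> (Y \<union> S)"
          then have "c \<inter> Y = c' \<inter> Y" "c \<inter> S = c' \<inter> S" by blast+
          then show "(c \<inter> Y = p \<inter> Y \<and> c \<inter> S \<noteq> p \<inter> S) = (c' \<inter> Y = p \<inter> Y \<and> c' \<inter> S \<noteq> p \<inter> S)" by simp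
        qed (use Y(1) S in simp)
        then have "\<exists>c\<in>?E. c \<in> ?Z" using g by (rule limit_class_meets) blast
        then obtain c where c: "c \<in> ?Z" "c \<inter> Y = p \<inter> Y" "c \<inter> S \<noteq> p \<inter> S" by blast
        show False using isolatesD[OF Y(3) singletonI c(1,2)] c(3) by simp
      qed
      from not_generic_avoid[OF True this] obtain W where
        W: "finite W" "card W \<le> l" "W \<subseteq> p" "\<forall>c\<in>?E. \<not> W \<subseteq> c" by (elim exE conjE)
      \<comment> \<open>\<open>P\<close> and \<open>N\<close> place a member of \<open>K\<close> in
        the cylinder and \<open>W\<close> keeps it out of \<open>?E\<close>; agreement with
        \<open>p\<close> on \<open>Y\<close> then yields agreement on \<open>S\<close>.\<close>
      let ?Y = "Y \<union> P \<union> N \<union> W"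
      have "isolates K {p} ?Y S"
      proof (rule isolatesI)
        fix z c assume z: "z \<in> {p}" and c: "c \<in> K" "c \<inter> ?Y = z \<inter> ?Y"
        have cp: "x \<in> c \<longleftrightarrow> x \<in> p" if "x \<in> ?Y" for x using c(2) z that by blast
        have cK: "c \<in> ?K" using cp pK c(1) unfolding cylinder_def by auto
        have cY: "c \<inter> Y = p \<inter> Y" using cp by auto
        have "W \<subseteq> c" using cp W(3) by auto
        then have "c \<notin> ?E" using bspec[OF W(4), of c] by blast
        then have "c \<inter> S = p \<inter> S" using cK cY by simp
        then show "\<exists>z'\<in>{p}. z' \<inter> S = c \<inter> S" by simp
      qed simp
      moreover have "card ?Y \<le> k_comp D + card P + card N + l"
        using card_Un_le[of "Y \<union> P \<union> N" W] card_Un_le[of "Y \<union> P" N] card_Un_le[of Y P] Y(2) W(2)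
        by linarith
      ultimately show "\<exists>Y. finite Y \<and> card Y \<le> k_comp D + card P + card N + l \<and> isolates K {p} Y S"
        using Y(1) W(1) fin by (intro exI[of _ ?Y]) simp
    qed
    then show ?thesis using pK KK True by blast
  next
    case False
    then have "- p \<in> U" by (simp add: ultrafilter_Compl[OF U])
    \<comment> \<open>As \<open>p\<close> is in the limit class, its neighbourhood given by
      \<open>{a}\<close> is generic, and all members of that neighbourhood omit
      \<open>a\<close>.\<close>
    moreover have "- p \<subseteq> {a. generic U {c \<in> ?K. (a \<in> c) = False} (replicate l True)}"
    proof
      fix a assume a: "a \<in> - p"
      have "generic U {c' \<in> ?K. c' \<inter> {a} = p \<inter> {a}} (replicate l True)"
        using p(1) unfolding limit_class_def by simp
      moreover have "{c' \<in> ?K. c' \<inter> {a} = p \<inter> {a}} \<subseteq> {c \<in> ?K. (a \<in> c) = False}" using a by auto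
      ultimately show "a \<in> {a. generic U {c \<in> ?K. (a \<in> c) = False} (replicate l True)}"
        using generic_mono by simp
    qed
    ultimately have "{a. generic U {c \<in> ?K. (a \<in> c) = False} (replicate l True)} \<in> U"
      by (rule ultrafilter_mono[OF U])
    then show ?thesis by simp
  qed
qed

lemma cylinder_restrict:
  "{c \<in> cylinder K P N. (a \<in> c) = e} =
     cylinder K (if e then insert a P else P) (if e then N else insert a N)"
  unfolding cylinder_def by auto

text \<open>The points for the prefix \<open>\<eta>\<close> are moved one by one into
  \<open>P\<close> or \<open>N\<close>. Each adds at most one condition and shortens
  \<open>\<eta>\<close> by one, so the bound \<open>m\<close> stays valid.\<close>

lemma compressible_in_ultrafilter_or_insert_after:
  assumes closed: "closed_class K" and vc: "vc_le K D"
    and no: "\<And>p. p \<in> K \<Longrightarrow> p \<in> U \<Longrightarrow> \<not> compressible m K {p}"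
    and "finite P" "finite N" "k_comp D + card P + card N + length \<eta> + l \<le> m"
    and "generic U (cylinder K P N) (\<eta> @ replicate l True)"
  shows "generic U (cylinder K P N) (\<eta> @ False # replicate l True)"
  using assms(4-7)
proof (induction \<eta> arbitrary: P N)
  case Nil
  have "\<not> compressible (k_comp D + card P + card N + l) K {p}" if "p \<in> K" "p \<in> U" for p
    using no[OF that] compressible_mono[of _ K "{p}" m] Nil(3) by auto
  then show ?case using compressible_in_ultrafilter_or_insert[OF closed vc Nil(1,2)] Nil(4) by auto
next
  case (Cons e \<eta>)
  let ?P = "\<lambda>a. if e then insert a P else P" and ?N = "\<lambda>a. if e then N else insert a N"
  have "{a. generic U (cylinder K (?P a) (?N a)) (\<eta> @ replicate l True)} \<in> U"
    using Cons.prems(4) by (simp add: cylinder_restrict)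
  moreover have "generic U (cylinder K (?P a) (?N a)) (\<eta> @ False # replicate l True)"
    if "generic U (cylinder K (?P a) (?N a)) (\<eta> @ replicate l True)" for a
  proof (rule Cons.IH[OF _ _ _ that])
    show "finite (?P a)" "finite (?N a)" using Cons.prems by simp_all
    have "card (?P a) + card (?N a) \<le> Suc (card P + card N)"
      using Cons.prems(1,2) by (simp add: card_insert_if)
    then show "k_comp D + card (?P a) + card (?N a) + length \<eta> + l \<le> m" using Cons.prems(3) by simp
  qed
  ultimately have "{a. generic U (cylinder K (?P a) (?N a)) (\<eta> @ False # replicate l True)} \<in> U"
    using ultrafilter_mono[OF U] by (smt (verit, best) Collect_mono)
  then show ?case by (simp add: cylinder_restrict)
qed

text \<open>\<open>P\<close> collects the points chosen so far; together with the \<open>l\<close>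
  points still to come they lie in one member of \<open>K\<close>.\<close>

lemma generic_all_True:
  assumes "\<And>Y. finite Y \<Longrightarrow> card Y \<le> card P + l \<Longrightarrow> \<exists>c\<in>K. Y \<subseteq> c" "finite P"
  shows "generic U {c \<in> K. P \<subseteq> c} (replicate l True)"
  using assms
proof (induction l arbitrary: P)
  case 0
  then show ?case by auto
next
  case (Suc l)
  have "generic U {c \<in> K. insert a P \<subseteq> c} (replicate l True)" for a
  proof (rule Suc.IH)
    fix Y :: "'p set" assume "finite Y" "card Y \<le> card (insert a P) + l"
    moreover have "card (insert a P) \<le> Suc (card P)" using Suc.prems(2) by (simp add: card_insert_if)
    ultimately show "\<exists>c\<in>K. Y \<subseteq> c" using Suc.prems(1) by simp
  qed (use Suc.prems in simp)
  moreover have "{c \<in> {c \<in> K. P \<subseteq> c}. (a \<in> c) = True} = {c \<in> K. insert a P \<subseteq> c}" for a by auto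
  ultimately show ?case using ultrafilter_UNIV[OF U] by simp
qed

section \<open>Alternating patterns\<close>

definition alternating :: "nat \<Rightarrow> bool list" where
  "alternating j = concat (replicate j [False, True])"

lemma alternating_Suc: "alternating (Suc j) = False # True # alternating j"
  by (simp add: alternating_def)

lemma alternating_Suc': "alternating (Suc j) = alternating j @ [False, True]"
  by (induction j) (simp_all add: alternating_def)

lemma length_alternating: "length (alternating j) = 2 * j"
  by (induction j) (simp_all add: alternating_Suc, simp add: alternating_def)

text \<open>Each entry is taken from its own block \<open>01\<close>.\<close>

lemma subseq_alternating: "length \<sigma> = j \<Longrightarrow> subseq \<sigma> (alternating j)"
proof (induction \<sigma> arbitrary: j)
  case Nil
  then show ?case by simp
next
  case (Cons e \<sigma>)
  then obtain j' where j: "j = Suc j'" "length \<sigma> = j'" by auto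
  then have "subseq \<sigma> (alternating j')" using Cons.IH by simp
  then show ?case by (cases e) (auto simp: j(1) alternating_Suc)
qed

text \<open>Starting from \<open>1\<^sup>D\<^sup>+\<^sup>1\<close>, each failure inserts a \<open>0\<close>, which eventually yields
  the pattern \<open>(01)\<^sup>D\<^sup>+\<^sup>1\<close> and thereby too large a shattered set.\<close>

lemma compressible_in_ultrafilter:
  assumes closed: "closed_class K" and vc: "vc_le K D"
    and hype: "\<And>Y. finite Y \<Longrightarrow> card Y \<le> Suc D \<Longrightarrow> \<exists>c\<in>K. Y \<subseteq> c"
  shows "\<exists>p\<in>K. compressible (k_comp D + 2 * D + 1) K {p} \<and> p \<in> U"
proof (rule ccontr)
  assume neg: "\<not> ?thesis"
  then have no: "\<And>p. p \<in> K \<Longrightarrow> p \<in> U \<Longrightarrow> \<not> compressible (k_comp D + 2 * D + 1) K {p}" by blast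
  have K: "cylinder K {} {} = K" unfolding cylinder_def by auto
  \<comment> \<open>The inserted 0 and the first 1 of the remaining run form a new block
    \<open>01\<close>, so the alternating part grows while the run shrinks.\<close>
  have gen: "generic U K (alternating j @ replicate (Suc D - j) True)" if "j \<le> Suc D" for j
    using that
  proof (induction j)
    case 0
    then show ?case using generic_all_True[of "{}" "Suc D" K] hype by (simp add: alternating_def)
  next
    case (Suc j)
    have l: "Suc D - j = Suc (D - j)" using Suc.prems by simp
    have "generic U (cylinder K {} {}) (alternating j @ False # replicate (Suc D - j) True)"
    proof (rule compressible_in_ultrafilter_or_insert_after[OF closed vc no])
      \<comment> \<open>Here \<open>j \<le> D\<close>, so the pattern has length
        \<open>2 * j + (D + 1 - j) \<le> 2 * D + 1\<close>; this is the source of the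
        constant.\<close>
      show "k_comp D + card {} + card {} + length (alternating j) + (Suc D - j) \<le> k_comp D + 2 * D + 1"
        using Suc.prems by (simp add: length_alternating)
      show "generic U (cylinder K {} {}) (alternating j @ replicate (Suc D - j) True)"
        using Suc unfolding K by simp
    qed simp_all
    then show ?case unfolding K alternating_Suc' l by simp
  qed
  have "generic U K' \<sigma>" if "K' \<in> {K}" "length \<sigma> = Suc D" for K' \<sigma>
    using generic_subseq[OF subseq_alternating[OF that(2)]] gen[of "Suc D"] that(1) by simp
  then obtain S where "finite S" "card S = Suc D" "shatters K S"
    using generic_all_patterns_shatter[of "{K}" "Suc D"] by auto
  then show False using vc_leD[OF vc] by fastforce
qed

end

section \<open>Sauer--Shelah and the classes of agreement tuples\<close>

text \<open>Pajor's lemma. Split \<open>T\<close> by membership of \<open>x\<close>: a set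
  \<open>B\<close> shattered by both parts contributes \<open>B\<close> and
  \<open>insert x B\<close>, so nothing is lost when the two counts from the induction are
  added.\<close>

lemma card_le_card_shattered:
  assumes "finite S" "T \<subseteq> Pow S"
  shows "card T \<le> card {B. B \<subseteq> S \<and> shatters T B}"
  using assms
proof (induction S arbitrary: T rule: finite_induct)
  case empty
  then have "T = {} \<or> T = {{}}" by auto
  then show ?case
  proof
    assume T: "T = {{}}"
    have "{B. B \<subseteq> {} \<and> shatters T B} = {{}}" unfolding T by (auto simp: shatters_def)
    then show ?thesis using T by simp
  qed simp
next
  case (insert x S)
  let ?sh = "\<lambda>T S. {B. B \<subseteq> S \<and> shatters T B}"
  define T0 where "T0 = {t \<in> T. x \<notin> t}"
  define T1 where "T1 = (\<lambda>t. t - {x}) ` {t \<in> T. x \<in> t}"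
  have sub: "T0 \<subseteq> Pow S" "T1 \<subseteq> Pow S" using insert.prems unfolding T0_def T1_def by auto
  have finT: "finite T" using insert.prems insert.hyps(1) by (meson finite.insertI finite_Pow_iff finite_subset)
  have inj: "inj_on (\<lambda>t. t - {x}) {t \<in> T. x \<in> t}"
    by (rule inj_onI) (metis (no_types, lifting) insert_Diff mem_Collect_eq)
  have "card T = card T0 + card {t \<in> T. x \<in> t}"
  proof -
    have "T = T0 \<union> {t \<in> T. x \<in> t}" "T0 \<inter> {t \<in> T. x \<in> t} = {}" unfolding T0_def by auto
    then show ?thesis using finT card_Un_disjoint[of T0 "{t \<in> T. x \<in> t}"] by (metis (lifting) finite_Un)
  qed
  also have "card {t \<in> T. x \<in> t} = card T1" unfolding T1_def using inj by (simp add: card_image)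
  finally have cT: "card T = card T0 + card T1" .
  have finsh: "finite (?sh T' S)" for T' using insert.hyps(1) by simp
  have "card T \<le> card (?sh T0 S) + card (?sh T1 S)"
    unfolding cT using insert.IH[OF sub(1)] insert.IH[OF sub(2)] by linarith
  also have "\<dots> = card (?sh T0 S \<union> ?sh T1 S) + card (?sh T0 S \<inter> ?sh T1 S)"
    using card_Un_Int[OF finsh finsh] by simp
  also have "card (?sh T0 S \<inter> ?sh T1 S) = card (insert x ` (?sh T0 S \<inter> ?sh T1 S))"
  proof (rule card_image[symmetric])
    show "inj_on (insert x) (?sh T0 S \<inter> ?sh T1 S)"
    proof (rule inj_onI)
      fix B B' assume "B \<in> ?sh T0 S \<inter> ?sh T1 S" "B' \<in> ?sh T0 S \<inter> ?sh T1 S" "insert x B = insert x B'"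
      then show "B = B'" using insert.hyps(2) by (metis (no_types, lifting) IntD1 insert_ident mem_Collect_eq subsetD)
    qed
  qed
  also have "card (?sh T0 S \<union> ?sh T1 S) + card (insert x ` (?sh T0 S \<inter> ?sh T1 S))
      = card ((?sh T0 S \<union> ?sh T1 S) \<union> insert x ` (?sh T0 S \<inter> ?sh T1 S))"
    using insert.hyps(1,2) by (intro card_Un_disjoint[symmetric]) auto
  also have "\<dots> \<le> card (?sh T (insert x S))"
  proof (rule card_mono)
    show "finite (?sh T (insert x S))" using insert.hyps(1) by simp
    have 0: "shatters T B" if "shatters T0 B" for B
      using that by (rule shatters_mono) (simp add: T0_def)
    have 1: "shatters T B" if s1: "shatters T1 B" "B \<subseteq> S" for B
      unfolding shatters_def
    proof (intro allI impI)
      fix C assume "C \<subseteq> B"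
      then obtain t where t: "t \<in> T1" "t \<inter> B = C" using shattersD[OF s1(1)] by blast
      obtain u where "u \<in> T" "t = u - {x}" using t(1) unfolding T1_def by blast
      then show "\<exists>u\<in>T. u \<inter> B = C" using t(2) s1(2) insert.hyps(2) by (intro bexI[of _ u]) auto
    qed
    have 2: "shatters T (insert x B)" if B: "shatters T0 B" "shatters T1 B" "B \<subseteq> S" for B
      unfolding shatters_def
    proof (intro allI impI)
      fix C assume C: "C \<subseteq> insert x B"
      have xB: "x \<notin> B" using B(3) insert.hyps(2) by blast
      show "\<exists>u\<in>T. u \<inter> insert x B = C"
      proof (cases "x \<in> C")
        case True
        obtain t where t: "t \<in> T1" "t \<inter> B = C - {x}" using shattersD[OF B(2), of "C - {x}"] C by blast
        obtain u where "u \<in> T" "x \<in> u" "t = u - {x}" using t(1) unfolding T1_def by blast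
        then show ?thesis using t(2) True xB by (intro bexI[of _ u]) auto
      next
        case False
        then obtain t where "t \<in> T0" "t \<inter> B = C" using shattersD[OF B(1), of C] C by blast
        then show ?thesis unfolding T0_def by (intro bexI[of _ t]) auto
      qed
    qed
    show "(?sh T0 S \<union> ?sh T1 S) \<union> insert x ` (?sh T0 S \<inter> ?sh T1 S) \<subseteq> ?sh T (insert x S)"
    proof
      fix B assume "B \<in> (?sh T0 S \<union> ?sh T1 S) \<union> insert x ` (?sh T0 S \<inter> ?sh T1 S)"
      then show "B \<in> ?sh T (insert x S)"
      proof (elim UnE imageE)
        fix B' assume "B = insert x B'" "B' \<in> ?sh T0 S \<inter> ?sh T1 S"
        then show ?thesis using 2[of B'] by auto
      qed (use 0 1 in auto)
    qed
  qed
  finally show ?case .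
qed

lemma card_subsets_le: "finite S \<Longrightarrow> card {B. B \<subseteq> S \<and> card B \<le> k} = choose_le (card S) k"
proof -
  assume S: "finite S"
  have "{B. B \<subseteq> S \<and> card B \<le> k} = (\<Union>i\<in>{..k}. {B. B \<subseteq> S \<and> card B = i})" by auto
  also have "card \<dots> = (\<Sum>i\<in>{..k}. card {B. B \<subseteq> S \<and> card B = i})"
    using S by (intro card_UN_disjoint) auto
  finally show ?thesis unfolding choose_le_def by (simp add: n_subsets[OF S])
qed

text \<open>A family has at most as many members as it shatters sets, and each of these has at most
  \<open>k\<close> elements.\<close>

lemma sauer_shelah:
  assumes "finite S" "T \<subseteq> Pow S" "vc_le T k"
  shows "card T \<le> choose_le (card S) k"
proof -
  have "card T \<le> card {B. B \<subseteq> S \<and> shatters T B}" using assms(1,2) by (rule card_le_card_shattered)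
  also have "\<dots> \<le> card {B. B \<subseteq> S \<and> card B \<le> k}"
    using assms(1) by (intro card_mono) (auto intro!: vc_leD[OF assms(3)] intro: finite_subset)
  finally show ?thesis using card_subsets_le[OF assms(1)] by simp
qed

text \<open>Label \<open>2 ^ m\<close> of the indices as \<open>f P\<close> with
  \<open>P \<subseteq> {..<m}\<close> and let \<open>x i\<close> realise the pattern of all
  \<open>f P\<close> with \<open>i \<in> P\<close>. Then the set with index \<open>f P\<close>
  contains exactly those \<open>x i\<close> with \<open>i \<in> P\<close>.\<close>

lemma dual_shatters:
  assumes J: "finite J" "2 ^ m \<le> card J"
    and sh: "\<And>B. B \<subseteq> J \<Longrightarrow> \<exists>a\<in>X. \<forall>i\<in>J. R i a \<longleftrightarrow> i \<in> B"
  obtains S where "finite S" "S \<subseteq> X" "card S = m" "shatters ((\<lambda>i. {a. R i a}) ` J) S"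
proof -
  obtain J' where J': "J' \<subseteq> J" "card J' = 2 ^ m" using obtain_subset_with_card_n[OF J(2)] by metis
  have "card (Pow {..<m}) = card J'" by (simp add: J'(2) card_Pow)
  then obtain f where f: "bij_betw f (Pow {..<m}) J'"
    using finite_same_card_bij[of "Pow {..<m}" J'] J(1) J'(1) finite_subset by auto
  then have inj: "inj_on f (Pow {..<m})" and im: "f ` Pow {..<m} = J'" unfolding bij_betw_def by auto
  have "\<forall>i. \<exists>a\<in>X. \<forall>j\<in>J. R j a \<longleftrightarrow> j \<in> f ` {P \<in> Pow {..<m}. i \<in> P}"
  proof
    fix i
    have "f ` {P \<in> Pow {..<m}. i \<in> P} \<subseteq> J" using im J'(1) by auto
    then show "\<exists>a\<in>X. \<forall>j\<in>J. R j a \<longleftrightarrow> j \<in> f ` {P \<in> Pow {..<m}. i \<in> P}" by (rule sh)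
  qed
  then obtain x where x: "\<And>i. x i \<in> X" "\<And>i j. j \<in> J \<Longrightarrow> R j (x i) \<longleftrightarrow> j \<in> f ` {P \<in> Pow {..<m}. i \<in> P}"
    by metis
  have R: "R (f P) (x i) \<longleftrightarrow> i \<in> P" if P: "P \<subseteq> {..<m}" for P i
  proof -
    have "f P \<in> J" using P im J'(1) by auto
    then have "R (f P) (x i) \<longleftrightarrow> f P \<in> f ` {P \<in> Pow {..<m}. i \<in> P}" by (rule x(2))
    also have "\<dots> \<longleftrightarrow> P \<in> {P \<in> Pow {..<m}. i \<in> P}"
      using inj by (rule inj_on_image_mem_iff) (use P in auto)
    finally show ?thesis using P by simp
  qed
  \<comment> \<open>The set with index \<open>f {i}\<close> separates \<open>x i\<close> from the
    other points.\<close>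
  have "inj_on x {..<m}"
  proof (rule inj_onI)
    fix i i' assume i: "i \<in> {..<m}" "i' \<in> {..<m}" "x i = x i'"
    have sub: "{i} \<subseteq> {..<m}" using i(1) by simp
    have "R (f {i}) (x i)" by (rule iffD2[OF R[OF sub]]) simp
    then have "R (f {i}) (x i')" unfolding i(3) .
    then have "i' \<in> {i}" by (rule iffD1[OF R[OF sub]])
    then show "i = i'" by simp
  qed
  then have card: "card (x ` {..<m}) = m" by (simp add: card_image)
  have "shatters ((\<lambda>i. {a. R i a}) ` J) (x ` {..<m})"
    unfolding shatters_def
  proof (intro allI impI)
    fix B assume B: "B \<subseteq> x ` {..<m}"
    let ?P = "{i \<in> {..<m}. x i \<in> B}"
    have "{a. R (f ?P) a} \<inter> x ` {..<m} = B"
    proof -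
      have "R (f ?P) (x i) \<longleftrightarrow> i \<in> ?P" for i by (rule R) auto
      moreover have "i \<in> ?P \<longleftrightarrow> x i \<in> B" if "i < m" for i using that by simp
      ultimately have "R (f ?P) (x i) \<longleftrightarrow> x i \<in> B" if "i < m" for i using that by metis
      then show ?thesis using B by fastforce
    qed
    moreover have "f ?P \<in> J'" unfolding im[symmetric] by (intro imageI) auto
    then have "f ?P \<in> J" using J'(1) by blast
    ultimately show "\<exists>C\<in>(\<lambda>i. {a. R i a}) ` J. C \<inter> x ` {..<m} = B" by blast
  qed
  then show thesis using card x(1) by (intro that[of "x ` {..<m}"]) auto
qed

section \<open>The growth bound behind \<open>B_vc\<close>\<close>

lemma exp_beats_poly: "\<exists>s0. \<forall>s\<ge>s0. C * (s + 1) ^ M < (2::nat) ^ s"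
proof (induction M arbitrary: C)
  case 0
  have "C * (s + 1) ^ 0 < 2 ^ s" if "C \<le> s" for s
    using le_less_trans[OF that less_exp[of s]] by simp
  then show ?case by blast
next
  case (Suc M)
  obtain t0 where t0: "\<And>t. t \<ge> t0 \<Longrightarrow> (C * 2 ^ Suc M) * (t + 1) ^ M < 2 ^ t" using Suc.IH by blast
  have "C * (s + 1) ^ Suc M < 2 ^ s" if s: "2 * t0 \<le> s" for s
  proof -
    \<comment> \<open>Half of the exponent absorbs the factor of degree \<open>M\<close> by
      induction, the other half absorbs the remaining \<open>t + 1\<close>.\<close>
    define t where "t = s div 2"
    have t: "t0 \<le> t" "s + 1 \<le> 2 * (t + 1)" "2 * t \<le> s" using s unfolding t_def by auto
    have "C * (s + 1) ^ Suc M \<le> C * (2 * (t + 1)) ^ Suc M"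
      using t(2) by (intro mult_le_mono2 power_mono) auto
    also have "\<dots> = (C * 2 ^ Suc M) * (t + 1) ^ M * (t + 1)" 
      by (simp only: power_mult_distrib power_Suc ac_simps)
    also have "\<dots> < 2 ^ t * (t + 1)" using t0[OF t(1)] by (rule mult_strict_right_mono) simp
    also have "\<dots> \<le> 2 ^ t * 2 ^ t" using Suc_leI[OF less_exp[of t]] by (intro mult_le_mono2) simp
    also have "\<dots> = 2 ^ (2 * t)" by (simp add: power_add mult_2)
    also have "\<dots> \<le> 2 ^ s" using t(3) by (intro power_increasing) auto
    finally show ?thesis .
  qed
  then show ?case by blast
qed

lemma choose_le_poly: "choose_le s k \<le> (k + 1) * (s + 1) ^ k"
proof -
  have "s choose i \<le> (s + 1) ^ k" if "i \<le> k" for i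
  proof (cases "i \<le> s")
    case True
    then have "s choose i \<le> s ^ i" by (rule binomial_le_pow)
    also have "\<dots> \<le> (s + 1) ^ i" by (intro power_mono) auto
    also have "\<dots> \<le> (s + 1) ^ k" using that by (intro power_increasing) auto
    finally show ?thesis .
  qed (simp add: binomial_eq_0)
  then have "(\<Sum>i\<le>k. s choose i) \<le> (\<Sum>i\<le>k. (s + 1) ^ k)" by (intro sum_mono) auto
  then show ?thesis unfolding choose_le_def by simp
qed

text \<open>\<open>Max\<close> is meaningful because the set is finite:
  \<open>choose_le s k ^ n\<close> grows polynomially in \<open>s\<close>.\<close>

lemma le_B_vc:
  assumes "2 ^ s \<le> choose_le s k ^ n"
  shows "s \<le> B_vc n k"
proof -
  obtain s0 where s0: "\<And>s. s \<ge> s0 \<Longrightarrow> (k + 1) ^ n * (s + 1) ^ (k * n) < 2 ^ s" using exp_beats_poly by blast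
  have "{s. choose_le s k ^ n \<ge> 2 ^ s} \<subseteq> {..s0}"
  proof
    fix s assume "s \<in> {s. choose_le s k ^ n \<ge> 2 ^ s}"
    then have "2 ^ s \<le> choose_le s k ^ n" by simp
    also have "\<dots> \<le> ((k + 1) * (s + 1) ^ k) ^ n" by (intro power_mono choose_le_poly) simp
    also have "\<dots> = (k + 1) ^ n * (s + 1) ^ (k * n)" by (simp only: power_mult_distrib power_mult)
    finally show "s \<in> {..s0}" using s0[of s] by fastforce
  qed
  then have "finite {s. choose_le s k ^ n \<ge> 2 ^ s}" by (rule finite_subset) simp
  then show ?thesis unfolding B_vc_def using assms by (intro Max_ge) auto
qed

section \<open>Agreement classes and their VC-dimension\<close>

lemma vc_le_flip:
  assumes "vc_le K d"
  shows "vc_le ((\<lambda>c. {a. a \<in> c \<longleftrightarrow> a \<in> g}) ` K) d"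
  unfolding vc_le_def
proof (intro allI impI)
  fix S :: "'a set" assume S: "finite S" "shatters ((\<lambda>c. {a. a \<in> c \<longleftrightarrow> a \<in> g}) ` K) S"
  \<comment> \<open>Up to complement, the points where \<open>c\<close> and \<open>g\<close> agree
    form the symmetric difference of \<open>c\<close> and \<open>g\<close>, and taking it permutes
    the traces on \<open>S\<close>.\<close>
  have "shatters K S"
    unfolding shatters_def
  proof (intro allI impI)
    fix B assume B: "B \<subseteq> S"
    obtain c where c: "c \<in> K" "{a. a \<in> c \<longleftrightarrow> a \<in> g} \<inter> S = {a \<in> S. a \<in> B \<longleftrightarrow> a \<in> g}"
      using shattersD[OF S(2), of "{a \<in> S. a \<in> B \<longleftrightarrow> a \<in> g}"] by auto
    then have "c \<inter> S = B" using B by auto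
    then show "\<exists>c\<in>K. c \<inter> S = B" using c(1) by blast
  qed
  then show "card S \<le> d" by (rule vc_leD[OF assms S(1)])
qed

text \<open>Tuples of a length other than \<open>N\<close> belong to every \<open>agreement N g c\<close>, which keeps the class
  closed and consistent without any case distinction.\<close>

definition agreement :: "nat \<Rightarrow> 'p set \<Rightarrow> 'p set \<Rightarrow> 'p list set" where
  "agreement N g c = {as. length as = N \<longrightarrow> (\<forall>a\<in>set as. a \<in> c \<longleftrightarrow> a \<in> g)}"

text \<open>A finite \<open>T\<close> carries only finitely many \<open>N\<close>-tuples, so
  compactness yields one \<open>c\<close> that fits \<open>X\<close> on the tuples from every
  \<open>T\<close>. Tuples of another length lie in every agreement set, hence also in
  \<open>X\<close>.\<close>

lemma closed_agreement:
  assumes "closed_class K"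
  shows "closed_class (agreement N g ` K)"
  unfolding closed_class_def
proof (intro allI impI)
  fix X assume X: "\<forall>S. finite S \<longrightarrow> (\<exists>z\<in>agreement N g ` K. z \<inter> S = X \<inter> S)"
  let ?tup = "\<lambda>T. {as. set as \<subseteq> T \<and> length as = N}"
  have "\<exists>c\<in>K. \<forall>T. finite T \<longrightarrow> agreement N g c \<inter> ?tup T = X \<inter> ?tup T"
  proof (rule compactness_directed[OF assms])
    fix T and c c' :: "'a set" assume "c \<inter> T = c' \<inter> T"
    then have "a \<in> c \<longleftrightarrow> a \<in> c'" if "a \<in> T" for a using that by blast
    then have "agreement N g c \<inter> ?tup T = agreement N g c' \<inter> ?tup T"
      unfolding agreement_def by (auto simp: subset_iff)
    then show "(agreement N g c \<inter> ?tup T = X \<inter> ?tup T) = (agreement N g c' \<inter> ?tup T = X \<inter> ?tup T)" by simp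
  next
    fix T T' and c :: "'a set"
    assume T: "T \<subseteq> T'" "agreement N g c \<inter> ?tup T' = X \<inter> ?tup T'"
    have eq: "?tup T' \<inter> ?tup T = ?tup T" using T(1) by auto
    have "(agreement N g c \<inter> ?tup T') \<inter> ?tup T = (X \<inter> ?tup T') \<inter> ?tup T" by (simp only: T(2))
    then show "agreement N g c \<inter> ?tup T = X \<inter> ?tup T" by (simp only: inf_assoc eq)
  next
    fix T :: "'a set" assume "finite T"
    then have "finite (?tup T)" by (rule finite_lists_length_eq)
    with X obtain z where z: "z \<in> agreement N g ` K" "z \<inter> ?tup T = X \<inter> ?tup T" by meson
    from z(1) obtain c where "z = agreement N g c" "c \<in> K" by (rule imageE)
    then show "\<exists>c\<in>K. agreement N g c \<inter> ?tup T = X \<inter> ?tup T" using z(2) by (intro bexI[of _ c]) simp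
  qed
  then obtain c where c: "c \<in> K" "\<And>T. finite T \<Longrightarrow> agreement N g c \<inter> ?tup T = X \<inter> ?tup T" by blast
  have "as \<in> agreement N g c \<longleftrightarrow> as \<in> X" for as
  proof (cases "length as = N")
    case True
    then have "as \<in> ?tup (set as)" by simp
    then show ?thesis using c(2)[of "set as"] by blast
  next
    case False
    have "finite {as}" by simp
    with X obtain z where z: "z \<in> agreement N g ` K" "z \<inter> {as} = X \<inter> {as}" by meson
    have "as \<in> z" using z(1) False unfolding agreement_def by auto
    then have "as \<in> X" using z(2) by blast
    then show ?thesis using False unfolding agreement_def by simp
  qed
  then have "X = agreement N g c" by blast
  then show "X \<in> agreement N g ` K" using c(1) by blast
qed

text \<open>For \<open>N = 1\<close> the relevant tuples are points and the class is
  \<open>K\<close> flipped by \<open>g\<close>, which does not raise the dimension. This accounts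
  for the separate value \<open>k_sd 1 d\<close>.\<close>

lemma vc_le_agreement_1:
  assumes "vc_le K d"
  shows "vc_le (agreement 1 g ` K) d"
  unfolding vc_le_def
proof (intro allI impI)
  fix S :: "'a list set" assume S: "finite S" "shatters (agreement 1 g ` K) S"
  have len: "\<exists>a. as = [a]" if "as \<in> S" for as
  proof (rule ccontr)
    assume "\<nexists>a. as = [a]"
    then have "length as \<noteq> 1" by (cases as) auto
    then have "as \<in> agreement 1 g c" for c unfolding agreement_def by simp
    moreover obtain c where "c \<in> K" "agreement 1 g c \<inter> S = {}" using shattersD[OF S(2), of "{}"] by auto
    ultimately show False using that by blast
  qed
  have "inj_on hd S" by (rule inj_onI) (metis len list.sel(1))
  then have c1: "card S = card (hd ` S)" by (simp add: card_image)
  have "shatters ((\<lambda>c. {a. a \<in> c \<longleftrightarrow> a \<in> g}) ` K) (hd ` S)"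
    unfolding shatters_def
  proof (intro allI impI)
    fix B assume B: "B \<subseteq> hd ` S"
    obtain c where c: "c \<in> K" "agreement 1 g c \<inter> S = {as \<in> S. hd as \<in> B}"
      using shattersD[OF S(2), of "{as \<in> S. hd as \<in> B}"] by auto
    have "(hd as \<in> c \<longleftrightarrow> hd as \<in> g) \<longleftrightarrow> hd as \<in> B" if "as \<in> S" for as
    proof -
      obtain a where a: "as = [a]" using len \<open>as \<in> S\<close> by blast
      have "as \<in> agreement 1 g c \<longleftrightarrow> hd as \<in> B" using c(2) \<open>as \<in> S\<close> by blast
      then show ?thesis unfolding a agreement_def by simp
    qed
    then have "{a. a \<in> c \<longleftrightarrow> a \<in> g} \<inter> hd ` S = B" using B by auto
    then show "\<exists>C\<in>(\<lambda>c. {a. a \<in> c \<longleftrightarrow> a \<in> g}) ` K. C \<inter> hd ` S = B" using c(1) by blast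
  qed
  then have "card (hd ` S) \<le> d" using S(1) by (intro vc_leD[OF vc_le_flip[OF assms, of g]]) simp_all
  then show "card S \<le> d" using c1 by simp
qed

text \<open>Duality is applied twice. With \<open>s = B_vc N (2 ^ (d + 1)) + 1\<close>, a shattered
  set of \<open>2 ^ s\<close> tuples gives \<open>s\<close> members of \<open>K\<close> all of whose
  subsets are cut out by tuples. The traces of single points on these members have VC-dimension at
  most \<open>2 ^ (d + 1)\<close>, so by Sauer--Shelah their \<open>N\<close>-fold intersections are
  too few.\<close>

lemma vc_le_agreement:
  fixes K :: "'p set set"
  assumes vc: "vc_le K d"
  shows "vc_le (agreement N g ` K) (2 ^ (B_vc N (2 ^ (d + 1)) + 1))"
  unfolding vc_le_def
proof (intro allI impI)
  let ?s = "B_vc N (2 ^ (d + 1)) + 1"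
  fix S :: "'p list set" assume S: "finite S" "shatters (agreement N g ` K) S"
  show "card S \<le> 2 ^ ?s"
  proof (rule ccontr)
    assume "\<not> ?thesis"
    then have cS: "2 ^ ?s \<le> card S" by simp
    have pat: "\<exists>c\<in>K. \<forall>as\<in>S. as \<in> agreement N g c \<longleftrightarrow> as \<in> B" if "B \<subseteq> S" for B
      using shattersD[OF S(2) that] by fastforce
    obtain C where C: "finite C" "C \<subseteq> K" "card C = ?s" "shatters ((\<lambda>as. {c. as \<in> agreement N g c}) ` S) C"
      by (rule dual_shatters[OF S(1) cS pat])
    define \<T> where "\<T> = (\<lambda>a. {c \<in> C. a \<in> c \<longleftrightarrow> a \<in> g}) ` UNIV"
    have \<T>C: "\<T> \<subseteq> Pow C" unfolding \<T>_def by auto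
    have fin\<T>: "finite \<T>" using \<T>C C(1) by (simp add: finite_subset)
    have "vc_le \<T> (2 ^ (d + 1))"
      unfolding vc_le_def
    proof (intro allI impI)
      fix J assume J: "finite J" "shatters \<T> J"
      show "card J \<le> 2 ^ (d + 1)"
      proof (rule ccontr)
        assume "\<not> ?thesis"
        then have cJ: "2 ^ (d + 1) \<le> card J" by simp
        have JC: "J \<subseteq> C" using shattersD[OF J(2), of J] \<T>C by auto
        have pat': "\<exists>a\<in>UNIV. \<forall>c\<in>J. (a \<in> c \<longleftrightarrow> a \<in> g) \<longleftrightarrow> c \<in> B" if B: "B \<subseteq> J" for B
        proof -
          obtain a where "{c \<in> C. a \<in> c \<longleftrightarrow> a \<in> g} \<inter> J = B"
            using shattersD[OF J(2) B] unfolding \<T>_def by auto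
          then show ?thesis using JC by (intro bexI[of _ a]) auto
        qed
        obtain S' where S': "finite S'" "S' \<subseteq> UNIV" "card S' = d + 1"
          "shatters ((\<lambda>c. {a. a \<in> c \<longleftrightarrow> a \<in> g}) ` J) S'"
          by (rule dual_shatters[OF J(1) cJ pat'])
        have "shatters ((\<lambda>c. {a. a \<in> c \<longleftrightarrow> a \<in> g}) ` K) S'"
          using S'(4) JC C(2) by (meson image_mono order_trans shatters_mono)
        then have "card S' \<le> d" by (rule vc_leD[OF vc_le_flip[OF vc] S'(1)])
        then show False using S'(3) by simp
      qed
    qed
    then have c\<T>: "card \<T> \<le> choose_le ?s (2 ^ (d + 1))"
      using sauer_shelah[OF C(1) \<T>C] C(3) by simp
    \<comment> \<open>A member of \<open>K\<close> agrees with \<open>g\<close> on a tuple iff it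
      does so at each of the \<open>N\<close> entries, so tuples cut out \<open>N\<close>-fold
      intersections of traces.\<close>
    have "Pow C \<subseteq> (\<lambda>ts. {c \<in> C. \<forall>t\<in>set ts. c \<in> t}) ` {ts. set ts \<subseteq> \<T> \<and> length ts = N}"
    proof
      fix B assume "B \<in> Pow C"
      then obtain as where as: "as \<in> S" "{c. as \<in> agreement N g c} \<inter> C = B"
        using shattersD[OF C(4)] by auto
      have len: "length as = N"
      proof (rule ccontr)
        assume "length as \<noteq> N"
        then have "as \<in> agreement N g c" for c unfolding agreement_def by simp
        moreover obtain c where "c \<in> K" "agreement N g c \<inter> S = {}" using shattersD[OF S(2), of "{}"] by auto
        ultimately show False using as(1) by blast
      qed
      let ?ts = "map (\<lambda>a. {c \<in> C. a \<in> c \<longleftrightarrow> a \<in> g}) as"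
      have "B = {c \<in> C. \<forall>t\<in>set ?ts. c \<in> t}" using as(2) len unfolding agreement_def by auto
      moreover have "?ts \<in> {ts. set ts \<subseteq> \<T> \<and> length ts = N}" using len unfolding \<T>_def by auto
      ultimately show "B \<in> (\<lambda>ts. {c \<in> C. \<forall>t\<in>set ts. c \<in> t}) ` {ts. set ts \<subseteq> \<T> \<and> length ts = N}"
        by (rule image_eqI)
    qed
    then have "card (Pow C) \<le> card {ts. set ts \<subseteq> \<T> \<and> length ts = N}"
      using finite_lists_length_eq[OF fin\<T>, of N] by (meson card_image_le card_mono finite_imageI le_trans)
    also have "\<dots> = card \<T> ^ N" using fin\<T> by (rule card_lists_length_eq)
    also have "\<dots> \<le> choose_le ?s (2 ^ (d + 1)) ^ N" using c\<T> by (intro power_mono) auto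
    finally have "2 ^ ?s \<le> choose_le ?s (2 ^ (d + 1)) ^ N" using C(1,3) by (simp add: card_Pow)
    then have "?s \<le> B_vc N (2 ^ (d + 1))" by (rule le_B_vc)
    then show False by simp
  qed
qed

section \<open>Majorities of compressible points\<close>

text \<open>As \<open>N\<close> is positive, the constant tuples \<open>replicate N a\<close>
  translate agreement sets back into points. In the other direction each of the \<open>m\<close>
  isolating tuples is replaced by its at most \<open>N\<close> entries.\<close>

lemma compressible_of_agreement:
  assumes c: "compressible m (agreement N g ` K) {agreement N g p}" and p: "p \<in> K" and N: "0 < N"
  shows "compressible (N * m) K {p}"
  unfolding compressible_def
proof (intro conjI allI impI)
  show "{p} \<subseteq> K" "{p} \<noteq> {}" using p by simp_all
  show "closed_class {p}" unfolding closed_class_def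
  proof (intro allI impI)
    fix c assume *: "\<forall>S. finite S \<longrightarrow> (\<exists>z\<in>{p}. z \<inter> S = c \<inter> S)"
    have "x \<in> p \<longleftrightarrow> x \<in> c" for x using *[rule_format, of "{x}"] by auto
    then show "c \<in> {p}" by blast
  qed
  fix S :: "'a set" assume "finite S"
  then have "finite (replicate N ` S)" by simp
  with c obtain Y where Y: "finite Y" "card Y \<le> m"
    "isolates (agreement N g ` K) {agreement N g p} Y (replicate N ` S)" by (rule compressibleD)
  let ?Y = "\<Union>as\<in>{as \<in> Y. length as = N}. set as"
  have "card ?Y \<le> (\<Sum>as\<in>{as \<in> Y. length as = N}. card (set as))"
    using Y(1) by (intro card_UN_le) simp
  also have "\<dots> \<le> (\<Sum>as\<in>{as \<in> Y. length as = N}. N)"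
    by (intro sum_mono) (use card_length in auto)
  also have "\<dots> = card {as \<in> Y. length as = N} * N" by simp
  also have "\<dots> \<le> m * N"
    using Y(2) card_mono[OF Y(1), of "{as \<in> Y. length as = N}"] by (intro mult_le_mono1) auto
  finally have card: "card ?Y \<le> N * m" by (simp add: mult.commute)
  have "isolates K {p} ?Y S"
  proof (rule isolatesI)
    fix z c assume z: "z \<in> {p}" and c: "c \<in> K" "c \<inter> ?Y = z \<inter> ?Y"
    have eq: "a \<in> c \<longleftrightarrow> a \<in> p" if "as \<in> Y" "length as = N" "a \<in> set as" for as a
    proof -
      have "a \<in> ?Y" using that by blast
      then show ?thesis using c(2) z by blast
    qed
    have "as \<in> agreement N g c \<longleftrightarrow> as \<in> agreement N g p" if "as \<in> Y" for as
      using eq[OF that] unfolding agreement_def by auto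
    then have 1: "agreement N g c \<inter> Y = agreement N g p \<inter> Y" by blast
    have 2: "agreement N g c \<in> agreement N g ` K" using c(1) by (rule imageI)
    have 3: "agreement N g p \<inter> replicate N ` S = agreement N g c \<inter> replicate N ` S"
      using isolatesD[OF Y(3) singletonI 2 1] by simp
    have "a \<in> p \<longleftrightarrow> a \<in> c" if "a \<in> S" for a
    proof -
      have "replicate N a \<in> agreement N g p \<longleftrightarrow> replicate N a \<in> agreement N g c" using 3 that by blast
      then show ?thesis using N unfolding agreement_def by auto
    qed
    then show "\<exists>z'\<in>{p}. z' \<inter> S = c \<inter> S" by auto
  qed simp
  then show "\<exists>Y. finite Y \<and> card Y \<le> N * m \<and> isolates K {p} Y S"
    using card Y(1) by (intro exI[of _ ?Y]) simp
qed

text \<open>Any \<open>D + 1\<close> tuples have at most \<open>N * (D + 1) \<le> k\<close> entries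
  in all, on which some member of \<open>K\<close> agrees with \<open>g\<close>. So the agreement
  class satisfies the covering assumption of \<open>compressible_in_ultrafilter\<close>.\<close>

lemma compressible_agreeing:
  assumes closed: "closed_class K" and vc: "vc_le K d"
    and k: "k = k_sd N d" and N: "0 < N"
    and hype: "\<And>Y. finite Y \<Longrightarrow> card Y \<le> k \<Longrightarrow> \<exists>c\<in>K. c \<inter> Y = g \<inter> Y"
    and U: "is_ultrafilter U"
  shows "\<exists>p\<in>K. compressible k K {p} \<and> agreement N g p \<in> U"
proof -
  obtain D where D: "vc_le (agreement N g ` K) D" and kD: "k = N * k_sd1 D"
  proof (cases "N = 1")
    case True
    have "vc_le (agreement N g ` K) d" unfolding True using vc by (rule vc_le_agreement_1)
    moreover have "k = N * k_sd1 d" using k True by (simp add: k_sd_def)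
    ultimately show ?thesis by (rule that)
  next
    case False
    show ?thesis by (rule that[OF vc_le_agreement[OF vc]]) (use False in \<open>simp add: k k_sd_def\<close>)
  qed
  have "\<exists>P\<in>agreement N g ` K. compressible (k_comp D + 2 * D + 1) (agreement N g ` K) {P} \<and> P \<in> U"
  proof (rule compressible_in_ultrafilter[OF U closed_agreement[OF closed] D])
    fix Y :: "'a list set" assume Y: "finite Y" "card Y \<le> Suc D"
    let ?Y = "\<Union>as\<in>{as \<in> Y. length as = N}. set as"
    have "card ?Y \<le> (\<Sum>as\<in>{as \<in> Y. length as = N}. card (set as))"
      using Y(1) by (intro card_UN_le) simp
    also have "\<dots> \<le> (\<Sum>as\<in>{as \<in> Y. length as = N}. N)"
      by (intro sum_mono) (use card_length in auto)
    also have "\<dots> = card {as \<in> Y. length as = N} * N" by simp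
    also have "\<dots> \<le> k_sd1 D * N"
      using Y(2) card_mono[OF Y(1), of "{as \<in> Y. length as = N}"]
      by (intro mult_le_mono1) (auto simp: k_sd1_def)
    finally have "card ?Y \<le> k" by (simp add: kD mult.commute)
    then obtain c where c: "c \<in> K" "c \<inter> ?Y = g \<inter> ?Y" using hype[of ?Y] Y(1) by auto
    have "as \<in> agreement N g c" if "as \<in> Y" for as
      unfolding agreement_def
    proof (rule CollectI, intro impI ballI)
      fix a assume "length as = N" "a \<in> set as"
      then have "a \<in> ?Y" using that by blast
      then show "a \<in> c \<longleftrightarrow> a \<in> g" using c(2) by blast
    qed
    then show "\<exists>P\<in>agreement N g ` K. Y \<subseteq> P" using c(1) by blast
  qed
  then obtain p where p: "p \<in> K" "agreement N g p \<in> U"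
    "compressible (k_comp D + 2 * D + 1) (agreement N g ` K) {agreement N g p}" by auto
  have "compressible (N * (k_comp D + 2 * D + 1)) K {p}"
    using p(3,1) N by (rule compressible_of_agreement)
  then have "compressible k K {p}" by (rule compressible_mono) (simp add: kD k_sd1_def)
  then show ?thesis using p by blast
qed

section \<open>The \<open>(p, q)\<close>-theorem and the majority argument\<close>

lemma vc_le_imp_vc_dim_less:
  assumes "vc_le F d" "d < q"
  shows "vc_dim F < enat q"
proof -
  have "vc_dim F \<le> enat d" unfolding vc_dim_def
    by (rule Sup_least) (use assms(1) in \<open>auto dest: vc_leD\<close>)
  also have "\<dots> < enat q" using assms(2) by simp
  finally show ?thesis .
qed

text \<open>The bound is tested on the single set \<open>{0}\<close>: as \<open>1 < p\<close>, no
  subfamily has \<open>p\<close> members, and a set that meets \<open>{0}\<close> is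
  nonempty.\<close>

lemma pq_function_pos:
  assumes "pq_function N" "q \<le> p" "1 < p" "0 < q"
  shows "0 < N p q"
proof -
  let ?F = "{{0::nat}}"
  have vc: "vc_le ((\<lambda>x. {s \<in> ?F. x \<in> s}) ` {0::nat}) 0"
    unfolding vc_le_def
  proof (intro allI impI)
    fix S :: "nat set set" assume S: "finite S" "shatters ((\<lambda>x. {s \<in> ?F. x \<in> s}) ` {0::nat}) S"
    have "{s \<in> ?F. 0 \<in> s} \<inter> S = B" if "B \<subseteq> S" for B using shattersD[OF S(2) that] by simp
    from this[of "{}"] this[of S] have "S = {}" by auto
    then show "card S \<le> 0" by simp
  qed
  have "\<exists>X0\<subseteq>{0::nat}. card X0 \<le> N p q \<and> (\<forall>s\<in>?F. X0 \<inter> s \<noteq> {})"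
  proof (rule assms(1)[unfolded pq_function_def, rule_format], intro conjI allI impI)
    show "q \<le> p" by fact
    show "vc_dim ((\<lambda>x. {s \<in> ?F. x \<in> s}) ` {0::nat}) < enat q"
      using vc assms(4) by (rule vc_le_imp_vc_dim_less)
    fix S :: "nat set set" assume S: "S \<subseteq> ?F" "p \<le> card S"
    have "card S \<le> card ?F" using S(1) by (intro card_mono) auto
    then show "\<exists>S0\<subseteq>S. q \<le> card S0 \<and> \<Inter>S0 \<noteq> {}" using S(2) assms(3) by simp
  qed auto
  then obtain X0 where X0: "X0 \<subseteq> {0::nat}" "card X0 \<le> N p q" "X0 \<inter> {0} \<noteq> {}" by auto
  then have "X0 = {0}" by blast
  then show ?thesis using X0(2) by simp
qed

text \<open>Adapts the theorem to a family indexed by \<open>H\<close>. Points are coded as natural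
  numbers, and by duality VC-dimension at most \<open>d\<close> gives dual dimension below
  \<open>2 ^ Suc d\<close>. The assumption concerns lists, possibly with repetitions; it is applied
  to a list of \<open>p\<close> indices of distinct sets.\<close>

lemma pq_transversal:
  fixes s :: "'h \<Rightarrow> 'a set"
  assumes pq: "pq_function N" and qp: "2 ^ Suc d \<le> p"
    and fin: "finite H" "finite X" and sub: "\<And>h. h \<in> H \<Longrightarrow> s h \<subseteq> X \<and> s h \<noteq> {}"
    and vc: "vc_le (s ` H) d"
    and pq_property: "\<And>hs. length hs = p \<Longrightarrow> set hs \<subseteq> H \<Longrightarrow> \<exists>a\<in>X. 2 ^ Suc d \<le> card {i. i < p \<and> a \<in> s (hs ! i)}"
  shows "\<exists>X0\<subseteq>X. card X0 \<le> N p (2 ^ Suc d) \<and> (\<forall>h\<in>H. X0 \<inter> s h \<noteq> {})"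
proof -
  obtain e :: "'a \<Rightarrow> nat" where e: "inj_on e X"
    using finite_imp_inj_to_nat_seg[OF fin(2)] by blast
  let ?F = "(\<lambda>h. e ` s h) ` H"
  have vcd: "vc_le ((\<lambda>x. {t \<in> ?F. x \<in> t}) ` e ` X) (2 ^ Suc d - 1)"
    unfolding vc_le_def
  proof (intro allI impI)
    fix J assume J: "finite J" "shatters ((\<lambda>x. {t \<in> ?F. x \<in> t}) ` e ` X) J"
    show "card J \<le> 2 ^ Suc d - 1"
    proof (rule ccontr)
      assume "\<not> ?thesis"
      then have cJ: "2 ^ Suc d \<le> card J" by simp
      have JF: "J \<subseteq> ?F" using shattersD[OF J(2), of J] by auto
      have pat: "\<exists>x\<in>e ` X. \<forall>t\<in>J. x \<in> t \<longleftrightarrow> t \<in> B" if B: "B \<subseteq> J" for B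
      proof -
        obtain x where x: "x \<in> e ` X" "{t \<in> ?F. x \<in> t} \<inter> J = B" using shattersD[OF J(2) B] by auto
        then have "\<forall>t\<in>J. x \<in> t \<longleftrightarrow> t \<in> B" using JF by blast
        then show ?thesis using x(1) by blast
      qed
      obtain S where S: "finite S" "S \<subseteq> e ` X" "card S = Suc d" "shatters ((\<lambda>t. {x. x \<in> t}) ` J) S"
        by (rule dual_shatters[OF J(1) cJ pat])
      obtain S' where S': "S' \<subseteq> X" "S = e ` S'" using S(2) by (meson subset_imageE)
      have inj: "inj_on e S'" using e S'(1) by (rule inj_on_subset)
      have "shatters (s ` H) S'"
        unfolding shatters_def
      proof (intro allI impI)
        fix B assume B: "B \<subseteq> S'"
        then obtain t where t: "t \<in> J" "t \<inter> S = e ` B" using shattersD[OF S(4), of "e ` B"] S'(2) by auto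
        then obtain h where h: "h \<in> H" "t = e ` s h" using JF by auto
        have "a \<in> s h \<longleftrightarrow> a \<in> B" if a: "a \<in> S'" for a
        proof -
          have "a \<in> s h \<longleftrightarrow> e a \<in> t"
            unfolding h(2) using sub[OF h(1)] a S'(1) by (intro inj_on_image_mem_iff[OF e, symmetric]) auto
          also have "\<dots> \<longleftrightarrow> e a \<in> e ` B" using t(2) a S'(2) by blast
          also have "\<dots> \<longleftrightarrow> a \<in> B" using B a by (intro inj_on_image_mem_iff[OF inj]) auto
          finally show ?thesis .
        qed
        then have "s h \<inter> S' = B" using B by blast
        then show "\<exists>C\<in>s ` H. C \<inter> S' = B" using h(1) by blast
      qed
      moreover have "finite S'" using S'(1) fin(2) by (rule finite_subset)
      moreover have "card S' = Suc d" using S(3) S'(2) inj by (simp add: card_image)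
      ultimately show False using vc_leD[OF vc, of S'] by simp
    qed
  qed
  have "\<exists>X0\<subseteq>e ` X. card X0 \<le> N p (2 ^ Suc d) \<and> (\<forall>t\<in>?F. X0 \<inter> t \<noteq> {})"
  proof (rule pq[unfolded pq_function_def, rule_format], intro conjI allI impI)
    show "2 ^ Suc d \<le> p" by fact
    show "finite (e ` X)" using fin(2) by simp
    show "?F \<subseteq> Pow (e ` X)" using sub by blast
    show "{} \<notin> ?F" using sub by auto
    show "vc_dim ((\<lambda>x. {t \<in> ?F. x \<in> t}) ` e ` X) < enat (2 ^ Suc d)"
      using vcd by (rule vc_le_imp_vc_dim_less) simp
    fix S assume S: "S \<subseteq> ?F" "p \<le> card S"
    obtain S1 where S1: "S1 \<subseteq> S" "card S1 = p" using obtain_subset_with_card_n[OF S(2)] by metis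
    have "finite S1" using S1(1) S(1) fin(1) by (meson finite_imageI finite_subset)
    then obtain ts where ts: "set ts = S1" "distinct ts" using finite_distinct_list by blast
    then have len: "length ts = p" using S1(2) distinct_card by fastforce
    have "set ts \<subseteq> ?F" using ts(1) S1(1) S(1) by simp
    then have "\<forall>t\<in>set ts. \<exists>h\<in>H. t = e ` s h" by (meson imageE subsetD)
    then obtain f where f: "\<And>t. t \<in> set ts \<Longrightarrow> f t \<in> H \<and> t = e ` s (f t)" by metis
    obtain a where a: "a \<in> X" "2 ^ Suc d \<le> card {i. i < p \<and> a \<in> s (map f ts ! i)}"
      using pq_property[of "map f ts"] len f by auto
    let ?I = "{i. i < p \<and> a \<in> s (map f ts ! i)}"
    \<comment> \<open>As \<open>ts\<close> has no repetitions, counting indices is counting distinct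
      sets.\<close>
    have "card ((!) ts ` ?I) = card ?I"
      using ts(2) len by (intro card_image inj_on_subset[OF inj_on_nth[of ts "{..<p}"]]) auto
    moreover have "(!) ts ` ?I \<subseteq> S" using ts(1) len S1(1) by auto
    moreover have "e a \<in> t" if t: "t \<in> (!) ts ` ?I" for t
    proof -
      obtain i where i: "i < p" "a \<in> s (f (ts ! i))" "t = ts ! i" using t len by auto
      then show ?thesis using f[of t] len by auto
    qed
    then have "\<Inter>((!) ts ` ?I) \<noteq> {}" by blast
    ultimately show "\<exists>S0\<subseteq>S. 2 ^ Suc d \<le> card S0 \<and> \<Inter>S0 \<noteq> {}" using a(2) by metis
  qed
  then obtain X1 where X1: "X1 \<subseteq> e ` X" "card X1 \<le> N p (2 ^ Suc d)" "\<forall>t\<in>?F. X1 \<inter> t \<noteq> {}" by blast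
  obtain X0 where X0: "X0 \<subseteq> X" "X1 = e ` X0" using X1(1) by (meson subset_imageE)
  have "card X0 = card X1" unfolding X0(2) using e X0(1) by (metis card_image inj_on_subset)
  moreover have "X0 \<inter> s h \<noteq> {}" if h: "h \<in> H" for h
  proof -
    have "e ` s h \<in> ?F" using h by (rule imageI)
    with X1(3) have "X1 \<inter> e ` s h \<noteq> {}" by (rule bspec)
    then obtain y where y: "y \<in> X1" "y \<in> e ` s h" by (meson disjoint_iff)
    from y(2) obtain a where a: "y = e a" "a \<in> s h" by (rule imageE)
    have "a \<in> X" using sub[OF h] a(2) by (meson subsetD)
    then have "a \<in> X0" using y(1) inj_on_image_mem_iff[OF e _ X0(1)] unfolding X0(2) a(1) by simp
    then show ?thesis using a(2) by (meson disjoint_iff)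
  qed
  ultimately show ?thesis using X0(1) X1(2) by metis
qed

lemma majority_of_compressibles:
  fixes K :: "'p set set"
  assumes closed: "closed_class K" and vc: "vc_le K d" and pq: "pq_function Npq"
    and n: "n = 2 ^ (d + 2) - 1" and k: "k = k_sd (Npq n (2 ^ (d + 1))) d"
    and hype: "\<And>Y. finite Y \<Longrightarrow> card Y \<le> k \<Longrightarrow> \<exists>c\<in>K. c \<inter> Y = g \<inter> Y"
  shows "\<exists>h. (\<forall>i<n. h i \<in> K \<and> compressible k K {h i}) \<and>
    (\<forall>a. n < 2 * card {i. i < n \<and> (a \<in> h i \<longleftrightarrow> a \<in> g)})"
proof (rule ccontr)
  assume neg: "\<not> ?thesis"
  let ?N = "Npq n (2 ^ Suc d)"
  \<comment> \<open>The number \<open>n\<close> is odd: if the points right at \<open>a\<close> are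
    no majority, then at least \<open>(n + 1) / 2 = 2 ^ Suc d\<close> of them are wrong
    there.\<close>
  have n2: "n + 1 = 2 * 2 ^ Suc d" unfolding n by (simp add: power_add)
  have "(2 :: nat) \<le> 2 ^ Suc d" using one_le_power[of "2 :: nat" d] by simp
  then have big: "1 < n" using n2 by linarith
  have qn: "2 ^ Suc d \<le> n" using n2 big by linarith
  have N: "0 < ?N" using pq_function_pos[OF pq qn big] by simp
  define H where "H = {p \<in> K. compressible k K {p}}"
  define W where "W h = {a. a \<in> h \<longleftrightarrow> a \<notin> g}" for h
  have wrong: "\<exists>a. 2 ^ Suc d \<le> card {i. i < n \<and> a \<in> W (hs ! i)}"
    if hs: "length hs = n" "set hs \<subseteq> H" for hs
  proof -
    have "\<forall>i<n. hs ! i \<in> K \<and> compressible k K {hs ! i}" using hs unfolding H_def by force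
    then obtain a where a: "\<not> n < 2 * card {i. i < n \<and> (a \<in> hs ! i \<longleftrightarrow> a \<in> g)}" using neg by blast
    have "{..<n} = {i. i < n \<and> (a \<in> hs ! i \<longleftrightarrow> a \<in> g)} \<union> {i. i < n \<and> a \<in> W (hs ! i)}"
      unfolding W_def by auto
    then have "n \<le> card {i. i < n \<and> (a \<in> hs ! i \<longleftrightarrow> a \<in> g)} + card {i. i < n \<and> a \<in> W (hs ! i)}"
      by (metis card_Un_le card_lessThan)
    then show ?thesis using a n2 by (intro exI[of _ a]) linarith
  qed
  have "fin_inter ((\<lambda>h. - agreement ?N g h) ` H)"
    unfolding fin_inter_def
  proof (intro allI impI)
    fix T assume "finite T" "T \<subseteq> (\<lambda>h. - agreement ?N g h) ` H"
    then obtain H0 where H0: "H0 \<subseteq> H" "finite H0" "T = (\<lambda>h. - agreement ?N g h) ` H0"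
      by (meson finite_subset_image)
    show "\<Inter>T \<noteq> {}"
    proof (cases "H0 = {}")
      case True
      then show ?thesis using H0(3) by simp
    next
      case False
      then obtain h0 where h0: "h0 \<in> H0" by blast
      define L where "L = {hs. set hs \<subseteq> H0 \<and> length hs = n}"
      have finL: "finite L" unfolding L_def using H0(2) by (rule finite_lists_length_eq)
      have "\<forall>hs\<in>L. \<exists>a. 2 ^ Suc d \<le> card {i. i < n \<and> a \<in> W (hs ! i)}"
        using wrong H0(1) unfolding L_def by auto
      from bchoice[OF this] obtain f where
        f: "\<forall>hs\<in>L. 2 ^ Suc d \<le> card {i. i < n \<and> f hs \<in> W (hs ! i)}" ..
      \<comment> \<open>One witness for each list from \<open>H0\<close>. Restricting the error sets
        to these finitely many points makes the set system finite, as the theorem requires.\<close>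
      let ?X = "f ` L"
      let ?s = "\<lambda>h. W h \<inter> ?X"
      have "\<exists>X0\<subseteq>?X. card X0 \<le> ?N \<and> (\<forall>h\<in>H0. X0 \<inter> ?s h \<noteq> {})"
      proof (rule pq_transversal[OF pq qn H0(2)])
        show "finite ?X" using finL by simp
        show "?s h \<subseteq> ?X \<and> ?s h \<noteq> {}" if h: "h \<in> H0" for h
        proof -
          \<comment> \<open>The list that repeats \<open>h\<close> has its witness in
            \<open>W h\<close>, so the restricted error set of \<open>h\<close> is nonempty.\<close>
          have rL: "replicate n h \<in> L" unfolding L_def using h by auto
          then have "2 ^ Suc d \<le> card {i. i < n \<and> f (replicate n h) \<in> W (replicate n h ! i)}"
            using f by blast
          then have "{i. i < n \<and> f (replicate n h) \<in> W (replicate n h ! i)} \<noteq> {}"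
            by (metis card.empty not_less zero_less_numeral zero_less_power)
          then have "f (replicate n h) \<in> W h" by auto
          then show ?thesis using rL by auto
        qed
        show "vc_le (?s ` H0) d"
          unfolding vc_le_def
        proof (intro allI impI)
          fix S assume S: "finite S" "shatters (?s ` H0) S"
          \<comment> \<open>Error sets are the agreement sets for the complement of
            \<open>g\<close>, so flipping bounds their VC-dimension.\<close>
          have "shatters ((\<lambda>c. {a. a \<in> c \<longleftrightarrow> a \<in> - g}) ` K) S"
            unfolding shatters_def
          proof (intro allI impI)
            fix B assume "B \<subseteq> S"
            then obtain h where h: "h \<in> H0" "?s h \<inter> S = B" using shattersD[OF S(2)] by blast
            have "S \<subseteq> ?X" using shattersD[OF S(2), of S] by auto
            then have "{a. a \<in> h \<longleftrightarrow> a \<in> - g} \<inter> S = B" using h(2) unfolding W_def by auto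
            moreover have "h \<in> K" using h(1) H0(1) unfolding H_def by blast
            ultimately show "\<exists>C\<in>(\<lambda>c. {a. a \<in> c \<longleftrightarrow> a \<in> - g}) ` K. C \<inter> S = B" by blast
          qed
          then show "card S \<le> d" by (rule vc_leD[OF vc_le_flip[OF vc] S(1)])
        qed
        show "\<exists>a\<in>?X. 2 ^ Suc d \<le> card {i. i < n \<and> a \<in> ?s (hs ! i)}"
          if hs: "length hs = n" "set hs \<subseteq> H0" for hs
        proof -
          have hL: "hs \<in> L" unfolding L_def using hs by simp
          then have "2 ^ Suc d \<le> card {i. i < n \<and> f hs \<in> W (hs ! i)}" using f by blast
          also have "{i. i < n \<and> f hs \<in> W (hs ! i)} = {i. i < n \<and> f hs \<in> ?s (hs ! i)}"
            using hL by auto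
          finally show ?thesis using imageI[OF hL] by (rule bexI)
        qed
      qed
      then obtain X0 where X0: "X0 \<subseteq> ?X" "card X0 \<le> ?N" "\<forall>h\<in>H0. X0 \<inter> ?s h \<noteq> {}" by blast
      have "finite X0" using X0(1) finL by (meson finite_imageI finite_subset)
      then obtain xs where xs: "set xs = X0" "distinct xs" using finite_distinct_list by blast
      have lxs: "length xs \<le> ?N" using X0(2) xs distinct_card by fastforce
      have ne: "xs \<noteq> []" using X0(3) h0 xs(1) by auto
      \<comment> \<open>Repeating an entry gives length exactly \<open>?N\<close> without changing
        the set of entries; there is a first entry because \<open>X0\<close> meets the error set of
        \<open>h0\<close>.\<close>
      define as where "as = xs @ replicate (?N - length xs) (hd xs)"
      have las: "length as = ?N" and sas: "set as = X0" using lxs ne xs(1) unfolding as_def by auto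
      have "as \<notin> agreement ?N g h" if h: "h \<in> H0" for h
      proof -
        obtain a where "a \<in> X0" "a \<in> W h" using bspec[OF X0(3) h] by (meson disjoint_iff IntD1)
        then show ?thesis using las sas unfolding agreement_def W_def by auto
      qed
      then have "as \<in> \<Inter>T" unfolding H0(3) by simp
      then show ?thesis by blast
    qed
  qed
  then obtain U where U: "is_ultrafilter U" "(\<lambda>h. - agreement ?N g h) ` H \<subseteq> U"
    using ultrafilter_exists by blast
  have k': "k = k_sd ?N d" using k by simp
  obtain p where p: "p \<in> K" "compressible k K {p}" "agreement ?N g p \<in> U"
    using compressible_agreeing[OF closed vc k' N hype U(1)] by blast
  then have "- agreement ?N g p \<in> U" using U(2) unfolding H_def by blast
  then show False using p(3) ultrafilter_Compl[OF U(1)] by blast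
qed

section \<open>Semantics of the formula\<close>

lemma val_cong: "(\<And>v. v \<in> vars_tm t \<Longrightarrow> e v = e' v) \<Longrightarrow> val M e t = val M e' t"
proof (induction t)
  case (Fn f ts)
  have "map (val M e) ts = map (val M e') ts"
  proof (rule map_cong[OF refl])
    fix t assume t: "t \<in> set ts"
    show "val M e t = val M e' t" by (rule Fn.IH[OF t]) (use Fn.prems t in auto)
  qed
  then show ?case by (simp only: val.simps)
qed simp

lemma map_val_cong:
  "(\<And>v. v \<in> (\<Union>t \<in> set ts. vars_tm t) \<Longrightarrow> e v = e' v) \<Longrightarrow> map (val M e) ts = map (val M e') ts"
  by (rule map_cong[OF refl], rule val_cong) blast

lemma sat_cong: "(\<And>v. v \<in> fv A \<Longrightarrow> e v = e' v) \<Longrightarrow> sat M e A = sat M e' A"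
proof (induction A arbitrary: e e')
  case (Eq t u)
  then show ?case using val_cong[of t e e' M] val_cong[of u e e' M] by simp
next
  case (Rel r ts)
  have "map (val M e) ts = map (val M e') ts" by (rule map_val_cong) (use Rel.prems in simp)
  then show ?case by (simp only: sat.simps)
next
  case (Forall v A)
  have "sat M (e(v := u)) A = sat M (e'(v := u)) A" for u
    by (rule Forall.IH) (use Forall.prems in auto)
  then show ?case by simp
next
  case (Exists v A)
  have "sat M (e(v := u)) A = sat M (e'(v := u)) A" for u
    by (rule Exists.IH) (use Exists.prems in auto)
  then show ?case by simp
next
  case (Conj A B)
  have "sat M e A = sat M e' A" "sat M e B = sat M e' B"
    by (rule Conj.IH, use Conj.prems in simp)+
  then show ?case by simp
next
  case (Disj A B)
  have "sat M e A = sat M e' A" "sat M e B = sat M e' B"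
    by (rule Disj.IH, use Disj.prems in simp)+
  then show ?case by simp
next
  case (Imp A B)
  have "sat M e A = sat M e' A" "sat M e B = sat M e' B"
    by (rule Imp.IH, use Imp.prems in simp)+
  then show ?case by simp
next
  case (Iff A B)
  have "sat M e A = sat M e' A" "sat M e B = sat M e' B"
    by (rule Iff.IH, use Iff.prems in simp)+
  then show ?case by simp
next
  case (Neg A)
  have "sat M e A = sat M e' A" by (rule Neg.IH) (use Neg.prems in simp)
  then show ?case by simp
qed simp

section \<open>Renaming of variables\<close>

lemma val_rename_tm: "val M e (rename_tm s t) = val M (\<lambda>v. e (s v)) t"
  by (induction t) (auto intro!: arg_cong[where f = "FnI M _"])

text \<open>The hypothesis excludes capture: a free variable is either kept or sent to one that
  occurs nowhere in \<open>A\<close>, in particular not as a bound variable.\<close>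

lemma sat_rename:
  "(\<And>v. v \<in> fv A \<Longrightarrow> s v = v \<or> s v \<notin> vars_fm A) \<Longrightarrow> sat M e (rename s A) = sat M (\<lambda>v. e (s v)) A"
proof (induction A arbitrary: s e)
  case (Rel r ts)
  then show ?case by (auto simp: val_rename_tm comp_def)
next
  case (Forall v A)
  have "sat M (e(v := u)) (rename (s(v := v)) A) = sat M ((\<lambda>w. e (s w))(v := u)) A" for u
  proof -
    have "sat M (e(v := u)) (rename (s(v := v)) A) = sat M (\<lambda>w. (e(v := u)) ((s(v := v)) w)) A"
      by (rule Forall.IH) (use Forall.prems in \<open>auto split: if_splits\<close>)
    also have "\<dots> = sat M ((\<lambda>w. e (s w))(v := u)) A"
    proof (rule sat_cong)
      \<comment> \<open>For \<open>w \<noteq> v\<close> the variable \<open>s w\<close> is not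
        \<open>v\<close>, because \<open>v\<close> occurs in \<open>Forall v A\<close>.\<close>
      fix w assume "w \<in> fv A"
      then show "(e(v := u)) ((s(v := v)) w) = ((\<lambda>w. e (s w))(v := u)) w"
        using Forall.prems[of w] by auto
    qed
    finally show ?thesis .
  qed
  then show ?case by simp
next
  case (Exists v A)
  have "sat M (e(v := u)) (rename (s(v := v)) A) = sat M ((\<lambda>w. e (s w))(v := u)) A" for u
  proof -
    have "sat M (e(v := u)) (rename (s(v := v)) A) = sat M (\<lambda>w. (e(v := u)) ((s(v := v)) w)) A"
      by (rule Exists.IH) (use Exists.prems in \<open>auto split: if_splits\<close>)
    also have "\<dots> = sat M ((\<lambda>w. e (s w))(v := u)) A"
    proof (rule sat_cong)
      fix w assume "w \<in> fv A"
      then show "(e(v := u)) ((s(v := v)) w) = ((\<lambda>w. e (s w))(v := u)) w"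
        using Exists.prems[of w] by auto
    qed
    finally show ?thesis .
  qed
  then show ?case by simp
next
  case (Eq t u)
  then show ?case by (simp add: val_rename_tm)
next
  case (Neg A)
  have "sat M e (rename s A) = sat M (\<lambda>v. e (s v)) A" by (rule Neg.IH) (use Neg.prems in auto)
  then show ?case by simp
next
  case (Conj A B)
  have "sat M e (rename s A) = sat M (\<lambda>v. e (s v)) A" by (rule Conj.IH(1)) (use Conj.prems in auto)
  moreover have "sat M e (rename s B) = sat M (\<lambda>v. e (s v)) B" by (rule Conj.IH(2)) (use Conj.prems in auto)
  ultimately show ?case by simp
next
  case (Disj A B)
  have "sat M e (rename s A) = sat M (\<lambda>v. e (s v)) A" by (rule Disj.IH(1)) (use Disj.prems in auto)
  moreover have "sat M e (rename s B) = sat M (\<lambda>v. e (s v)) B" by (rule Disj.IH(2)) (use Disj.prems in auto)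
  ultimately show ?case by simp
next
  case (Imp A B)
  have "sat M e (rename s A) = sat M (\<lambda>v. e (s v)) A" by (rule Imp.IH(1)) (use Imp.prems in auto)
  moreover have "sat M e (rename s B) = sat M (\<lambda>v. e (s v)) B" by (rule Imp.IH(2)) (use Imp.prems in auto)
  ultimately show ?case by simp
next
  case (Iff A B)
  have "sat M e (rename s A) = sat M (\<lambda>v. e (s v)) A" by (rule Iff.IH(1)) (use Iff.prems in auto)
  moreover have "sat M e (rename s B) = sat M (\<lambda>v. e (s v)) B" by (rule Iff.IH(2)) (use Iff.prems in auto)
  ultimately show ?case by simp
qed simp

lemma wf_rename_tm: "wf_tm L t \<Longrightarrow> wf_tm L (rename_tm s t)"
  by (induction t) auto

lemma wf_rename: "wf_fm L A \<Longrightarrow> wf_fm L (rename s A)"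
  by (induction A arbitrary: s) (auto simp: wf_rename_tm)

lemma vars_rename_tm: "vars_tm (rename_tm s t) = s ` vars_tm t"
  by (induction t) auto

lemma fv_rename: "fv (rename s A) \<subseteq> s ` fv A"
proof (induction A arbitrary: s)
  case (Forall v A)
  then show ?case using Forall.IH[of "s(v := v)"] by (fastforce split: if_splits)
next
  case (Exists v A)
  then show ?case using Exists.IH[of "s(v := v)"] by (fastforce split: if_splits)
qed (auto simp: vars_rename_tm, blast+)

lemma finite_vars_tm: "finite (vars_tm t)"
  by (induction t) auto

lemma finite_vars_fm: "finite (vars_fm A)"
  by (induction A) (auto simp: finite_vars_tm)

section \<open>Conjunctions, quantifier blocks and majorities\<close>

lemma sat_Conjs: "sat M e (Conjs As) \<longleftrightarrow> (\<forall>A\<in>set As. sat M e A)"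
  unfolding Conjs_def by (induction As) auto

lemma sat_Conjs_upt: "sat M e (Conjs (map P [0..<k])) \<longleftrightarrow> (\<forall>j<k. sat M e (P j))"
  by (auto simp: sat_Conjs)

lemma sat_Disjs: "sat M e (Disjs As) \<longleftrightarrow> (\<exists>A\<in>set As. sat M e A)"
  unfolding Disjs_def by (induction As) auto

lemma wf_Conjs: "wf_fm L (Conjs As) \<longleftrightarrow> (\<forall>A\<in>set As. wf_fm L A)"
  unfolding Conjs_def by (induction As) auto

lemma wf_Disjs: "wf_fm L (Disjs As) \<longleftrightarrow> (\<forall>A\<in>set As. wf_fm L A)"
  unfolding Disjs_def by (induction As) auto

lemma wf_Foralls: "wf_fm L (Foralls vs A) \<longleftrightarrow> wf_fm L A"
  unfolding Foralls_def by (induction vs) auto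

lemma fv_Conjs: "fv (Conjs As) = (\<Union>A\<in>set As. fv A)"
  unfolding Conjs_def by (induction As) auto

lemma fv_Disjs: "fv (Disjs As) = (\<Union>A\<in>set As. fv A)"
  unfolding Disjs_def by (induction As) auto

lemma fv_Foralls: "fv (Foralls vs A) = fv A - set vs"
  unfolding Foralls_def by (induction vs) auto

lemma wf_Eqs: "wf_fm L (Eqs vs ws)"
  unfolding Eqs_def by (auto simp: wf_Conjs)

lemma fv_Eqs: "fv (Eqs vs ws) \<subseteq> set vs \<union> set ws"
  unfolding Eqs_def by (auto simp: fv_Conjs dest: set_zip_leftD set_zip_rightD)

lemma sat_Eqs: "length vs = length ws \<Longrightarrow> sat M e (Eqs vs ws) \<longleftrightarrow> map e vs = map e ws"
  unfolding Eqs_def by (induction vs ws rule: list_induct2) (auto simp: sat_Conjs)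

text \<open>All assignments that differ from \<open>e\<close> only on \<open>vs\<close> describe the
  whole block at once, so repeated variables in \<open>vs\<close> are covered.\<close>

lemma sat_Foralls:
  "sat M e (Foralls vs A) \<longleftrightarrow>
     (\<forall>e'. (\<forall>v. v \<notin> set vs \<longrightarrow> e' v = e v) \<longrightarrow> (\<forall>v\<in>set vs. e' v \<in> Univ M) \<longrightarrow> sat M e' A)"
  unfolding Foralls_def
proof (induction vs arbitrary: e)
  case Nil
  have "e' = e" if "\<forall>v. v \<notin> set [] \<longrightarrow> e' v = e v" for e' using that by auto
  then show ?case by auto
next
  case (Cons w vs)
  show ?case
  proof
    assume *: "sat M e (foldr Forall (w # vs) A)"
    show "\<forall>e'. (\<forall>v. v \<notin> set (w # vs) \<longrightarrow> e' v = e v) \<longrightarrow> (\<forall>v\<in>set (w # vs). e' v \<in> Univ M) \<longrightarrow> sat M e' A"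
    proof (intro allI impI)
      fix e' assume e': "\<forall>v. v \<notin> set (w # vs) \<longrightarrow> e' v = e v" "\<forall>v\<in>set (w # vs). e' v \<in> Univ M"
      have "sat M (e(w := e' w)) (foldr Forall vs A)" using * e'(2) by simp
      then show "sat M e' A" unfolding Cons.IH using e' by simp
    qed
  next
    assume *: "\<forall>e'. (\<forall>v. v \<notin> set (w # vs) \<longrightarrow> e' v = e v) \<longrightarrow> (\<forall>v\<in>set (w # vs). e' v \<in> Univ M) \<longrightarrow> sat M e' A"
    have "sat M (e(w := u)) (foldr Forall vs A)" if u: "u \<in> Univ M" for u
      unfolding Cons.IH
    proof (intro allI impI)
      fix e' assume e': "\<forall>v. v \<notin> set vs \<longrightarrow> e' v = (e(w := u)) v" "\<forall>v\<in>set vs. e' v \<in> Univ M"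
      have "e' w \<in> Univ M" using e' u by (cases "w \<in> set vs") auto
      then show "sat M e' A" using *[rule_format, of e'] e' by auto
    qed
    then show "sat M e (foldr Forall (w # vs) A)" by simp
  qed
qed

text \<open>The set of all \<open>i\<close> for which \<open>P i\<close> is true is the largest
  candidate, so the disjunction over index sets comes down to its size.\<close>

lemma sat_Maj: "sat M e (Maj n P) \<longleftrightarrow> n < 2 * card {i. i < n \<and> sat M e (P i)}"
proof -
  have dist: "length I = card (set I)" if "I \<in> set (subseqs [0..<n])" for I
    using that by (metis distinct_card distinct_upt subseqs_distinctD)
  have sub: "set ` set (subseqs [0..<n]) = Pow {..<n}"
    by (simp add: subseqs_powset lessThan_atLeast0)
  have "sat M e (Maj n P) \<longleftrightarrow>
      (\<exists>I\<in>set (subseqs [0..<n]). real n / 2 < real (length I) \<and> (\<forall>i\<in>set I. sat M e (P i)))"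
    unfolding Maj_def by (auto simp: sat_Disjs sat_Conjs)
  also have "\<dots> \<longleftrightarrow> (\<exists>I\<in>set (subseqs [0..<n]). n < 2 * card (set I) \<and> (\<forall>i\<in>set I. sat M e (P i)))"
  proof (rule bex_cong[OF refl])
    fix I assume "I \<in> set (subseqs [0..<n])"
    then have "length I = card (set I)" by (rule dist)
    moreover have "real n / 2 < real m \<longleftrightarrow> n < 2 * m" for m by linarith
    ultimately show "(real n / 2 < real (length I) \<and> (\<forall>i\<in>set I. sat M e (P i)))
      = (n < 2 * card (set I) \<and> (\<forall>i\<in>set I. sat M e (P i)))" by simp
  qed
  also have "\<dots> \<longleftrightarrow> (\<exists>J\<in>set ` set (subseqs [0..<n]). n < 2 * card J \<and> (\<forall>i\<in>J. sat M e (P i)))" by blast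
  also have "\<dots> \<longleftrightarrow> n < 2 * card {i. i < n \<and> sat M e (P i)}"
    unfolding sub
  proof
    assume "\<exists>J\<in>Pow {..<n}. n < 2 * card J \<and> (\<forall>i\<in>J. sat M e (P i))"
    then obtain J where J: "J \<subseteq> {..<n}" "n < 2 * card J" "\<forall>i\<in>J. sat M e (P i)" by blast
    have "card J \<le> card {i. i < n \<and> sat M e (P i)}" by (rule card_mono) (use J in auto)
    then show "n < 2 * card {i. i < n \<and> sat M e (P i)}" using J(2) by linarith
  next
    assume "n < 2 * card {i. i < n \<and> sat M e (P i)}"
    then show "\<exists>J\<in>Pow {..<n}. n < 2 * card J \<and> (\<forall>i\<in>J. sat M e (P i))"
      by (intro bexI[of _ "{i. i < n \<and> sat M e (P i)}"]) auto
  qed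
  finally show ?thesis .
qed

lemma fv_Maj: "fv (Maj n P) \<subseteq> (\<Union>i<n. fv (P i))"
proof -
  have "set I \<subseteq> {..<n}" if "I \<in> set (subseqs [0..<n])" for I
  proof -
    have "set I \<in> set ` set (subseqs [0..<n])" using that by (rule imageI)
    then show ?thesis unfolding subseqs_powset by auto
  qed
  then show ?thesis unfolding Maj_def by (fastforce simp: fv_Disjs fv_Conjs)
qed

lemma wf_Maj: "(\<And>i. wf_fm L (P i)) \<Longrightarrow> wf_fm L (Maj n P)"
  unfolding Maj_def by (auto simp: wf_Disjs wf_Conjs)

lemma map_assign: "distinct vs \<Longrightarrow> length vs = length us \<Longrightarrow> map (assign vs us) vs = us"
  by (rule nth_equalityI) (simp_all add: assign_def map_of_zip_nth)

lemma assign_map: "distinct vs \<Longrightarrow> v \<in> set vs \<Longrightarrow> assign vs (map e vs) v = e v"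
  using map_assign[of vs "map e vs"] by simp

lemma sat_iff_holds:
  assumes "partitioned L \<phi> x y"
  shows "sat M e \<phi> \<longleftrightarrow> holds M \<phi> x (map e x) y (map e y)"
  unfolding holds_def
proof (rule sat_cong)
  fix v assume "v \<in> fv \<phi>"
  then have "v \<in> set (x @ y)" "distinct (x @ y)" using assms unfolding partitioned_def by auto
  then show "e v = assign (x @ y) (map e x @ map e y) v"
    using assign_map[of "x @ y" v e] by simp
qed

section \<open>The meaning and the variables of the majority formula\<close>

context
  fixes L :: "('f, 'r) lang" and \<phi> :: "('f, 'r) fm" and x y :: "var list"
  assumes \<phi>: "partitioned L \<phi> x y"
begin

definition fresh_tuple :: "var list \<Rightarrow> bool" where
  "fresh_tuple w \<longleftrightarrow> length w = length x \<and> set w \<inter> (set x \<union> set y \<union> vars_fm \<phi>) = {}"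

text \<open>The variables of \<open>w\<close> do not occur in \<open>\<phi>\<close>, so the renaming
  captures nothing; those of \<open>y\<close> stay in place because \<open>x\<close> and
  \<open>y\<close> are disjoint.\<close>

lemma sat_subst_tuple:
  assumes w: "fresh_tuple w"
  shows "sat M e (subst_tuple x w \<phi>) \<longleftrightarrow> holds M \<phi> x (map e w) y (map e y)"
proof -
  let ?s = "\<lambda>v. case map_of (zip x w) v of Some u \<Rightarrow> u | None \<Rightarrow> v"
  have len: "length x = length w" and disj: "set w \<inter> vars_fm \<phi> = {}"
    using w unfolding fresh_tuple_def by auto
  have dist: "distinct x" "set x \<inter> set y = {}" using \<phi> unfolding partitioned_def by auto
  have "sat M e (subst_tuple x w \<phi>) = sat M (\<lambda>v. e (?s v)) \<phi>"
    unfolding subst_tuple_def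
  proof (rule sat_rename)
    fix v
    show "?s v = v \<or> ?s v \<notin> vars_fm \<phi>"
    proof (cases "map_of (zip x w) v")
      case (Some u)
      then have "u \<in> set w" by (meson map_of_SomeD set_zip_rightD)
      then show ?thesis using Some disj by auto
    qed simp
  qed
  also have "\<dots> \<longleftrightarrow> holds M \<phi> x (map (\<lambda>v. e (?s v)) x) y (map (\<lambda>v. e (?s v)) y)"
    by (rule sat_iff_holds[OF \<phi>])
  also have "map (\<lambda>v. e (?s v)) x = map e w"
    by (rule nth_equalityI) (use len dist(1) in \<open>simp_all add: map_of_zip_nth\<close>)
  also have "map (\<lambda>v. e (?s v)) y = map e y"
  proof (rule map_cong[OF refl])
    fix v assume "v \<in> set y"
    then have "v \<notin> set x" using dist(2) by blast
    then have "map_of (zip x w) v = None" using len by simp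
    then show "e (?s v) = e v" by simp
  qed
  finally show ?thesis .
qed

lemma fv_subst_tuple:
  assumes "fresh_tuple w"
  shows "fv (subst_tuple x w \<phi>) \<subseteq> set w \<union> set y"
proof -
  let ?s = "\<lambda>v. case map_of (zip x w) v of Some u \<Rightarrow> u | None \<Rightarrow> v"
  have len: "length x = length w" using assms unfolding fresh_tuple_def by simp
  have "?s v \<in> set w \<union> set y" if v: "v \<in> set x \<union> set y" for v
  proof (cases "map_of (zip x w) v")
    case None
    then have "v \<notin> set x" using len by simp
    then show ?thesis using None v by simp
  next
    case (Some u)
    then have "u \<in> set w" by (meson map_of_SomeD set_zip_rightD)
    then show ?thesis using Some by simp
  qed
  moreover have "fv \<phi> \<subseteq> set x \<union> set y" using \<phi> unfolding partitioned_def by simp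
  ultimately have "?s ` fv \<phi> \<subseteq> set w \<union> set y" by blast
  then show ?thesis using fv_rename unfolding subst_tuple_def by (rule order_trans[rotated])
qed

text \<open>Quantifying over \<open>y\<close> leaves the values of \<open>x\<close> and of the fresh
  tuples unchanged, so these are read off from \<open>e\<close> while \<open>b\<close> runs over the
  values of \<open>y\<close>.\<close>

lemma sat_maj_formula:
  assumes fresh: "\<And>i j. i < n \<Longrightarrow> j < k \<Longrightarrow> fresh_tuple (z i j) \<and> fresh_tuple (z' i j) \<and> fresh_tuple (z'' i j)"
  shows "sat M e (maj_formula \<phi> x y n k z z' z'') \<longleftrightarrow>
    n < 2 * card {i. i < n \<and> (\<forall>b\<in>tuples (Univ M) y.
      (\<forall>j<k. holds M \<phi> x (map e (z i j)) y b \<longleftrightarrow> map e (z' i j) = map e (z'' i j)) \<longrightarrow>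
      holds M \<phi> x (map e x) y b)}"
proof -
  let ?B = "\<lambda>i. Imp (Conjs (map (\<lambda>j. Iff (subst_tuple x (z i j) \<phi>) (Eqs (z' i j) (z'' i j))) [0..<k])) \<phi>"
  let ?C = "\<lambda>i b. (\<forall>j<k. holds M \<phi> x (map e (z i j)) y b \<longleftrightarrow> map e (z' i j) = map e (z'' i j)) \<longrightarrow>
      holds M \<phi> x (map e x) y b"
  have dist: "distinct y" "set x \<inter> set y = {}" using \<phi> unfolding partitioned_def by auto
  have body: "sat M e' (?B i) \<longleftrightarrow> ?C i (map e' y)"
    if i: "i < n" and e': "\<forall>v. v \<notin> set y \<longrightarrow> e' v = e v" for i e'
  proof -
    have same: "map e' w = map e w" if "set w \<inter> set y = {}" for w
      using e' that by (intro map_cong[OF refl]) blast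
    have "sat M e' (Iff (subst_tuple x (z i j) \<phi>) (Eqs (z' i j) (z'' i j))) \<longleftrightarrow>
        (holds M \<phi> x (map e (z i j)) y (map e' y) \<longleftrightarrow> map e (z' i j) = map e (z'' i j))"
      if j: "j < k" for j
    proof -
      have f: "fresh_tuple (z i j)" "fresh_tuple (z' i j)" "fresh_tuple (z'' i j)" using fresh[OF i j] by auto
      then have "length (z' i j) = length (z'' i j)" unfolding fresh_tuple_def by simp
      then have "sat M e' (Eqs (z' i j) (z'' i j)) \<longleftrightarrow> map e' (z' i j) = map e' (z'' i j)" by (rule sat_Eqs)
      moreover have "map e' (z i j) = map e (z i j)" "map e' (z' i j) = map e (z' i j)"
        "map e' (z'' i j) = map e (z'' i j)"
        using f unfolding fresh_tuple_def by (simp_all add: same disjoint_iff)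
      ultimately show ?thesis using sat_subst_tuple[OF f(1), of M e'] by (simp del: map_eq_conv)
    qed
    moreover have "sat M e' \<phi> \<longleftrightarrow> holds M \<phi> x (map e x) y (map e' y)"
      using sat_iff_holds[OF \<phi>, of M e'] same[OF dist(2)] by (simp del: map_eq_conv)
    ultimately show ?thesis by (simp add: sat_Conjs_upt del: map_eq_conv)
  qed
  have "sat M e (Foralls y (?B i)) \<longleftrightarrow> (\<forall>b\<in>tuples (Univ M) y. ?C i b)" if i: "i < n" for i
  proof
    assume *: "sat M e (Foralls y (?B i))"
    show "\<forall>b\<in>tuples (Univ M) y. ?C i b"
    proof
      fix b assume b: "b \<in> tuples (Univ M) y"
      let ?e = "\<lambda>v. if v \<in> set y then assign y b v else e v"
      have "map ?e y = map (assign y b) y" by (rule map_cong[OF refl]) simp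
      also have "map (assign y b) y = b"
        by (rule map_assign[OF dist(1)]) (use b in \<open>simp add: tuples_def\<close>)
      finally have m: "map ?e y = b" .
      have dom: "\<forall>v\<in>set y. ?e v \<in> Univ M"
      proof
        fix v assume "v \<in> set y"
        then have "?e v \<in> set (map ?e y)" unfolding set_map by (rule imageI)
        then show "?e v \<in> Univ M" unfolding m using b unfolding tuples_def by blast
      qed
      have off: "\<forall>v. v \<notin> set y \<longrightarrow> ?e v = e v" by simp
      have "sat M ?e (?B i)" by (rule *[unfolded sat_Foralls, THEN spec, THEN mp, THEN mp, OF off dom])
      then show "?C i b" unfolding body[OF i off] m .
    qed
  next
    assume *: "\<forall>b\<in>tuples (Univ M) y. ?C i b"
    show "sat M e (Foralls y (?B i))"
      unfolding sat_Foralls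
    proof (intro allI impI)
      fix e' assume e': "\<forall>v. v \<notin> set y \<longrightarrow> e' v = e v" "\<forall>v\<in>set y. e' v \<in> Univ M"
      have "map e' y \<in> tuples (Univ M) y" using e'(2) unfolding tuples_def by auto
      then have "?C i (map e' y)" by (rule bspec[OF *])
      then show "sat M e' (?B i)" by (rule iffD2[OF body[OF i e'(1)]])
    qed
  qed
  then have "{i. i < n \<and> sat M e (Foralls y (?B i))} = {i. i < n \<and> (\<forall>b\<in>tuples (Univ M) y. ?C i b)}"
    by (intro Collect_cong conj_cong refl)
  then show ?thesis unfolding maj_formula_def sat_Maj by (rule arg_cong)
qed

lemma wf_maj_formula: "wf_fm L (maj_formula \<phi> x y n k z z' z'')"
proof -
  have "wf_fm L \<phi>" using \<phi> unfolding partitioned_def by simp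
  then show ?thesis unfolding maj_formula_def subst_tuple_def
    by (intro wf_Maj) (auto simp: wf_Foralls wf_Conjs wf_Eqs wf_rename)
qed

lemma set_matrix_list: "set (matrix_list n k z) = (\<Union>i<n. z i ` {..<k})"
  unfolding matrix_list_def by auto

lemma fv_maj_formula:
  assumes fresh: "\<And>i j. i < n \<Longrightarrow> j < k \<Longrightarrow> fresh_tuple (z i j)"
  shows "fv (maj_formula \<phi> x y n k z z' z'') \<subseteq> set x \<union> set (concat (maj_vars n k z z' z''))"
proof -
  have \<phi>v: "fv \<phi> \<subseteq> set x \<union> set y" using \<phi> unfolding partitioned_def by simp
  let ?I = "\<lambda>i j. Iff (subst_tuple x (z i j) \<phi>) (Eqs (z' i j) (z'' i j))"
  have I: "fv (?I i j) \<subseteq> set y \<union> set (concat (maj_vars n k z z' z''))" if ij: "i < n" "j < k" for i j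
  proof -
    have "set w \<subseteq> set (concat (maj_vars n k z z' z''))" if "w \<in> {z i j, z' i j, z'' i j}" for w
      using that ij unfolding maj_vars_def by (auto simp: set_matrix_list)
    then have "set (z i j) \<union> set (z' i j) \<union> set (z'' i j) \<subseteq> set (concat (maj_vars n k z z' z''))" by simp
    then show ?thesis using fv_subst_tuple[OF fresh[OF ij]] fv_Eqs[of "z' i j" "z'' i j"] by auto
  qed
  have "fv (Foralls y (Imp (Conjs (map (?I i) [0..<k])) \<phi>)) \<subseteq> set x \<union> set (concat (maj_vars n k z z' z''))"
    if i: "i < n" for i
  proof -
    have "fv (Conjs (map (?I i) [0..<k])) \<subseteq> set y \<union> set (concat (maj_vars n k z z' z''))"
      unfolding fv_Conjs using I[OF i] by fastforce
    then show ?thesis unfolding fv_Foralls using \<phi>v by auto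
  qed
  then show ?thesis unfolding maj_formula_def by (intro order_trans[OF fv_Maj] UN_least) simp
qed

lemma fresh_tuples_maj_vars:
  assumes "fresh_tuples \<phi> x y (maj_vars n k z z' z'')" "i < n" "j < k"
  shows "fresh_tuple (z i j)" "fresh_tuple (z' i j)" "fresh_tuple (z'' i j)"
proof -
  have "fresh_tuple w" if "w \<in> set (maj_vars n k z z' z'')" for w
    using assms(1) that unfolding fresh_tuples_def fresh_tuple_def by auto
  moreover have "z i j \<in> set (maj_vars n k z z' z'')" "z' i j \<in> set (maj_vars n k z z' z'')"
    "z'' i j \<in> set (maj_vars n k z z' z'')"
    using assms(2,3) unfolding maj_vars_def by (auto simp: set_matrix_list)
  ultimately show "fresh_tuple (z i j)" "fresh_tuple (z' i j)" "fresh_tuple (z'' i j)" by auto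
qed

lemma z_partitioned_maj_formula:
  assumes fresh: "fresh_tuples \<phi> x y (maj_vars n k z z' z'')"
  shows "z_partitioned L (maj_formula \<phi> x y n k z z' z'') x (maj_vars n k z z' z'')"
  unfolding z_partitioned_def partitioned_def
proof (intro conjI)
  show "\<forall>w\<in>set (maj_vars n k z z' z''). length w = length x"
    using fresh unfolding fresh_tuples_def by blast
  show "wf_fm L (maj_formula \<phi> x y n k z z' z'')" by (rule wf_maj_formula)
  show "distinct (x @ concat (maj_vars n k z z' z''))"
    using fresh \<phi> unfolding fresh_tuples_def partitioned_def by auto
  show "fv (maj_formula \<phi> x y n k z z' z'') \<subseteq> set (x @ concat (maj_vars n k z z' z''))"
    using fv_maj_formula[of n k z z' z''] fresh_tuples_maj_vars[OF fresh] by simp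
qed

end

section \<open>Existence of fresh variables\<close>

lemma concat_intervals:
  "concat (map (\<lambda>j. [b + j * l..<b + Suc j * l]) [0..<k]) = [b..<b + k * l]"
proof (induction k)
  case (Suc k)
  have "[b..<b + Suc k * l] = [b..<b + k * l] @ [b + k * l..<b + Suc k * l]"
    using upt_add_eq_append[of b "b + k * l" l] by (simp add: algebra_simps)
  then show ?case using Suc by simp
qed simp

lemma concat_matrix_intervals:
  "concat (matrix_list n k (\<lambda>i j. [b + i * (k * l) + j * l..<b + i * (k * l) + Suc j * l])) = [b..<b + n * (k * l)]"
proof -
  have "concat (matrix_list n k (\<lambda>i j. [b + i * (k * l) + j * l..<b + i * (k * l) + Suc j * l]))
      = concat (map (\<lambda>i. concat (map (\<lambda>j. [b + i * (k * l) + j * l..<b + i * (k * l) + Suc j * l]) [0..<k])) [0..<n])"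
    unfolding matrix_list_def by (induction n) simp_all
  also have "\<dots> = concat (map (\<lambda>i. [b + i * (k * l)..<b + Suc i * (k * l)]) [0..<n])"
  proof (intro arg_cong[where f = concat] map_cong refl)
    fix i
    have "b + i * (k * l) + k * l = b + Suc i * (k * l)" by simp
    then show "concat (map (\<lambda>j. [b + i * (k * l) + j * l..<b + i * (k * l) + Suc j * l]) [0..<k])
        = [b + i * (k * l)..<b + Suc i * (k * l)]"
      using concat_intervals[of "b + i * (k * l)" l k] by (simp only:)
  qed
  also have "\<dots> = [b..<b + n * (k * l)]" by (rule concat_intervals)
  finally show ?thesis .
qed

text \<open>Above a bound \<open>b\<close> for all variables in use, consecutive intervals of length
  \<open>l\<close> serve as tuples, in three blocks of \<open>n * (k * l)\<close> variables for
  \<open>z\<close>, \<open>z'\<close> and \<open>z''\<close>.\<close>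

lemma fresh_maj_vars_exist: "\<exists>z z' z''. fresh_tuples \<phi> x y (maj_vars n k z z' z'')"
proof -
  let ?V = "set x \<union> set y \<union> vars_fm \<phi>"
  obtain b where b: "\<And>v. v \<in> ?V \<Longrightarrow> v < b"
    using finite_nat_set_iff_bounded[of ?V] finite_vars_fm by auto
  define l where "l = length x"
  define Z where "Z b i j = [b + i * (k * l) + j * l..<b + i * (k * l) + Suc j * l]" for b i j :: nat
  define m where "m = n * (k * l)"
  have Z: "concat (matrix_list n k (Z b)) = [b..<b + m]" for b
    unfolding Z_def m_def by (rule concat_matrix_intervals)
  have conc: "concat (maj_vars n k (Z b) (Z (b + m)) (Z (b + m + m))) = [b..<b + m + m + m]"
    using upt_add_eq_append[of b "b + m" m] upt_add_eq_append[of b "b + m + m" m]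
    unfolding maj_vars_def concat_append Z by simp
  have "length (Z b i j) = length x" for b i j unfolding Z_def l_def by simp
  then have "\<forall>w\<in>set (maj_vars n k (Z b) (Z (b + m)) (Z (b + m + m))). length w = length x"
    unfolding maj_vars_def matrix_list_def by auto
  moreover have "distinct (concat (maj_vars n k (Z b) (Z (b + m)) (Z (b + m + m))))"
    unfolding conc by simp
  moreover have "set (concat (maj_vars n k (Z b) (Z (b + m)) (Z (b + m + m)))) \<inter> ?V = {}"
    unfolding conc using b by fastforce
  ultimately show ?thesis unfolding fresh_tuples_def by blast
qed

section \<open>Honest definitions\<close>

definition closure_class :: "'p set set \<Rightarrow> 'p set set" where
  "closure_class F = {c. \<forall>S. finite S \<longrightarrow> (\<exists>z\<in>F. z \<inter> S = c \<inter> S)}"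

lemma closure_classD: "c \<in> closure_class F \<Longrightarrow> finite S \<Longrightarrow> \<exists>z\<in>F. z \<inter> S = c \<inter> S"
  unfolding closure_class_def by simp

lemma subset_closure_class: "F \<subseteq> closure_class F"
  unfolding closure_class_def by auto

lemma closed_closure_class: "closed_class (closure_class F)"
  unfolding closed_class_def
proof (intro allI impI)
  fix c assume *: "\<forall>S. finite S \<longrightarrow> (\<exists>z\<in>closure_class F. z \<inter> S = c \<inter> S)"
  have "\<exists>z\<in>F. z \<inter> S = c \<inter> S" if S: "finite S" for S
  proof -
    obtain u where u: "u \<in> closure_class F" "u \<inter> S = c \<inter> S" using * S by meson
    show ?thesis using closure_classD[OF u(1) S] unfolding u(2) .
  qed
  then show "c \<in> closure_class F" unfolding closure_class_def by simp
qed

text \<open>Shattering a finite set concerns only traces on it, and passing to the closure adds no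
  trace on a finite set.\<close>

lemma vc_le_closure_class:
  assumes "vc_le F d"
  shows "vc_le (closure_class F) d"
  unfolding vc_le_def
proof (intro allI impI)
  fix S :: "'a set" assume S: "finite S" "shatters (closure_class F) S"
  have "shatters F S"
    unfolding shatters_def
  proof (intro allI impI)
    fix B assume "B \<subseteq> S"
    then obtain c where c: "c \<in> closure_class F" "c \<inter> S = B" using shattersD[OF S(2)] by meson
    show "\<exists>z\<in>F. z \<inter> S = B" using closure_classD[OF c(1) S(1)] unfolding c(2) .
  qed
  then show "card S \<le> d" by (rule vc_leD[OF assms S(1)])
qed

lemma vc_dim_imp_vc_le:
  assumes "vc_dim F < \<infinity>"
  shows "vc_le F (the_enat (vc_dim F))"
  unfolding vc_le_def
proof (intro allI impI)
  fix S assume "finite S" "shatters F S"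
  then have "enat (card S) \<le> vc_dim F" unfolding vc_dim_def by (intro Sup_upper) blast
  then show "card S \<le> the_enat (vc_dim F)" using assms by (cases "vc_dim F") auto
qed

text \<open>The inequality says \<open>m > 2 ^ (d + 2) - 2\<close>, and \<open>m\<close> is an
  integer.\<close>

lemma least_majority: "(LEAST m. real m / 2 > 2 ^ (d + 1) - 1) = 2 ^ (d + 2) - 1"
proof (rule Least_equality)
  have "real (2 ^ (d + 2) - 1) = 2 ^ (d + 2) - 1" by (simp add: of_nat_diff)
  then show "real (2 ^ (d + 2) - 1) / 2 > 2 ^ (d + 1) - 1" by simp
next
  fix m assume "real m / 2 > 2 ^ (d + 1) - 1"
  then have "real (2 ^ (d + 2)) < real (m + 2)" by simp
  then have "2 ^ (d + 2) < m + 2" by (simp only: of_nat_less_iff)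
  then show "2 ^ (d + 2) - 1 \<le> m" by simp
qed

section \<open>Evaluation at tuples of parameters\<close>

lemma length_matrix_list: "length (matrix_list n k z) = n * k"
  unfolding matrix_list_def by (simp add: length_concat comp_def sum_list_triv)

lemma matrix_list_eqD:
  assumes "matrix_list n k z = matrix_list n k w" "i < n" "j < k"
  shows "z i j = w i j"
proof -
  have "map (\<lambda>i. map (z i) [0..<k]) [0..<n] = map (\<lambda>i. map (w i) [0..<k]) [0..<n]"
  proof (rule iffD1[OF concat_eq_concat_iff])
    show "concat (map (\<lambda>i. map (z i) [0..<k]) [0..<n]) = concat (map (\<lambda>i. map (w i) [0..<k]) [0..<n])"
      using assms(1) unfolding matrix_list_def .
  qed (auto simp: in_set_zip)
  then show ?thesis using assms(2,3) by simp
qed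

text \<open>Has the layout of \<open>maj_vars\<close> with entries of any type, so that values of
  variables and parameters can be compared position by position.\<close>

definition maj_params ::
  "nat \<Rightarrow> nat \<Rightarrow> (nat \<Rightarrow> nat \<Rightarrow> 'a) \<Rightarrow> (nat \<Rightarrow> nat \<Rightarrow> 'a) \<Rightarrow> (nat \<Rightarrow> nat \<Rightarrow> 'a) \<Rightarrow> 'a list" where
  "maj_params n k E E' E'' = matrix_list n k E @ matrix_list n k E' @ matrix_list n k E''"

lemma maj_params_eqD:
  assumes "maj_params n k z z' z'' = maj_params n k w w' w''" "i < n" "j < k"
  shows "z i j = w i j" "z' i j = w' i j" "z'' i j = w'' i j"
proof -
  have "matrix_list n k z = matrix_list n k w" "matrix_list n k z' = matrix_list n k w'"
    "matrix_list n k z'' = matrix_list n k w''"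
    using assms(1) unfolding maj_params_def by (simp_all add: length_matrix_list)
  then show "z i j = w i j" "z' i j = w' i j" "z'' i j = w'' i j"
    using matrix_list_eqD assms(2,3) by metis+
qed

lemma map_matrix_list: "map f (matrix_list n k z) = matrix_list n k (\<lambda>i j. f (z i j))"
  unfolding matrix_list_def by (simp add: map_concat comp_def)

lemma length_concat_uniform: "\<forall>w\<in>set ws. length w = l \<Longrightarrow> length (concat ws) = length ws * l"
  by (induction ws) auto

text \<open>Since all tuples have the length of \<open>x\<close>, the concatenated list of values
  can be cut back into tuples in only one way.\<close>

lemma assign_maj_vars:
  assumes dist: "distinct (x @ concat (maj_vars n k z z' z''))"
    and len: "\<forall>w\<in>set (maj_vars n k z z' z''). length w = length x"
    and a: "length a = length x"
    and E: "\<forall>w\<in>set (maj_params n k E E' E''). length w = length x"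
  defines "f \<equiv> assign (x @ concat (maj_vars n k z z' z'')) (a @ concat (maj_params n k E E' E''))"
  shows "map f x = a"
    and "\<And>i j. i < n \<Longrightarrow> j < k \<Longrightarrow> map f (z i j) = E i j \<and> map f (z' i j) = E' i j \<and> map f (z'' i j) = E'' i j"
proof -
  let ?Z = "maj_vars n k z z' z''" and ?E = "maj_params n k E E' E''"
  have lenZE: "length ?Z = length ?E" by (simp add: maj_vars_def maj_params_def length_matrix_list)
  have "length (x @ concat ?Z) = length (a @ concat ?E)"
    using length_concat_uniform[OF E] length_concat_uniform[OF len] lenZE a by simp
  then have "map f (x @ concat ?Z) = a @ concat ?E"
    unfolding f_def using dist by (intro map_assign)
  then have m: "map f x = a" "map f (concat ?Z) = concat ?E" using a by simp_all
  show "map f x = a" by (rule m)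
  have "map (map f) ?Z = ?E"
  proof (rule iffD1[OF concat_eq_concat_iff])
    show "concat (map (map f) ?Z) = concat ?E" using m(2) by (simp add: map_concat)
    show "\<forall>(u, v)\<in>set (zip (map (map f) ?Z) ?E). length u = length v"
    proof clarify
      fix u v assume uv: "(u, v) \<in> set (zip (map (map f) ?Z) ?E)"
      from uv have "u \<in> set (map (map f) ?Z)" by (rule set_zip_leftD)
      moreover from uv have "v \<in> set ?E" by (rule set_zip_rightD)
      ultimately show "length u = length v" using len E by auto
    qed
  qed (simp add: lenZE)
  then have "maj_params n k (\<lambda>i j. map f (z i j)) (\<lambda>i j. map f (z' i j)) (\<lambda>i j. map f (z'' i j)) = ?E"
    by (simp add: maj_vars_def maj_params_def map_matrix_list)
  from maj_params_eqD[OF this] show "map f (z i j) = E i j \<and> map f (z' i j) = E' i j \<and> map f (z'' i j) = E'' i j"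
    if "i < n" "j < k" for i j using that by simp
qed

text \<open>An isolating set has at most \<open>k\<close> points while the formula has exactly
  \<open>k\<close> slots for it; the remaining slots are filled with \<open>a\<close>.\<close>

lemma list_covering:
  assumes "finite Y" "card Y \<le> k" "Y \<subseteq> A" "a \<in> A"
  shows "\<exists>ys. length ys = k \<and> Y \<subseteq> set ys \<and> set ys \<subseteq> A"
proof -
  obtain xs where xs: "set xs = Y" "distinct xs" using finite_distinct_list[OF assms(1)] by blast
  then have "length xs \<le> k" using assms(2) distinct_card by fastforce
  then show ?thesis using xs assms(3,4) by (intro exI[of _ "xs @ replicate (k - length xs) a"]) auto
qed

text \<open>The majority of the compressible points \<open>h i\<close> is \<open>g\<close>. The
  \<open>i\<close>-th part of the formula says that the pattern of \<open>h i\<close> on its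
  isolating points \<open>E i j\<close> forces \<open>\<phi>(a, y)\<close>: on \<open>A0\<close>
  this holds for all members of \<open>h i\<close>, and on all of \<open>A\<close> it holds for no
  other points.\<close>

lemma honest_definition_maj_formula:
  fixes M :: "('f, 'r, 'u) fo_struct"
  assumes \<phi>: "partitioned L \<phi> x y" and nip: "NIP M \<phi> x y" and pq: "pq_function N_pq"
    and d: "d = vc M \<phi> x y" and n: "n = 2 ^ (d + 2) - 1" and k: "k = k_sd (N_pq n (2 ^ (d + 1))) d"
    and fresh: "fresh_tuples \<phi> x y (maj_vars n k z z' z'')"
    and A: "A \<subseteq> tuples (Univ M) x" and ab: "\<alpha> \<in> A" "\<beta> \<in> A" "\<alpha> \<noteq> \<beta>"
    and \<Gamma>: "hype_opp M \<phi> x y k A \<Gamma>"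
  shows "honest_definition M \<phi> x A \<Gamma> (maj_formula \<phi> x y n k z z' z'') (maj_vars n k z z' z'')"
  unfolding honest_definition_def
proof (intro allI impI)
  fix A0 assume A0: "A0 \<subseteq> A" "finite A0"
  \<comment> \<open>Traces are taken inside \<open>A\<close>, so that the members of
    \<open>K\<close> are subsets of \<open>A\<close> and isolating points can be chosen in
    \<open>A\<close>.\<close>
  define tr where "tr b = {a \<in> A. holds M \<phi> x a y b}" for b
  define F where "F = tr ` tuples (Univ M) y"
  define K where "K = closure_class F"
  have trK: "tr b \<in> K" if "b \<in> tuples (Univ M) y" for b
    unfolding K_def F_def by (rule subsetD[OF subset_closure_class imageI[OF that]])
  define g where "g = {a \<in> A. (\<phi>, a) \<in> \<Gamma>}"
  have "vc_le F d"
    unfolding vc_le_def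
  proof (intro allI impI)
    fix S assume S: "finite S" "shatters F S"
    have SA: "S \<subseteq> A" using shattersD[OF S(2), of S] unfolding F_def tr_def by auto
    have "shatters (def_family M \<phi> x y) S"
      unfolding shatters_def
    proof (intro allI impI)
      fix B assume "B \<subseteq> S"
      then obtain c where c: "c \<in> F" "c \<inter> S = B" using shattersD[OF S(2)] by meson
      from c(1) obtain b where b: "c = tr b" "b \<in> tuples (Univ M) y" unfolding F_def by (rule imageE)
      have "{a \<in> tuples (Univ M) x. holds M \<phi> x a y b} \<inter> S = B"
        using c(2) SA A unfolding b(1) tr_def by auto
      moreover have "{a \<in> tuples (Univ M) x. holds M \<phi> x a y b} \<in> def_family M \<phi> x y"
        unfolding def_family_def using b(2) by auto
      ultimately show "\<exists>C\<in>def_family M \<phi> x y. C \<inter> S = B" by (rule bexI)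
    qed
    moreover have "vc_le (def_family M \<phi> x y) d"
      using vc_dim_imp_vc_le nip unfolding d vc_def NIP_def by auto
    ultimately show "card S \<le> d" using S(1) by (simp add: vc_leD)
  qed
  then have vcK: "vc_le K d" unfolding K_def by (rule vc_le_closure_class)
  have clK: "closed_class K" unfolding K_def by (rule closed_closure_class)
  have hype: "\<exists>c\<in>K. c \<inter> Y = g \<inter> Y" if Y: "finite Y" "card Y \<le> k" for Y
  proof -
    let ?f = "\<lambda>a. (if a \<in> g then \<phi> else Neg \<phi>, a)"
    \<comment> \<open>Points of \<open>Y\<close> outside \<open>A\<close> lie neither in a trace nor
      in \<open>g\<close>, so the instances come from \<open>Y \<inter> A\<close>.\<close>
    let ?S = "?f ` (Y \<inter> A)"
    have "?S \<subseteq> \<Gamma>" using \<Gamma> unfolding hype_opp_def g_def by auto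
    moreover have "card ?S \<le> k"
    proof -
      have "card ?S \<le> card (Y \<inter> A)" using Y(1) by (intro card_image_le) simp
      also have "\<dots> \<le> card Y" using Y(1) by (intro card_mono) auto
      finally show ?thesis using Y(2) by simp
    qed
    moreover have "finite ?S" using Y(1) by simp
    ultimately have "consistent M x y ?S" using \<Gamma> unfolding hype_opp_def by meson
    then obtain b where b: "b \<in> tuples (Univ M) y" "\<forall>(\<theta>, a) \<in> ?S. holds M \<theta> x a y b"
      unfolding consistent_def by meson
    have "a \<in> tr b \<longleftrightarrow> a \<in> g" if a: "a \<in> Y" for a
    proof (cases "a \<in> A")
      case True
      then have "?f a \<in> ?S" using a by blast
      then have "holds M (if a \<in> g then \<phi> else Neg \<phi>) x a y b" using b(2) by fastforce
      then show ?thesis using True unfolding tr_def by (auto simp: holds_def split: if_splits)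
    next
      case False
      then show ?thesis unfolding tr_def g_def by simp
    qed
    then have "tr b \<inter> Y = g \<inter> Y" by blast
    moreover have "tr b \<in> K" by (rule trK[OF b(1)])
    ultimately show ?thesis by (rule bexI)
  qed
  obtain h where h: "\<And>i. i < n \<Longrightarrow> h i \<in> K" "\<And>i. i < n \<Longrightarrow> compressible k K {h i}"
    and maj: "\<And>a. n < 2 * card {i. i < n \<and> (a \<in> h i \<longleftrightarrow> a \<in> g)}"
    using majority_of_compressibles[OF clK vcK pq n k hype] by metis
  have KA: "c \<subseteq> A" if c: "c \<in> K" for c
  proof
    fix a assume "a \<in> c"
    obtain z where "z \<in> F" "z \<inter> {a} = c \<inter> {a}"
      using closure_classD[OF c[unfolded K_def], of "{a}"] by auto
    then show "a \<in> A" using \<open>a \<in> c\<close> unfolding F_def tr_def by auto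
  qed
  have "\<exists>ys. length ys = k \<and> set ys \<subseteq> A \<and> (\<forall>c\<in>K. c \<inter> set ys = h i \<inter> set ys \<longrightarrow> c \<inter> A0 = h i \<inter> A0)"
    if i: "i < n" for i
  proof -
    obtain Y where Y: "finite Y" "card Y \<le> k" "isolates K {h i} Y A0"
      using h(2)[OF i] A0(2) by (rule compressibleD)
    have "card (Y \<inter> A) \<le> k" using card_mono[OF Y(1), of "Y \<inter> A"] Y(2) by simp
    then obtain ys where ys: "length ys = k" "Y \<inter> A \<subseteq> set ys" "set ys \<subseteq> A"
      using list_covering[of "Y \<inter> A" k A \<alpha>] Y(1) ab(1) by auto
    have "c \<inter> A0 = h i \<inter> A0" if c: "c \<in> K" "c \<inter> set ys = h i \<inter> set ys" for c
    proof -
      have "c \<inter> Y = h i \<inter> Y" using KA[OF c(1)] KA[OF h(1)[OF i]] ys(2) c(2) by blast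
      then show ?thesis using isolatesD[OF Y(3) singletonI c(1)] by simp
    qed
    then show ?thesis using ys by blast
  qed
  then have "\<forall>i. \<exists>ys. i < n \<longrightarrow> length ys = k \<and> set ys \<subseteq> A \<and>
      (\<forall>c\<in>K. c \<inter> set ys = h i \<inter> set ys \<longrightarrow> c \<inter> A0 = h i \<inter> A0)" by meson
  from choice[OF this] obtain ys where ys: "\<forall>i. i < n \<longrightarrow> length (ys i) = k \<and> set (ys i) \<subseteq> A \<and>
      (\<forall>c\<in>K. c \<inter> set (ys i) = h i \<inter> set (ys i) \<longrightarrow> c \<inter> A0 = h i \<inter> A0)" ..
  then have ys_len: "\<And>i. i < n \<Longrightarrow> length (ys i) = k" and ys_A: "\<And>i. i < n \<Longrightarrow> set (ys i) \<subseteq> A"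
    and ys_iso: "\<And>i c. i < n \<Longrightarrow> c \<in> K \<Longrightarrow> c \<inter> set (ys i) = h i \<inter> set (ys i) \<Longrightarrow> c \<inter> A0 = h i \<inter> A0"
    by meson+
  define E where "E i j = ys i ! j" for i j
  define E' where "E' i j = \<alpha>" for i j :: nat
  \<comment> \<open>Since \<open>\<alpha> \<noteq> \<beta>\<close>, equality of
    \<open>E' i j\<close> and \<open>E'' i j\<close> encodes whether \<open>E i j\<close> belongs to
    \<open>h i\<close>.\<close>
  define E'' where "E'' i j = (if E i j \<in> h i then \<alpha> else \<beta>)" for i j
  let ?Z = "maj_vars n k z z' z''" and ?e = "maj_params n k E E' E''"
  have EA: "E i j \<in> A" if "i < n" "j < k" for i j
    using ys_A[OF that(1)] ys_len[OF that(1)] that(2) unfolding E_def by auto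
  have eA: "set ?e \<subseteq> A"
    using EA ab unfolding maj_params_def by (auto simp: set_matrix_list[OF \<phi>] E'_def E''_def)
  have lenA: "length a = length x" if "a \<in> A" for a using that A unfolding tuples_def by auto
  have e: "?e \<in> tuples A ?Z"
    using eA unfolding tuples_def maj_vars_def maj_params_def by (simp add: length_matrix_list)
  define \<psi> where "\<psi> i a \<longleftrightarrow> (\<forall>b\<in>tuples (Univ M) y.
      (\<forall>j<k. holds M \<phi> x (E i j) y b \<longleftrightarrow> E i j \<in> h i) \<longrightarrow> holds M \<phi> x a y b)" for i a
  have sem: "holds M (maj_formula \<phi> x y n k z z' z'') x a (concat ?Z) (concat ?e)
      \<longleftrightarrow> n < 2 * card {i. i < n \<and> \<psi> i a}" if a: "a \<in> A" for a
  proof -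
    let ?f = "assign (x @ concat ?Z) (a @ concat ?e)"
    have dist: "distinct (x @ concat ?Z)" and lenZ: "\<forall>w\<in>set ?Z. length w = length x"
      using z_partitioned_maj_formula[OF \<phi> fresh] unfolding z_partitioned_def partitioned_def by simp_all
    have lenE: "\<forall>w\<in>set ?e. length w = length x" using eA lenA by blast
    note f = assign_maj_vars[OF dist lenZ lenA[OF a] lenE]
    have "holds M (maj_formula \<phi> x y n k z z' z'') x a (concat ?Z) (concat ?e) \<longleftrightarrow>
      n < 2 * card {i. i < n \<and> (\<forall>b\<in>tuples (Univ M) y.
        (\<forall>j<k. holds M \<phi> x (map ?f (z i j)) y b \<longleftrightarrow> map ?f (z' i j) = map ?f (z'' i j)) \<longrightarrow>
        holds M \<phi> x (map ?f x) y b)}"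
      unfolding holds_def[of M "maj_formula \<phi> x y n k z z' z''"]
      by (rule sat_maj_formula[OF \<phi>]) (use fresh_tuples_maj_vars[OF \<phi> fresh] in blast)
    also have "{i. i < n \<and> (\<forall>b\<in>tuples (Univ M) y.
        (\<forall>j<k. holds M \<phi> x (map ?f (z i j)) y b \<longleftrightarrow> map ?f (z' i j) = map ?f (z'' i j)) \<longrightarrow>
        holds M \<phi> x (map ?f x) y b)} = {i. i < n \<and> \<psi> i a}"
    proof (intro Collect_cong conj_cong refl)
      fix i assume i: "i < n"
      have "holds M \<phi> x (map ?f (z i j)) y b = (map ?f (z' i j) = map ?f (z'' i j)) \<longleftrightarrow>
          holds M \<phi> x (E i j) y b = (E i j \<in> h i)" if "j < k" for j b
        using f(2)[OF i that] ab(3) unfolding E'_def E''_def by (simp del: map_eq_conv)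
      then show "(\<forall>b\<in>tuples (Univ M) y.
        (\<forall>j<k. holds M \<phi> x (map ?f (z i j)) y b \<longleftrightarrow> map ?f (z' i j) = map ?f (z'' i j)) \<longrightarrow>
        holds M \<phi> x (map ?f x) y b) \<longleftrightarrow> \<psi> i a"
        unfolding \<psi>_def f(1) by (simp del: map_eq_conv)
    qed
    finally show ?thesis .
  qed
  \<comment> \<open>The trace of a \<open>b\<close> with the prescribed pattern agrees with
    \<open>h i\<close> on \<open>ys i\<close>, hence on \<open>A0\<close> by isolation.\<close>
  have \<psi>_complete: "\<psi> i a" if i: "i < n" and a: "a \<in> A0" "a \<in> h i" for i a
    unfolding \<psi>_def
  proof (intro ballI impI)
    fix b assume b: "b \<in> tuples (Univ M) y" and ag: "\<forall>j<k. holds M \<phi> x (E i j) y b \<longleftrightarrow> E i j \<in> h i"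
    have "t \<in> tr b \<longleftrightarrow> t \<in> h i" if t: "t \<in> set (ys i)" for t
    proof -
      obtain j where "j < k" "t = E i j"
        using t[unfolded in_set_conv_nth] ys_len[OF i] unfolding E_def by auto
      then show ?thesis using ag EA[OF i] unfolding tr_def by auto
    qed
    then have "tr b \<inter> set (ys i) = h i \<inter> set (ys i)" by blast
    moreover have "tr b \<in> K" by (rule trK[OF b])
    ultimately have "tr b \<inter> A0 = h i \<inter> A0" by (intro ys_iso[OF i])
    then have "a \<in> tr b" using a by blast
    then show "holds M \<phi> x a y b" unfolding tr_def by simp
  qed
  have \<psi>_sound: "a \<in> h i" if i: "i < n" and a: "a \<in> A" "\<psi> i a" for i a
  proof -
    \<comment> \<open>As a limit, \<open>h i\<close> may fail to be a trace itself, but some trace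
      agrees with it on \<open>ys i\<close> and at \<open>a\<close> simultaneously. This works for
      every \<open>a\<close> in \<open>A\<close>.\<close>
    obtain c where c: "c \<in> F" "c \<inter> insert a (set (ys i)) = h i \<inter> insert a (set (ys i))"
      using closure_classD[OF h(1)[OF i, unfolded K_def], of "insert a (set (ys i))"] by auto
    from c(1) obtain b where b: "c = tr b" "b \<in> tuples (Univ M) y" unfolding F_def by (rule imageE)
    have eq: "t \<in> tr b \<longleftrightarrow> t \<in> h i" if "t \<in> insert a (set (ys i))" for t using c(2) that unfolding b(1) by blast
    have "holds M \<phi> x (E i j) y b \<longleftrightarrow> E i j \<in> h i" if j: "j < k" for j
    proof -
      have "E i j \<in> set (ys i)" using j ys_len[OF i] unfolding E_def by simp
      then show ?thesis using eq[of "E i j"] EA[OF i j] unfolding tr_def by simp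
    qed
    then have "holds M \<phi> x a y b" using a(2) b(2) unfolding \<psi>_def by blast
    then show ?thesis using eq[of a] a(1) unfolding tr_def by simp
  qed
  show "\<exists>e\<in>tuples A ?Z.
      (\<forall>a\<in>A0. (\<phi>, a) \<in> \<Gamma> \<longrightarrow> holds M (maj_formula \<phi> x y n k z z' z'') x a (concat ?Z) (concat e)) \<and>
      (\<forall>a\<in>A. holds M (maj_formula \<phi> x y n k z z' z'') x a (concat ?Z) (concat e) \<longrightarrow> (\<phi>, a) \<in> \<Gamma>)"
  proof (rule bexI[OF _ e], intro conjI ballI impI)
    fix a assume a: "a \<in> A0" "(\<phi>, a) \<in> \<Gamma>"
    then have aA: "a \<in> A" and ag: "a \<in> g" using A0(1) unfolding g_def by auto
    \<comment> \<open>At a point of \<open>g\<close> in \<open>A0\<close>, every index whose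
      \<open>h i\<close> agrees with \<open>g\<close> satisfies \<open>\<psi>\<close>.\<close>
    have "card {i. i < n \<and> (a \<in> h i \<longleftrightarrow> a \<in> g)} \<le> card {i. i < n \<and> \<psi> i a}"
      by (rule card_mono) (use \<psi>_complete a(1) ag in auto)
    then show "holds M (maj_formula \<phi> x y n k z z' z'') x a (concat ?Z) (concat ?e)"
      using maj[of a] unfolding sem[OF aA] by linarith
  next
    fix a assume a: "a \<in> A" "holds M (maj_formula \<phi> x y n k z z' z'') x a (concat ?Z) (concat ?e)"
    have "a \<in> g"
    proof (rule ccontr)
      assume "a \<notin> g"
      \<comment> \<open>Outside \<open>g\<close>, an index with \<open>\<psi> i a\<close> has
        \<open>h i\<close> wrong at \<open>a\<close>, and two majorities among \<open>n\<close>
        indices cannot be disjoint.\<close>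
      let ?P = "{i. i < n \<and> \<psi> i a}" and ?Q = "{i. i < n \<and> (a \<in> h i \<longleftrightarrow> a \<in> g)}"
      have "?P \<inter> ?Q = {}" using \<psi>_sound a(1) \<open>a \<notin> g\<close> by blast
      then have "card ?P + card ?Q = card (?P \<union> ?Q)" by (intro card_Un_disjoint[symmetric]) simp_all
      also have "\<dots> \<le> card {..<n}" by (intro card_mono) auto
      finally show False using maj[of a] a(2) unfolding sem[OF a(1)] by simp
    qed
    then show "(\<phi>, a) \<in> \<Gamma>" unfolding g_def by simp
  qed
qed

theorem corollary5p30:
  fixes L :: "('f, 'r) lang"
    and T :: "('f, 'r) fm set"
    and \<U> :: "('f, 'r, 'u) fo_struct"
    and \<phi> :: "('f, 'r) fm"
    and x y :: "var list"
    and N_pq :: "nat \<Rightarrow> nat \<Rightarrow> nat"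
    and d n k :: nat
  assumes "complete_theory L T"
    and "monster_model L T \<U>"
    and "partitioned L \<phi> x y"
    and "NIP \<U> \<phi> x y"
    and "pq_function N_pq"
    and "d = vc \<U> \<phi> x y"
    and "n = (LEAST m. real m / 2 > 2 ^ (d + 1) - 1)"
    and "k = k_sd (N_pq n (2 ^ (d + 1))) d"
  shows
    "(\<exists>\<psi> z. z_partitioned L \<psi> x z \<and>
        (\<forall>A \<Gamma>. A \<subseteq> tuples (Univ \<U>) x \<and> small \<U> A \<and> (\<exists>a \<in> A. \<exists>b \<in> A. a \<noteq> b) \<and>
           hype_opp \<U> \<phi> x y k A \<Gamma> \<longrightarrow>
           honest_definition \<U> \<phi> x A \<Gamma> \<psi> z)) \<and>
     (\<forall>z z' z''. fresh_tuples \<phi> x y (maj_vars n k z z' z'') \<longrightarrow>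
        z_partitioned L (maj_formula \<phi> x y n k z z' z'') x (maj_vars n k z z' z'') \<and>
        (\<forall>A \<Gamma>. A \<subseteq> tuples (Univ \<U>) x \<and> small \<U> A \<and> (\<exists>a \<in> A. \<exists>b \<in> A. a \<noteq> b) \<and>
           hype_opp \<U> \<phi> x y k A \<Gamma> \<longrightarrow>
           honest_definition \<U> \<phi> x A \<Gamma>
             (maj_formula \<phi> x y n k z z' z'') (maj_vars n k z z' z'')))"
proof -
  have n: "n = 2 ^ (d + 2) - 1" using assms(7) least_majority by simp
  have explicit: "z_partitioned L (maj_formula \<phi> x y n k z z' z'') x (maj_vars n k z z' z'') \<and>
      (\<forall>A \<Gamma>. A \<subseteq> tuples (Univ \<U>) x \<and> small \<U> A \<and> (\<exists>a \<in> A. \<exists>b \<in> A. a \<noteq> b) \<and>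
         hype_opp \<U> \<phi> x y k A \<Gamma> \<longrightarrow>
         honest_definition \<U> \<phi> x A \<Gamma> (maj_formula \<phi> x y n k z z' z'') (maj_vars n k z z' z''))"
    if fresh: "fresh_tuples \<phi> x y (maj_vars n k z z' z'')" for z z' z''
  proof (intro conjI allI impI)
    show "z_partitioned L (maj_formula \<phi> x y n k z z' z'') x (maj_vars n k z z' z'')"
      using assms(3) fresh by (rule z_partitioned_maj_formula)
    fix A \<Gamma>
    assume A: "A \<subseteq> tuples (Univ \<U>) x \<and> small \<U> A \<and> (\<exists>a \<in> A. \<exists>b \<in> A. a \<noteq> b) \<and> hype_opp \<U> \<phi> x y k A \<Gamma>"
    then obtain \<alpha> \<beta> where "\<alpha> \<in> A" "\<beta> \<in> A" "\<alpha> \<noteq> \<beta>" by blast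
    then show "honest_definition \<U> \<phi> x A \<Gamma> (maj_formula \<phi> x y n k z z' z'') (maj_vars n k z z' z'')"
      using A by (intro honest_definition_maj_formula[OF assms(3-6) n assms(8) fresh]) simp_all
  qed
  \<comment> \<open>With fresh tuples at hand, the explicit formula also witnesses the existential
    claim.\<close>
  obtain z z' z'' where "fresh_tuples \<phi> x y (maj_vars n k z z' z'')"
    using fresh_maj_vars_exist by meson
  then show ?thesis using explicit by blast
qed

end
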